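(* Suppose the kernel conditions (K1)–(K3) and the distributional conditions (D1)–(D4) of the context hold with $\alpha(p)=O(1)$. Suppose $|\Delta|=0$ and there are positive constants $L_3,U_3<\infty$ (not depending on $p$) and exponents $0\le\delta_3,\delta_4<1$ with $\delta_3\ne\delta_4$ and $\max\{\delta_3,\delta_4\}>0$ such that $$L_3p^{\delta_3/2}\le\big|\mathbb{E}|\tilde X_1|^2-\mathbb{E}|\tilde Y_1|^2\big|\le U_3p^{\delta_3/2}\quad\text{and}\quad L_3p^{\delta_4/2}\le\|\Sigma_X-\Sigma_Y\|_F\le U_3p^{\delta_4/2}.$$ Assume that for any $k=k^{(p)}$ in a sequence of $\mathcal{C}$, $\mathbb{E}[k^4(Z_1,Z_2)]<\infty$, and that $n/N=\rho+O(1/N)$ as $n,m\to\infty$ for some $0<\rho<1$, where $N=n+m$. Then for any $C>0$, $\mathbb{P}(T_{n,m,p}^k>C)\to1$ when $n,m,p\to\infty$ as long as $p=o\big(N^{1/(3-2\max\{\delta_3,\delta_4\})}\big)$.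
   Context: Kernel: a kernel on $\mathbb{R}^p$ is a symmetric function $k:\mathbb{R}^p\times\mathbb{R}^p\to\mathbb{R}$ satisfying either (a) $k\ge0$, $k(x,y)=0$ iff $x=y$, and for all Borel probability measures $P\ne Q$ with $\int k(z,z_0)\,dP(z)<\infty$ and $\int k(z,z_0)\,dQ(z)<\infty$ for some $z_0$, one has $\int k\,d([P-Q]\times[P-Q])<0$; or (b) $-k$ is the reproducing kernel of an RKHS on $\mathbb{R}^p$ and is characteristic (the mean embedding map on Borel probability measures is injective). $\mathcal{C}$ is a set of sequences $(k^{(p)})_{p\ge1}$ of kernels, $k^{(p)}$ on $\mathbb{R}^p$. Write $a_0^k=k(x,x)$ (constant in $x$ here). Sampling: for each $p$, $X=(x_1,\dots,x_p)^\top$, $Y=(y_1,\dots,y_p)^\top$ are random vectors in $\mathbb{R}^p$ with covariance matrices $\Sigma_X,\Sigma_Y$; $X_1,\dots,X_n$ are i.i.d. copies of $X$, $Y_1,\dots,Y_m$ i.i.d. copies of $Y$, the two samples independent. $Z$ equals $X$ with probability $\rho$ and $Y$ with probability $1-\rho$; $Z_1,Z_2,\dots$ are i.i.d. copies of $Z$. $\tilde X=X-\mathbb{E}X$, $\tilde Y=Y-\mathbb{E}Y$, $\Delta=\mathbb{E}X-\mathbb{E}Y$, $|\cdot|$ is the Euclidean norm, $\|\cdot\|_F$ the Frobenius norm. $A=\mathbb{E}|Z_1-Z_2|^2$, $A^X=\mathbb{E}|X_1-X_2|^2$, $A^{XY}=\mathbb{E}|X_1-Y_1|^2$, $A^Y=\mathbb{E}|Y_1-Y_2|^2$;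 $A_0=A^{1/2}$, $A_0^{XY}=(A^{XY})^{1/2}$. Kernel conditions: each $k^{(p)}$ occurring in $\mathcal{C}$ has the form $k^{(p)}(x,y)=f^{(p)}(|x-y|)$; $D$ is the domain of $f^{(p)}$, $D_0\subseteq D$ contains $A_0$ and $A_0^{XY}$; $f_i^{(p)}$ is the $i$-th derivative ($f_0^{(p)}=f^{(p)}$). (K1) For each $f^{(p)}$, all $s\in D$, $s_0\in D_0$: $f^{(p)}(s)=\sum_{i=0}^6\frac{1}{i!}f_i^{(p)}(s_0)(s-s_0)^i+\frac1{7!}f_7^{(p)}(\xi)(s-s_0)^7$ for some $\xi=\xi(s,s_0)$ between $s$ and $s_0$. (K2) There is $\tilde M<\infty$ such that for any $f^{(p)}$ and $s_0\in D_0$: $\max_{1\le i\le7}\sup_{s\in D}|f_i^{(p)}(s)|\cdot|s_0^i|\le\tilde M|f_0^{(p)}(s_0)|$. (K3) There is $\hat M<\infty$ such that for any $f^{(p)}$ and $s_0\in D_0$: $|f_0^{(p)}(s_0)|\le\hat M\min\{|\tfrac12f_1^{(p)}(s_0)s_0|,\ |-\tfrac18f_1^{(p)}(s_0)s_0+\tfrac18f_2^{(p)}(s_0)s_0^2|\}$. Distributional conditions (constants not depending on $p$): (D1) There is an integer $1\le\alpha(p)$ with $\alpha(p)=o(p)$ such that for any $1\le j\le p-\alpha(p)-1$ and $\ell>\alpha(p)$, $\{x_i\}_{i\le j}$ is independent of $\{x_i\}_{i\ge j+\ell}$ and $\{y_i\}_{i\le j}$ is independent of $\{y_i\}_{i\ge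 j+\ell}$. (D2) There is $0<U^*<\infty$ with $\max_{1\le j\le p}\max_{1\le r\le128}\{\mathbb{E}|x_j|^r,\mathbb{E}|y_j|^r\}<U^*$. (D3) There are $0<L_0,U_0<\infty$ with $L_0p\le\min\{A^X,A^{XY},A^Y\}\le\max\{A^X,A^{XY},A^Y\}\le U_0p$. (D4) There are $0<L_0^*,U_0^*<\infty$ with $L_0^*\alpha(p)p\le\min\{\|\Sigma_X\|_F^2,\|\Sigma_Y\|_F^2\}\le\max\{\|\Sigma_X\|_F^2,\|\Sigma_Y\|_F^2\}\le U_0^*\alpha(p)p$. Test statistic: $\mathcal{E}_{n,m}^k(X,Y)=\frac{2}{nm}\sum_{i=1}^n\sum_{j=1}^m k(X_i,Y_j)-\binom n2^{-1}\sum_{1\le i<j\le n}k(X_i,X_j)-\binom m2^{-1}\sum_{1\le i<j\le m}k(Y_i,Y_j)$; $c_{n,m}=\frac{2}{n(n-1)}+\frac{4}{nm}+\frac{2}{m(m-1)}$. Let $W_1,\dots,W_N$ be the pooled sample ($W_s=X_s$ for $s\le n$, $W_s=Y_{s-n}$ for $s>n$), $a_{s,t}=k(W_s,W_t)$ for $1\le s,t\le N$, $\tilde a_{\cdot t}=\frac{1}{N-2}\sum_{i=1}^N a_{i,t}$, $\tilde a_{s\cdot}=\frac1{N-2}\sum_{j=1}^Na_{s,j}$, $\tilde a_{\cdot\cdot}=\frac{1}{(N-1)(N-2)}\sum_{i,j=1}^Na_{i,j}$, $A^*_{s,t}=a_{s,t}-\tilde a_{\cdot t}-\tilde a_{s\cdot}+\tilde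 a_{\cdot\cdot}$, and $\mathcal{V}_{n,m}^{k*}(X,Y)=\frac{1}{N(N-3)}\sum_{s\ne t}(A^*_{s,t})^2-\frac{(a_0^k)^2}{(N-1)(N-3)}$. Finally $T_{n,m,p}^k=\mathcal{E}_{n,m}^k(X,Y)\big/\sqrt{c_{n,m}\mathcal{V}_{n,m}^{k*}(X,Y)}$. *)

theory Defs
  imports "HOL-Probability.Probability" "HOL-Library.Landau_Symbols"
begin

text \<open>The dimension tends to infinity, so a point of \<open>\<real>\<^sup>p\<close> is an extensional function on
  \<open>{1..p}\<close>; \<open>Rp p\<close> is \<open>\<real>\<^sup>p\<close> with its Borel sigma-algebra.\<close>

type_synonym vec = "nat \<Rightarrow> real"

abbreviation Rp :: "nat \<Rightarrow> vec measure" where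
  "Rp p \<equiv> PiM {1..p} (\<lambda>_. borel)"

definition origin :: "nat \<Rightarrow> vec" where
  "origin p = (\<lambda>i\<in>{1..p}. 0)"

definition edist :: "nat \<Rightarrow> vec \<Rightarrow> vec \<Rightarrow> real" where
  "edist p x y = L2_set (\<lambda>i. x i - y i) {1..p}"

definition frobenius :: "nat \<Rightarrow> (nat \<Rightarrow> nat \<Rightarrow> real) \<Rightarrow> real" where
  "frobenius p B = L2_set (\<lambda>(i, j). B i j) ({1..p} \<times> {1..p})"

definition borel_prob :: "nat \<Rightarrow> vec measure \<Rightarrow> bool" where
  "borel_prob p P \<longleftrightarrow> prob_space P \<and> sets P = sets (Rp p)"

text \<open>Functions on a set \<open>S\<close> are represented extensionally, so that a Hilbert space of
  functions on \<open>S\<close> is a set \<open>H \<subseteq> extensional S\<close> with an inner product \<open>ip\<close>.\<close>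

definition is_rkhs ::
  "'a set \<Rightarrow> ('a \<Rightarrow> real) set \<Rightarrow> (('a \<Rightarrow> real) \<Rightarrow> ('a \<Rightarrow> real) \<Rightarrow> real) \<Rightarrow> bool" where
  "is_rkhs S H ip \<longleftrightarrow>
     (let zero = (\<lambda>x\<in>S. 0);
          add = (\<lambda>g h. \<lambda>x\<in>S. g x + h x);
          scale = (\<lambda>(c::real) g. \<lambda>x\<in>S. c * g x);
          sqdist = (\<lambda>g h. ip (\<lambda>x\<in>S. g x - h x) (\<lambda>x\<in>S. g x - h x))
      in
       H \<subseteq> extensional S \<and>
       zero \<in> H \<and>
       (\<forall>g\<in>H. \<forall>h\<in>H. add g h \<in> H) \<and>
       (\<forall>c. \<forall>g\<in>H. scale c g \<in> H) \<and>
       (\<forall>g\<in>H. \<forall>h\<in>H. ip g h = ip h g) \<and>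
       (\<forall>g\<in>H. \<forall>h\<in>H. \<forall>l\<in>H. ip (add g h) l = ip g l + ip h l) \<and>
       (\<forall>c. \<forall>g\<in>H. \<forall>h\<in>H. ip (scale c g) h = c * ip g h) \<and>
       (\<forall>g\<in>H. 0 \<le> ip g g) \<and>
       (\<forall>g\<in>H. ip g g = 0 \<longrightarrow> g = zero) \<and>
       (\<forall>u. (\<forall>i::nat. u i \<in> H) \<and>
            (\<forall>e>0. \<exists>K. \<forall>i\<ge>K. \<forall>j\<ge>K. sqdist (u i) (u j) < e) \<longrightarrow>
            (\<exists>h\<in>H. (\<lambda>i. sqdist (u i) h) \<longlonglongrightarrow> 0)) \<and>
       (\<forall>x\<in>S. \<exists>c. \<forall>h\<in>H. \<bar>h x\<bar> \<le> c * sqrt (ip h h)))"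

definition is_reproducing_kernel ::
  "'a set \<Rightarrow> ('a \<Rightarrow> real) set \<Rightarrow> (('a \<Rightarrow> real) \<Rightarrow> ('a \<Rightarrow> real) \<Rightarrow> real) \<Rightarrow>
     ('a \<Rightarrow> 'a \<Rightarrow> real) \<Rightarrow> bool" where
  "is_reproducing_kernel S H ip K \<longleftrightarrow>
     (\<forall>x\<in>S. (\<lambda>y\<in>S. K y x) \<in> H \<and> (\<forall>h\<in>H. h x = ip h (\<lambda>y\<in>S. K y x)))"

definition is_mean_embedding ::
  "('a \<Rightarrow> real) set \<Rightarrow> (('a \<Rightarrow> real) \<Rightarrow> ('a \<Rightarrow> real) \<Rightarrow> real) \<Rightarrow>
     'a measure \<Rightarrow> ('a \<Rightarrow> real) \<Rightarrow> bool" where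
  "is_mean_embedding H ip P \<mu> \<longleftrightarrow>
     \<mu> \<in> H \<and> (\<forall>h\<in>H. integrable P h \<and> (\<integral>x. h x \<partial>P) = ip h \<mu>)"

definition characteristic_rkhs ::
  "nat \<Rightarrow> (vec \<Rightarrow> real) set \<Rightarrow> ((vec \<Rightarrow> real) \<Rightarrow> (vec \<Rightarrow> real) \<Rightarrow> real) \<Rightarrow> bool" where
  "characteristic_rkhs p H ip \<longleftrightarrow>
     (\<forall>P. borel_prob p P \<longrightarrow> (\<exists>\<mu>. is_mean_embedding H ip P \<mu>)) \<and>
     (\<forall>P Q \<mu>. borel_prob p P \<and> borel_prob p Q \<and>
        is_mean_embedding H ip P \<mu> \<and> is_mean_embedding H ip Q \<mu> \<longrightarrow> P = Q)"

definition kernel_cross :: "(vec \<Rightarrow> vec \<Rightarrow> real) \<Rightarrow> vec measure \<Rightarrow> vec measure \<Rightarrow> real" where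
  "kernel_cross k P Q = (\<integral>z. k (fst z) (snd z) \<partial>(P \<Otimes>\<^sub>M Q))"

text \<open>The integral of \<open>k\<close> against the signed measure \<open>[P - Q] \<times> [P - Q]\<close>, expanded.\<close>

definition kernel_signed :: "(vec \<Rightarrow> vec \<Rightarrow> real) \<Rightarrow> vec measure \<Rightarrow> vec measure \<Rightarrow> real" where
  "kernel_signed k P Q =
     kernel_cross k P P - kernel_cross k P Q - kernel_cross k Q P + kernel_cross k Q Q"

definition strong_negative_type :: "nat \<Rightarrow> (vec \<Rightarrow> vec \<Rightarrow> real) \<Rightarrow> bool" where
  "strong_negative_type p k \<longleftrightarrow>
     (\<forall>x\<in>space (Rp p). \<forall>y\<in>space (Rp p). 0 \<le> k x y \<and> (k x y = 0 \<longleftrightarrow> x = y)) \<and>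
     (\<forall>P Q. borel_prob p P \<and> borel_prob p Q \<and> P \<noteq> Q \<and>
        (\<exists>z0\<in>space (Rp p). integrable P (\<lambda>z. k z z0) \<and> integrable Q (\<lambda>z. k z z0)) \<longrightarrow>
        kernel_signed k P Q < 0)"

definition neg_characteristic :: "nat \<Rightarrow> (vec \<Rightarrow> vec \<Rightarrow> real) \<Rightarrow> bool" where
  "neg_characteristic p k \<longleftrightarrow>
     (\<exists>H ip. is_rkhs (space (Rp p)) H ip \<and>
        is_reproducing_kernel (space (Rp p)) H ip (\<lambda>x y. - k x y) \<and>
        characteristic_rkhs p H ip)"

definition kernel_on :: "nat \<Rightarrow> (vec \<Rightarrow> vec \<Rightarrow> real) \<Rightarrow> bool" where
  "kernel_on p k \<longleftrightarrow>
     (\<forall>x\<in>space (Rp p). \<forall>y\<in>space (Rp p). k x y = k y x) \<and>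
     (strong_negative_type p k \<or> neg_characteristic p k)"

text \<open>A sequence of kernels, one for each dimension; the entry at \<open>0\<close> is never used.\<close>

type_synonym kernel_seq = "nat \<Rightarrow> vec \<Rightarrow> vec \<Rightarrow> real"

text \<open>The profile \<open>f\<close> of a radial kernel \<open>k x y = f (edist p x y)\<close> has domain \<open>[0, \<infinity>)\<close>; its
  derivatives are taken within that domain, hence are one-sided at \<open>0\<close>.\<close>

definition nth_deriv :: "nat \<Rightarrow> (real \<Rightarrow> real) \<Rightarrow> real \<Rightarrow> real" where
  "nth_deriv i f = ((\<lambda>g s. vector_derivative g (at s within {0..})) ^^ i) f"

definition taylor_condition :: "real set \<Rightarrow> (real \<Rightarrow> real) \<Rightarrow> bool" where
  "taylor_condition D0 f \<longleftrightarrow>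
     (\<forall>i<7. nth_deriv i f differentiable_on {0..}) \<and>
     (\<forall>s\<in>{0..}. \<forall>s0\<in>D0. \<exists>\<xi>\<in>{min s s0..max s s0}.
        f s = (\<Sum>i\<le>6. 1 / fact i * nth_deriv i f s0 * (s - s0) ^ i)
              + 1 / fact 7 * nth_deriv 7 f \<xi> * (s - s0) ^ 7)"

definition derivative_bound :: "real \<Rightarrow> real set \<Rightarrow> (real \<Rightarrow> real) \<Rightarrow> bool" where
  "derivative_bound B D0 f \<longleftrightarrow>
     (\<forall>s0\<in>D0. \<forall>i\<in>{1..7}. \<forall>s\<in>{0..}. \<bar>nth_deriv i f s\<bar> * \<bar>s0 ^ i\<bar> \<le> B * \<bar>f s0\<bar>)"

definition derivative_nondegenerate :: "real \<Rightarrow> real set \<Rightarrow> (real \<Rightarrow> real) \<Rightarrow> bool" where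
  "derivative_nondegenerate B D0 f \<longleftrightarrow>
     (\<forall>s0\<in>D0. \<bar>f s0\<bar> \<le> B * min \<bar>1/2 * nth_deriv 1 f s0 * s0\<bar>
        \<bar>- (1/8) * nth_deriv 1 f s0 * s0 + 1/8 * nth_deriv 2 f s0 * s0 ^ 2\<bar>)"

definition mean :: "vec measure \<Rightarrow> nat \<Rightarrow> real" where
  "mean P i = (\<integral>x. x i \<partial>P)"

definition covariance :: "vec measure \<Rightarrow> nat \<Rightarrow> nat \<Rightarrow> real" where
  "covariance P i j = (\<integral>x. (x i - mean P i) * (x j - mean P j) \<partial>P)"

definition centered_sq_norm :: "nat \<Rightarrow> vec measure \<Rightarrow> real" where
  "centered_sq_norm p P = (\<integral>x. (L2_set (\<lambda>i. x i - mean P i) {1..p}) ^ 2 \<partial>P)"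

definition mean_sq_dist :: "nat \<Rightarrow> vec measure \<Rightarrow> vec measure \<Rightarrow> real" where
  "mean_sq_dist p P Q = (\<integral>z. (edist p (fst z) (snd z)) ^ 2 \<partial>(P \<Otimes>\<^sub>M Q))"

text \<open>The law of the variable that follows \<open>P\<close> with probability \<open>\<rho>\<close> and \<open>Q\<close> otherwise.\<close>

definition mixture :: "real \<Rightarrow> vec measure \<Rightarrow> vec measure \<Rightarrow> vec measure" where
  "mixture \<rho> P Q = Giry_Monad.bind (measure_pmf (bernoulli_pmf \<rho>)) (\<lambda>b. if b then P else Q)"

text \<open>The statistics only use the indices from \<open>1\<close> on; index \<open>0\<close> is a spare copy.\<close>

definition two_samples ::
  "nat \<Rightarrow> 'w measure \<Rightarrow> (nat \<Rightarrow> 'w \<Rightarrow> vec) \<Rightarrow> (nat \<Rightarrow> 'w \<Rightarrow> vec) \<Rightarrow>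
     vec measure \<Rightarrow> vec measure \<Rightarrow> bool" where
  "two_samples p M X Y P Q \<longleftrightarrow>
     prob_space M \<and>
     prob_space.indep_vars M (\<lambda>_. Rp p) (case_sum X Y) UNIV \<and>
     (\<forall>i. distr M (Rp p) (X i) = P) \<and>
     (\<forall>j. distr M (Rp p) (Y j) = Q)"

definition lag_independent :: "nat \<Rightarrow> nat \<Rightarrow> vec measure \<Rightarrow> bool" where
  "lag_independent p a P \<longleftrightarrow>
     (\<forall>j l. 1 \<le> j \<and> j + a + 1 \<le> p \<and> a < l \<longrightarrow>
        prob_space.indep_var P
          (PiM {1..j} (\<lambda>_. borel)) (\<lambda>x. restrict x {1..j})
          (PiM {j + l..p} (\<lambda>_. borel)) (\<lambda>x. restrict x {j + l..p}))"

definition dependence_condition ::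
  "(nat \<Rightarrow> nat) \<Rightarrow> (nat \<Rightarrow> vec measure) \<Rightarrow> (nat \<Rightarrow> vec measure) \<Rightarrow> bool" where
  "dependence_condition \<alpha> PX PY \<longleftrightarrow>
     (\<lambda>p. real (\<alpha> p)) \<in> o(\<lambda>p. real p) \<and>
     (\<forall>p\<ge>1. 1 \<le> \<alpha> p \<and> lag_independent p (\<alpha> p) (PX p) \<and> lag_independent p (\<alpha> p) (PY p))"

definition moment_condition :: "(nat \<Rightarrow> vec measure) \<Rightarrow> (nat \<Rightarrow> vec measure) \<Rightarrow> bool" where
  "moment_condition PX PY \<longleftrightarrow>
     (\<exists>U>0. \<forall>p\<ge>1. \<forall>P\<in>{PX p, PY p}. \<forall>j\<in>{1..p}. \<forall>r\<in>{1..128}.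
        integrable P (\<lambda>x. \<bar>x j\<bar> ^ r) \<and> (\<integral>x. \<bar>x j\<bar> ^ r \<partial>P) < U)"

definition distance_condition :: "(nat \<Rightarrow> vec measure) \<Rightarrow> (nat \<Rightarrow> vec measure) \<Rightarrow> bool" where
  "distance_condition PX PY \<longleftrightarrow>
     (\<exists>L>0. \<exists>U>0. \<forall>p\<ge>1.
        \<forall>a\<in>{mean_sq_dist p (PX p) (PX p), mean_sq_dist p (PX p) (PY p),
             mean_sq_dist p (PY p) (PY p)}.
          L * real p \<le> a \<and> a \<le> U * real p)"

definition covariance_condition ::
  "(nat \<Rightarrow> nat) \<Rightarrow> (nat \<Rightarrow> vec measure) \<Rightarrow> (nat \<Rightarrow> vec measure) \<Rightarrow> bool" where
  "covariance_condition \<alpha> PX PY \<longleftrightarrow>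
     (\<exists>L>0. \<exists>U>0. \<forall>p\<ge>1. \<forall>P\<in>{PX p, PY p}.
        L * real (\<alpha> p) * real p \<le> (frobenius p (covariance P)) ^ 2 \<and>
        (frobenius p (covariance P)) ^ 2 \<le> U * real (\<alpha> p) * real p)"

definition energy_stat ::
  "(vec \<Rightarrow> vec \<Rightarrow> real) \<Rightarrow> nat \<Rightarrow> nat \<Rightarrow> (nat \<Rightarrow> vec) \<Rightarrow> (nat \<Rightarrow> vec) \<Rightarrow> real" where
  "energy_stat k n m x y =
     2 / (real n * real m) * (\<Sum>i=1..n. \<Sum>j=1..m. k (x i) (y j))
     - inverse (real (n choose 2)) * (\<Sum>(i, j)\<in>{(i, j). 1 \<le> i \<and> i < j \<and> j \<le> n}. k (x i) (x j))
     - inverse (real (m choose 2)) * (\<Sum>(i, j)\<in>{(i, j). 1 \<le> i \<and> i < j \<and> j \<le> m}. k (y i) (y j))"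

definition c_nm :: "nat \<Rightarrow> nat \<Rightarrow> real" where
  "c_nm n m = 2 / (real n * (real n - 1)) + 4 / (real n * real m) + 2 / (real m * (real m - 1))"

definition pooled :: "nat \<Rightarrow> (nat \<Rightarrow> vec) \<Rightarrow> (nat \<Rightarrow> vec) \<Rightarrow> nat \<Rightarrow> vec" where
  "pooled n x y s = (if s \<le> n then x s else y (s - n))"

definition u_center :: "nat \<Rightarrow> (nat \<Rightarrow> nat \<Rightarrow> real) \<Rightarrow> nat \<Rightarrow> nat \<Rightarrow> real" where
  "u_center N a s t =
     a s t
     - (\<Sum>i=1..N. a i t) / (real N - 2)
     - (\<Sum>j=1..N. a s j) / (real N - 2)
     + (\<Sum>i=1..N. \<Sum>j=1..N. a i j) / ((real N - 1) * (real N - 2))"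

text \<open>For a radial kernel \<open>k x x\<close> does not depend on \<open>x\<close>, so it may be read off at the origin.\<close>

definition variance_stat ::
  "nat \<Rightarrow> (vec \<Rightarrow> vec \<Rightarrow> real) \<Rightarrow> nat \<Rightarrow> nat \<Rightarrow> (nat \<Rightarrow> vec) \<Rightarrow> (nat \<Rightarrow> vec) \<Rightarrow> real" where
  "variance_stat p k n m x y =
     (let N = n + m;
          a = (\<lambda>s t. k (pooled n x y s) (pooled n x y t))
      in
       1 / (real N * (real N - 3)) *
         (\<Sum>(s, t)\<in>{(s, t). s \<in> {1..N} \<and> t \<in> {1..N} \<and> s \<noteq> t}. (u_center N a s t) ^ 2)
       - (k (origin p) (origin p)) ^ 2 / ((real N - 1) * (real N - 3)))"

definition T_stat ::
  "nat \<Rightarrow> (vec \<Rightarrow> vec \<Rightarrow> real) \<Rightarrow> nat \<Rightarrow> nat \<Rightarrow> (nat \<Rightarrow> vec) \<Rightarrow> (nat \<Rightarrow> vec) \<Rightarrow> real" where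
  "T_stat p k n m x y = energy_stat k n m x y / sqrt (c_nm n m * variance_stat p k n m x y)"

end

theory Submission
  imports Defs
begin

text \<open>Write $\delta = \max\{\delta_3,\delta_4\}$, let $s_0^2 = E|X_1-Y_1|^2$, which is of order $p$, and let
$f_0 = f(s_0)$. The expectation of the energy statistic is the population energy
\[e = 2 E k(X_1,Y_1) - E k(X_1,X_2) - E k(Y_1,Y_2).\]

Expand $k(x,y) = f(|x-y|)$ in powers of $u = (|x-y|^2 - s_0^2)/s_0^2$ up to order three. The first
order cancels in $e$ because the means agree. In the second order, independence leaves exactly
$-2(E|\tilde X|^2 - E|\tilde Y|^2)^2 - 4\|\Sigma_X-\Sigma_Y\|_F^2$, divided by $s_0^4$
(\<open>energy_second_moment\<close>); both squares have the same sign, so the signal is of order $p^{\delta-2}$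
whichever exponent is larger. For the remaining terms no cancellation between the three
expectations is needed. Indeed $|x-y|^2$ is a sum of $p$ variables that are independent at lag
greater than the bounded $\alpha(p)$, so its third central moment is $O(p)$ and its fourth central
moment is $O(p^2)$ (\<open>third_moment_sum\<close>, \<open>fourth_moment_sum\<close>). Hence the order three term and the
remainder are $O(p^{\delta/2-2})$ relative to $f_0$, which is of smaller order because $\delta > 0$. So
$|e| \ge c\,|f_0|\,p^{\delta-2}$ for large $p$. The sign of the second order coefficient comes from
the kernel: either description of a kernel makes $e$ strictly positive once the two laws
differ, and this also excludes $f_0 = 0$ (\<open>energy_positive\<close>).

The growth condition is generous enough for crude bounds on the fluctuations. With
$v = \sup E(k-f_0)^2 = O(f_0^2/p)$, a U-statistic has variance $O(v/N)$
(\<open>u_statistic_variance\<close>). The variance estimator is exactly a sum of squares of the doubly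
centred kernel matrix with its diagonal removed (\<open>variance_identity\<close>). Such centring is an
orthogonal projection, so the estimator is bounded by the average of $(k-f_0)^2$, whose mean is
$O(v)$. It cannot vanish where the energy statistic is non-zero, because that statistic is a
linear functional of the same centred matrix. Markov's inequality, applied to
$(\mathcal{E}-e)^2 + C^2 c_{n,m} V'$ with $V'$ this upper bound, gives
\[P(T \le C) = O(v/(N e^2)) = O(p^{3-2\delta}/N),\]
and this tends to zero (\<open>fixed_dimension_bound\<close>, \<open>growth_limit\<close>).\<close>

section \<open>Moments of lagged-independent sums\<close>

text \<open>All estimates below multiply at most four factors, and by the inequality between arithmetic and
geometric means a product of four functions with integrable fourth powers is integrable.\<close>

definition L4 :: "'a measure \<Rightarrow> ('a \<Rightarrow> real) \<Rightarrow> bool" where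
  "L4 M f \<longleftrightarrow> f \<in> borel_measurable M \<and> integrable M (\<lambda>x. f x ^ 4)"

lemma sum_pow4_le: "(\<Sum>i\<in>I. f i) ^ 4 \<le> real (card I) ^ 3 * (\<Sum>i\<in>I. (f i :: real) ^ 4)"
proof -
  have "(\<Sum>i\<in>I. f i) ^ 4 = ((\<Sum>i\<in>I. f i)\<^sup>2)\<^sup>2" by (simp flip: power_mult)
  also have "\<dots> \<le> ((\<Sum>i\<in>I. (f i)\<^sup>2) * card I)\<^sup>2"
    by (intro power_mono sum_squared_le_sum_of_squares) auto
  also have "\<dots> = (\<Sum>i\<in>I. (f i)\<^sup>2)\<^sup>2 * (real (card I))\<^sup>2" by (simp add: power_mult_distrib)
  also have "\<dots> \<le> ((\<Sum>i\<in>I. ((f i)\<^sup>2)\<^sup>2) * card I) * (real (card I))\<^sup>2"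
    by (intro mult_right_mono sum_squared_le_sum_of_squares) auto
  also have "\<dots> = real (card I) ^ 3 * (\<Sum>i\<in>I. f i ^ 4)"
    by (simp add: power2_eq_square power3_eq_cube power4_eq_xxxx mult_ac)
  finally show ?thesis .
qed

lemma add_pow4_le: "(a + b) ^ 4 \<le> 8 * (a ^ 4 + (b::real) ^ 4)"
proof -
  have "(a+b)^2 \<le> 2 * (a^2+b^2)" by (smt (verit) sum_squares_bound power2_sum)
  then have "((a+b)^2)^2 \<le> (2 * (a^2+b^2))^2" by (intro power_mono) auto
  also have "\<dots> = 4 * (a\<^sup>2+b\<^sup>2)^2" by (simp only: power_mult_distrib) simp
  also have "\<dots> \<le> 4 * (2 * ((a\<^sup>2)\<^sup>2 + (b\<^sup>2)\<^sup>2))"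
    using sum_squares_bound[of "a\<^sup>2" "b\<^sup>2"] by (simp add: power2_sum)
  finally show ?thesis by (simp flip: power_mult)
qed

lemma four_factor_bound: "\<bar>a * b * c * d\<bar> \<le> (a ^ 4 + b ^ 4 + c ^ 4 + (d::real) ^ 4) / 4"
proof -
  have 1: "2 * \<bar>x * y\<bar> \<le> x\<^sup>2 + y\<^sup>2" for x y :: real
    using sum_squares_bound[of "\<bar>x\<bar>" "\<bar>y\<bar>"] by (simp add: abs_mult)
  have "2 * \<bar>(a * b) * (c * d)\<bar> \<le> (a*b)\<^sup>2 + (c*d)\<^sup>2" by (rule 1)
  moreover have "2 * (a*b)\<^sup>2 \<le> a^4 + b^4"
    using 1[of "a\<^sup>2" "b\<^sup>2"] by (simp add: power_mult_distrib flip: power_mult)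
  moreover have "2 * (c*d)\<^sup>2 \<le> c^4 + d^4"
    using 1[of "c\<^sup>2" "d\<^sup>2"] by (simp add: power_mult_distrib flip: power_mult)
  ultimately show ?thesis by (simp add: mult.assoc)
qed

lemma L4_measurable[measurable_dest]: "L4 M f \<Longrightarrow> f \<in> borel_measurable M"
  by (simp add: L4_def)

lemma L4_integrable_pow4: "L4 M f \<Longrightarrow> integrable M (\<lambda>x. f x ^ 4)"
  by (simp add: L4_def)

lemma L4_add[intro]:
  assumes "L4 M f" "L4 M g" shows "L4 M (\<lambda>x. f x + g x)"
  unfolding L4_def
proof
  have [measurable]: "f \<in> borel_measurable M" "g \<in> borel_measurable M" using assms by (auto simp: L4_def)
  show "(\<lambda>x. f x + g x) \<in> borel_measurable M" by simp
  show "integrable M (\<lambda>x. (f x + g x) ^ 4)"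
    by (rule Bochner_Integration.integrable_bound[where f="\<lambda>x. 8 * (f x ^ 4 + g x ^ 4)"])
      (use assms add_pow4_le in \<open>auto simp: L4_def distrib_left[symmetric] simp del: distrib_left_numeral intro!: AE_I2\<close>)
qed

lemma L4_cmult[intro]: "L4 M f \<Longrightarrow> L4 M (\<lambda>x. c * f x)"
  by (auto simp: L4_def power_mult_distrib)

lemma L4_minus[intro]: "L4 M f \<Longrightarrow> L4 M (\<lambda>x. - f x)"
  using L4_cmult[of M f "-1"] by simp

lemma L4_diff[intro]: "L4 M f \<Longrightarrow> L4 M g \<Longrightarrow> L4 M (\<lambda>x. f x - g x)"
  using L4_add[of M f "\<lambda>x. - g x"] by auto

lemma (in finite_measure) L4_const[simp, intro]: "L4 M (\<lambda>_. c)"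
  by (simp add: L4_def)

lemma (in finite_measure) L4_sum[intro]: "(\<And>i. i \<in> I \<Longrightarrow> L4 M (f i)) \<Longrightarrow> L4 M (\<lambda>x. \<Sum>i\<in>I. f i x)"
  by (induction I rule: infinite_finite_induct) (auto intro!: L4_add)

lemma L4_product:
  assumes "L4 M f" "L4 M g" "L4 M h" "L4 M k"
  shows "integrable M (\<lambda>x. f x * g x * h x * k x)"
proof (rule Bochner_Integration.integrable_bound[where f="\<lambda>x. (f x ^ 4 + g x ^ 4 + h x ^ 4 + k x ^ 4) / 4"])
  show "integrable M (\<lambda>x. (f x ^ 4 + g x ^ 4 + h x ^ 4 + k x ^ 4) / 4)"
    using assms by (auto simp: L4_def)
  have [measurable]: "f \<in> borel_measurable M" "g \<in> borel_measurable M" "h \<in> borel_measurable M" "k \<in> borel_measurable M"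
    using assms by (auto simp: L4_def)
  show "(\<lambda>x. f x * g x * h x * k x) \<in> borel_measurable M" by measurable
  show "AE x in M. norm (f x * g x * h x * k x) \<le> norm ((f x ^ 4 + g x ^ 4 + h x ^ 4 + k x ^ 4) / 4)"
  proof (rule AE_I2)
    fix x show "norm (f x * g x * h x * k x) \<le> norm ((f x ^ 4 + g x ^ 4 + h x ^ 4 + k x ^ 4) / 4)"
      using four_factor_bound[of "f x" "g x" "h x" "k x"] by simp
  qed
qed

lemma (in finite_measure) L4_integrable:
  assumes "L4 M f"
  shows "integrable M f" and "integrable M (\<lambda>x. f x ^ 2)" and "integrable M (\<lambda>x. f x ^ 3)"
  using L4_product[OF assms L4_const[of 1] L4_const[of 1] L4_const[of 1]]
    L4_product[OF assms assms L4_const[of 1] L4_const[of 1]]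
    L4_product[OF assms assms assms L4_const[of 1]]
  by (simp_all add: power2_eq_square power3_eq_cube)

lemma (in prob_space) L4_product_bound:
  assumes "L4 M f" "L4 M g" "L4 M h" "L4 M k"
    and "expectation (\<lambda>x. f x ^ 4) \<le> K" "expectation (\<lambda>x. g x ^ 4) \<le> K"
    and "expectation (\<lambda>x. h x ^ 4) \<le> K" "expectation (\<lambda>x. k x ^ 4) \<le> K"
  shows "\<bar>expectation (\<lambda>x. f x * g x * h x * k x)\<bar> \<le> K"
proof -
  have "\<bar>expectation (\<lambda>x. f x * g x * h x * k x)\<bar> \<le> expectation (\<lambda>x. \<bar>f x * g x * h x * k x\<bar>)"
    by simp
  also have "\<dots> \<le> expectation (\<lambda>x. (f x ^ 4 + g x ^ 4 + h x ^ 4 + k x ^ 4) / 4)"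
  proof (rule integral_mono)
    show "integrable M (\<lambda>x. \<bar>f x * g x * h x * k x\<bar>)"
      using L4_product[OF assms(1-4)] by simp
    show "integrable M (\<lambda>x. (f x ^ 4 + g x ^ 4 + h x ^ 4 + k x ^ 4) / 4)"
      using assms by (auto simp: L4_def)
  qed (rule four_factor_bound)
  also have "\<dots> = (expectation (\<lambda>x. f x ^ 4) + expectation (\<lambda>x. g x ^ 4) +
      expectation (\<lambda>x. h x ^ 4) + expectation (\<lambda>x. k x ^ 4)) / 4"
    using assms by (auto simp: L4_def)
  finally show ?thesis using assms(5-8) by simp
qed

lemma (in prob_space) L4_sum_bound:
  assumes "finite I" "\<And>i. i \<in> I \<Longrightarrow> L4 M (f i)" "\<And>i. i \<in> I \<Longrightarrow> expectation (\<lambda>x. f i x ^ 4) \<le> B"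
  shows "expectation (\<lambda>x. (\<Sum>i\<in>I. f i x) ^ 4) \<le> real (card I) ^ 4 * B"
proof -
  have "expectation (\<lambda>x. (\<Sum>i\<in>I. f i x) ^ 4) \<le> expectation (\<lambda>x. real (card I) ^ 3 * (\<Sum>i\<in>I. f i x ^ 4))"
  proof (rule integral_mono)
    show "integrable M (\<lambda>x. (\<Sum>i\<in>I. f i x) ^ 4)"
      by (intro L4_integrable_pow4 L4_sum assms)
    show "integrable M (\<lambda>x. real (card I) ^ 3 * (\<Sum>i\<in>I. f i x ^ 4))"
      by (intro integrable_mult_right Bochner_Integration.integrable_sum L4_integrable_pow4 assms)
  qed (rule sum_pow4_le)
  also have "\<dots> = real (card I) ^ 3 * (\<Sum>i\<in>I. expectation (\<lambda>x. f i x ^ 4))"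
    by (subst integral_mult_right_zero, subst Bochner_Integration.integral_sum) (auto intro!: L4_integrable_pow4 assms)
  also have "\<dots> \<le> real (card I) ^ 3 * (real (card I) * B)"
    by (intro mult_left_mono sum_bounded_above assms) auto
  finally show ?thesis by (simp add: power_numeral_reduce mult_ac)
qed


lemma (in prob_space) square_expectation_le:
  fixes f :: "'a \<Rightarrow> real"
  assumes "integrable M f" "integrable M (\<lambda>x. f x ^ 2)"
  shows "expectation f ^ 2 \<le> expectation (\<lambda>x. f x ^ 2)"
  using variance_positive[of f] unfolding variance_eq[OF assms] by linarith

text \<open>The usual notion of \<open>a\<close>-dependence, reduced to one cut at a time: blocks separated by a gap of \<open>a\<close>
indices are compared in pairs, past against future. The sums below are built up one variable at
a time, and this is the form of independence that such an induction consumes.\<close>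

locale m_dependent = prob_space M for M :: "'a measure" +
  fixes \<xi> :: "nat \<Rightarrow> 'a \<Rightarrow> real" and q a :: nat and K :: real
  assumes L4: "\<And>i. i \<in> {1..q} \<Longrightarrow> L4 M (\<xi> i)"
    and centred: "\<And>i. i \<in> {1..q} \<Longrightarrow> expectation (\<xi> i) = 0"
    and fourth: "\<And>i. i \<in> {1..q} \<Longrightarrow> expectation (\<lambda>x. \<xi> i x ^ 4) \<le> K"
    and K: "1 \<le> K"
    and indep: "\<And>j. 1 \<le> j \<Longrightarrow> j + a + 1 \<le> q \<Longrightarrow>
      indep_var (PiM {1..j} (\<lambda>_. borel)) (\<lambda>x. \<lambda>i\<in>{1..j}. \<xi> i x)
        (PiM {j + a + 1..q} (\<lambda>_. borel)) (\<lambda>x. \<lambda>i\<in>{j + a + 1..q}. \<xi> i x)"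
begin

definition S :: "nat \<Rightarrow> 'a \<Rightarrow> real" where "S j x = (\<Sum>i = 1..j. \<xi> i x)"

text \<open>The independence assumption in the form in which it is applied: an expectation factorises if one
factor is a power of a sum over the past and the other a function of the future.\<close>

lemma past_future_factor:
  assumes "I \<subseteq> {1..j}" "j + a + 1 \<le> q" "0 < e"
    and h: "h \<in> borel_measurable (PiM {j + a + 1..q} (\<lambda>_. borel))"
    and v: "\<And>x. v x = h (\<lambda>i\<in>{j + a + 1..q}. \<xi> i x)"
    and int: "integrable M (\<lambda>x. (\<Sum>i\<in>I. \<xi> i x) ^ e)" "integrable M v"
  shows "expectation (\<lambda>x. (\<Sum>i\<in>I. \<xi> i x) ^ e * v x)
    = expectation (\<lambda>x. (\<Sum>i\<in>I. \<xi> i x) ^ e) * expectation v"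
proof (cases "I = {}")
  case True
  then show ?thesis using \<open>0 < e\<close> by simp
next
  case False
  then have j: "1 \<le> j" using assms(1) by auto
  define g :: "(nat \<Rightarrow> real) \<Rightarrow> real" where "g = (\<lambda>x. (\<Sum>i\<in>I. x i) ^ e)"
  have g: "g \<in> borel_measurable (PiM {1..j} (\<lambda>_. borel))"
    unfolding g_def using assms(1)
    by (intro borel_measurable_power borel_measurable_sum measurable_component_singleton) auto
  have eq: "(\<Sum>i\<in>I. \<xi> i x) ^ e = g (\<lambda>i\<in>{1..j}. \<xi> i x)" for x
  proof -
    have "(\<Sum>i\<in>I. \<xi> i x) = (\<Sum>i\<in>I. (\<lambda>i\<in>{1..j}. \<xi> i x) i)"
      using assms(1) by (intro sum.cong) auto
    then show ?thesis by (simp add: g_def)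
  qed
  have "indep_var borel (g \<circ> (\<lambda>x. \<lambda>i\<in>{1..j}. \<xi> i x)) borel (h \<circ> (\<lambda>x. \<lambda>i\<in>{j + a + 1..q}. \<xi> i x))"
    by (rule indep_var_compose[OF indep[OF j assms(2)] g h])
  then have "indep_var borel (\<lambda>x. (\<Sum>i\<in>I. \<xi> i x) ^ e) borel v"
    by (simp add: eq v[abs_def] comp_def)
  from indep_var_lebesgue_integral[OF this int] show ?thesis .
qed

lemma sum_L4: "I \<subseteq> {1..q} \<Longrightarrow> L4 M (\<lambda>x. \<Sum>i\<in>I. \<xi> i x)"
  by (intro L4_sum L4) auto

lemma sum_centred: "I \<subseteq> {1..q} \<Longrightarrow> expectation (\<lambda>x. \<Sum>i\<in>I. \<xi> i x) = 0"
  by (subst Bochner_Integration.integral_sum) (auto intro!: L4_integrable L4 sum.neutral centred)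

lemma term_second_moment: "i \<in> {1..q} \<Longrightarrow> expectation (\<lambda>x. \<xi> i x ^ 2) \<le> K"
  using L4_product_bound[of "\<xi> i" "\<xi> i" "\<lambda>_. 1" "\<lambda>_. 1" K] L4[of i] fourth[of i] K
  by (simp add: power2_eq_square prob_space)

text \<open>Along a residue class modulo \<open>a + 1\<close> consecutive indices are far enough apart for each term to be
independent of the sum of all earlier ones. The terms of the binomial expansion that contain a
first power then vanish, and the second and fourth moments grow as for independent variables.\<close>

lemma class_moments:
  fixes r :: nat
  assumes "j \<le> q"
  defines "I \<equiv> \<lambda>j. {i\<in>{1..j}. i mod (a + 1) = r}"
  shows "expectation (\<lambda>x. (\<Sum>i\<in>I j. \<xi> i x) ^ 2) \<le> K * real j
    \<and> expectation (\<lambda>x. (\<Sum>i\<in>I j. \<xi> i x) ^ 4) \<le> 3 * K ^ 2 * real j ^ 2"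
  using assms(1)
proof (induction j)
  case 0
  have "I 0 = {}" by (auto simp: I_def)
  then show ?case by simp
next
  case (Suc j)
  then have IH: "expectation (\<lambda>x. (\<Sum>i\<in>I j. \<xi> i x) ^ 2) \<le> K * real j"
    "expectation (\<lambda>x. (\<Sum>i\<in>I j. \<xi> i x) ^ 4) \<le> 3 * K ^ 2 * real j ^ 2" by auto
  show ?case
  proof (cases "Suc j mod (a + 1) = r")
    case False
    then have "I (Suc j) = I j" by (auto simp: I_def le_Suc_eq)
    moreover have "K * real j \<le> K * real (Suc j)" using K by (intro mult_left_mono) auto
    moreover have "3 * K ^ 2 * real j ^ 2 \<le> 3 * K ^ 2 * real (Suc j) ^ 2"
      by (intro mult_left_mono power_mono) auto
    ultimately show ?thesis using IH by simp
  next
    case True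
    have ISuc: "I (Suc j) = insert (Suc j) (I j)" "Suc j \<notin> I j" "finite (I j)"
      using True by (auto simp: I_def le_Suc_eq)
    define T where "T = (\<lambda>x. \<Sum>i\<in>I j. \<xi> i x)"
    define z where "z = \<xi> (Suc j)"
    have sum: "(\<Sum>i\<in>I (Suc j). \<xi> i x) = T x + z x" for x
      using ISuc by (simp add: T_def z_def)
    have Iq: "I j \<subseteq> {1..q}" using Suc.prems by (auto simp: I_def)
    have T: "L4 M T" unfolding T_def by (rule sum_L4[OF Iq])
    have z: "L4 M z" unfolding z_def using Suc.prems by (intro L4) auto
    \<comment> \<open>the last earlier index of the residue class lies \<open>a + 1\<close> steps back\<close>
    have past: "I j \<subseteq> {1..j - a}"
    proof
      fix i assume i: "i \<in> I j"
      then have "i mod (a + 1) = Suc j mod (a + 1)" "i < Suc j" using True by (auto simp: I_def)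
      then have "(a + 1) dvd (Suc j - i)"
        by (metis less_imp_le mod_eq_dvd_iff_nat)
      then have "a + 1 \<le> Suc j - i" using \<open>i < Suc j\<close> by (intro dvd_imp_le) auto
      then show "i \<in> {1..j - a}" using i by (auto simp: I_def)
    qed
    have factor': "expectation (\<lambda>x. T x ^ e * z x ^ k) = expectation (\<lambda>x. T x ^ e) * expectation (\<lambda>x. z x ^ k)"
      if e: "e \<in> {1,2,3}" "k \<in> {1,2,3}" for e k
    proof (cases "I j = {}")
      case True
      then show ?thesis using that by (auto simp: T_def)
    next
      case False
      then have *: "j - a + a + 1 = Suc j" using past by auto
      show ?thesis unfolding T_def
      proof (rule past_future_factor[OF past])
        show "j - a + a + 1 \<le> q" using * Suc.prems by simp
        show "(\<lambda>y :: nat \<Rightarrow> real. y (Suc j) ^ k) \<in> borel_measurable (PiM {j - a + a + 1..q} (\<lambda>_. borel))"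
          using * Suc.prems by (intro borel_measurable_power measurable_component_singleton) auto
        show "z x ^ k = (\<lambda>i\<in>{j - a + a + 1..q}. \<xi> i x) (Suc j) ^ k" for x
          using * Suc.prems by (simp add: z_def)
        show "integrable M (\<lambda>x. (\<Sum>i\<in>I j. \<xi> i x) ^ e)" "integrable M (\<lambda>x. z x ^ k)"
          using e L4_integrable[OF T] L4_integrable[OF z] by (auto simp: T_def)
      qed (use e in auto)
    qed
    have zero: "expectation T = 0" "expectation z = 0"
      using sum_centred[OF Iq] centred[of "Suc j"] Suc.prems by (auto simp: T_def z_def)
    have z2: "expectation (\<lambda>x. z x ^ 2) \<le> K" "expectation (\<lambda>x. z x ^ 4) \<le> K"
      using term_second_moment[of "Suc j"] fourth[of "Suc j"] Suc.prems by (auto simp: z_def)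
    note int = L4_integrable[OF T] L4_integrable[OF z] L4_integrable_pow4[OF T] L4_integrable_pow4[OF z]
      L4_product[OF T z L4_const[of 1] L4_const[of 1], simplified]
      L4_product[OF T T T z] L4_product[OF T T z z] L4_product[OF T z z z]
    have int': "integrable M (\<lambda>x. T x ^ 3 * z x)" "integrable M (\<lambda>x. T x ^ 2 * z x ^ 2)" "integrable M (\<lambda>x. T x * z x ^ 3)"
      using int(10-12) by (simp_all add: power2_eq_square power3_eq_cube mult_ac)
    have "expectation (\<lambda>x. (T x + z x) ^ 2) = expectation (\<lambda>x. T x ^ 2 + 2 * (T x * z x) + z x ^ 2)"
      by (simp add: power2_sum algebra_simps)
    also have "\<dots> = expectation (\<lambda>x. T x ^ 2) + 2 * expectation (\<lambda>x. T x * z x) + expectation (\<lambda>x. z x ^ 2)"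
      using int by simp
    also have "expectation (\<lambda>x. T x * z x) = 0" using factor'[of 1 1] zero by simp
    finally have 2: "expectation (\<lambda>x. (T x + z x) ^ 2) = expectation (\<lambda>x. T x ^ 2) + expectation (\<lambda>x. z x ^ 2)" by simp
    have "expectation (\<lambda>x. (T x + z x) ^ 4)
      = expectation (\<lambda>x. T x ^ 4 + 4 * (T x ^ 3 * z x) + 6 * (T x ^ 2 * z x ^ 2) + 4 * (T x * z x ^ 3) + z x ^ 4)"
      by (intro Bochner_Integration.integral_cong refl) (simp add: power_numeral_reduce algebra_simps)
    also have "\<dots> = expectation (\<lambda>x. T x ^ 4) + 4 * expectation (\<lambda>x. T x ^ 3 * z x)
      + 6 * expectation (\<lambda>x. T x ^ 2 * z x ^ 2) + 4 * expectation (\<lambda>x. T x * z x ^ 3) + expectation (\<lambda>x. z x ^ 4)"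
      using int int' by simp
    also have "expectation (\<lambda>x. T x ^ 3 * z x) = 0" using factor'[of 3 1] zero by simp
    also have "expectation (\<lambda>x. T x * z x ^ 3) = 0" using factor'[of 1 3] zero by simp
    also have "expectation (\<lambda>x. T x ^ 2 * z x ^ 2) = expectation (\<lambda>x. T x ^ 2) * expectation (\<lambda>x. z x ^ 2)"
      using factor'[of 2 2] by simp
    finally have 4: "expectation (\<lambda>x. (T x + z x) ^ 4) = expectation (\<lambda>x. T x ^ 4)
      + 6 * (expectation (\<lambda>x. T x ^ 2) * expectation (\<lambda>x. z x ^ 2)) + expectation (\<lambda>x. z x ^ 4)" by simp
    have "expectation (\<lambda>x. T x ^ 2) * expectation (\<lambda>x. z x ^ 2) \<le> (K * real j) * K"
      using IH(1) z2(1) K by (intro mult_mono) (auto simp: T_def)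
    moreover have "K * 1 \<le> K * K" using K by (intro mult_left_mono) auto
    moreover have "expectation (\<lambda>x. T x ^ 4) \<le> 3 * K ^ 2 * real j ^ 2"
      using IH(2) by (simp add: T_def)
    ultimately have "expectation (\<lambda>x. (T x + z x) ^ 4) \<le> 3 * K ^ 2 * real j ^ 2 + 6 * (K * real j * K) + 3 * (K * K)"
      using z2(2) 4 K by linarith
    also have "\<dots> = 3 * K ^ 2 * real (Suc j) ^ 2"
      by (simp add: power2_eq_square algebra_simps)
    finally show ?thesis using IH(1) z2(1) 2 by (simp add: sum T_def algebra_simps)
  qed
qed

lemma fourth_moment_sum:
  "expectation (\<lambda>x. S q x ^ 4) \<le> 3 * real (a + 1) ^ 4 * K ^ 2 * real q ^ 2"
proof -
  define I where "I = (\<lambda>r. {i\<in>{1..q}. i mod (a + 1) = r})"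
  have "S q x = (\<Sum>r\<in>{..<a + 1}. \<Sum>i\<in>I r. \<xi> i x)" for x
    unfolding S_def I_def by (rule sum.group[symmetric]) auto
  then have "expectation (\<lambda>x. S q x ^ 4) \<le> real (card {..<a + 1}) ^ 4 * (3 * K ^ 2 * real q ^ 2)"
    using class_moments[of q] by (simp only:, intro L4_sum_bound sum_L4) (auto simp: I_def)
  then show ?thesis by (simp add: mult_ac)
qed

lemma S_L4: "j \<le> q \<Longrightarrow> L4 M (S j)"
  unfolding S_def[abs_def] by (intro sum_L4) auto

lemma second_moment_sum:
  "expectation (\<lambda>x. S q x ^ 2) \<le> 2 * real (a + 1) ^ 2 * K * real q"
proof (rule power2_le_imp_le)
  have int: "integrable M (\<lambda>x. S q x ^ 4)" "integrable M (\<lambda>x. S q x ^ 2)"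
    using L4_integrable_pow4 L4_integrable(2) S_L4 by auto
  have "(expectation (\<lambda>x. S q x ^ 2))\<^sup>2 \<le> expectation (\<lambda>x. (S q x ^ 2) ^ 2)"
    using int by (intro square_expectation_le) (simp_all flip: power_mult)
  also have "\<dots> \<le> 3 * real (a + 1) ^ 4 * K ^ 2 * real q ^ 2"
    using fourth_moment_sum by (simp flip: power_mult)
  also have "\<dots> \<le> 4 * real (a + 1) ^ 4 * K ^ 2 * real q ^ 2"
    by (intro mult_right_mono) auto
  also have "\<dots> = (2 * real (a + 1) ^ 2 * K * real q)\<^sup>2"
    by (simp add: power_mult_distrib flip: power_mult del: of_nat_add)
  finally show "(expectation (\<lambda>x. S q x ^ 2))\<^sup>2 \<le> (2 * real (a + 1) ^ 2 * K * real q)\<^sup>2" .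
qed (use K in auto)

text \<open>Peel off the last variable \<open>z\<close>. The sum before it is \<open>P + R\<close>, where the last \<open>a\<close> terms form \<open>R\<close> and
\<open>P\<close> is independent of \<open>z\<close>; in the same way \<open>P = P' + R'\<close> with \<open>P'\<close> independent of \<open>(R, z)\<close>. Every
product that contains \<open>P\<close> or \<open>P'\<close> as the factor carrying the mean zero drops out, so that only
products of boundedly many terms are left. The third moment of the whole sum is therefore linear
in its length, whereas the fourth moment would only give the exponent \<open>3/2\<close>.\<close>

lemma third_moment_step:
  assumes j: "Suc j \<le> q"
  shows "\<bar>expectation (\<lambda>x. S (Suc j) x ^ 3) - expectation (\<lambda>x. S j x ^ 3)\<bar> \<le> 13 * (real (a + 1) ^ 4 * K)"
proof -
  define B where "B = real (a + 1) ^ 4 * K"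
  \<comment> \<open>\<open>j - a\<close> and \<open>j - a - a\<close> may be cut off at 0, in which case the sum over the past is empty\<close>
  define z where "z = \<xi> (Suc j)"
  define P where "P = S (j - a)"
  define R where "R = (\<lambda>x. \<Sum>i\<in>{j - a + 1..j}. \<xi> i x)"
  define P' where "P' = S (j - a - a)"
  define R' where "R' = (\<lambda>x. \<Sum>i\<in>{j - a - a + 1..j - a}. \<xi> i x)"
  have split: "S k x = S (k - a) x + (\<Sum>i\<in>{k - a + 1..k}. \<xi> i x)" for k x
    unfolding S_def by (subst sum.union_disjoint[symmetric]) (auto intro!: sum.cong)
  have SR: "S j x = P x + R x" for x using split[of j x] by (simp add: P_def R_def)
  have PR: "P x = P' x + R' x" for x using split[of "j - a" x] by (simp add: P_def P'_def R'_def)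
  have SS: "S (Suc j) x = S j x + z x" for x by (simp add: S_def z_def)
  have L: "L4 M z" "L4 M P" "L4 M R" "L4 M P'" "L4 M R'" "L4 M (S j)" "L4 M (S (Suc j))"
    unfolding z_def P_def R_def P'_def R'_def using j by (auto intro!: sum_L4 S_L4 L4)
  have B1: "1 \<le> B" unfolding B_def using K mult_mono[of 1 "real (a + 1) ^ 4" 1 K] one_le_power[of "real (a+1)" 4]
    by simp
  have KB: "K \<le> B" unfolding B_def using K mult_right_mono[of 1 "real (a + 1) ^ 4" K] one_le_power[of "real (a+1)" 4]
    by simp
  have block: "expectation (\<lambda>x. (\<Sum>i\<in>{k - a + 1..k}. \<xi> i x) ^ 4) \<le> B" if "k \<le> q" for k
  proof -
    have "expectation (\<lambda>x. (\<Sum>i\<in>{k - a + 1..k}. \<xi> i x) ^ 4) \<le> real (card {k - a + 1..k}) ^ 4 * K"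
      using that by (intro L4_sum_bound L4 fourth) auto
    also have "\<dots> \<le> B" unfolding B_def using K by (intro mult_right_mono power_mono) auto
    finally show ?thesis .
  qed
  have bounds: "expectation (\<lambda>x. R x ^ 4) \<le> B" "expectation (\<lambda>x. R' x ^ 4) \<le> B"
    "expectation (\<lambda>x. z x ^ 4) \<le> B" "expectation (\<lambda>x. 1 ^ 4) \<le> B"
    using block[of j] block[of "j - a"] j fourth[of "Suc j"] KB B1
    by (auto simp: R_def R'_def z_def prob_space)
  have meas: "(\<lambda>y :: nat \<Rightarrow> real. (\<Sum>i\<in>{j - a + 1..j}. y i) * y (Suc j)) \<in> borel_measurable (PiM {j - a - a + a + 1..q} (\<lambda>_. borel))"
    if "a + a < j"
    using that j by (intro borel_measurable_times borel_measurable_sum measurable_component_singleton) auto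
  have P2: "expectation (\<lambda>x. P x ^ e * z x ^ k) = expectation (\<lambda>x. P x ^ e) * expectation (\<lambda>x. z x ^ k)"
    if e: "e \<in> {1,2}" "k \<in> {1,2}" for e k
  proof (cases "a < j")
    case False
    then show ?thesis using e by (auto simp: P_def S_def)
  next
    case True
    show ?thesis unfolding P_def S_def
    proof (rule past_future_factor[OF order_refl])
      show "j - a + a + 1 \<le> q" using True j by simp
      show "(\<lambda>y :: nat \<Rightarrow> real. y (Suc j) ^ k) \<in> borel_measurable (PiM {j - a + a + 1..q} (\<lambda>_. borel))"
        using True j by (intro borel_measurable_power measurable_component_singleton) auto
      show "z x ^ k = (\<lambda>i\<in>{j - a + a + 1..q}. \<xi> i x) (Suc j) ^ k" for x
        using True j by (simp add: z_def)
      show "integrable M (\<lambda>x. (\<Sum>i = 1..j - a. \<xi> i x) ^ e)" "integrable M (\<lambda>x. z x ^ k)"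
        using e L4_integrable[OF L(1)] L4_integrable[OF L(2)] by (auto simp: P_def S_def[abs_def])
    qed (use e in auto)
  qed
  have int2: "integrable M (\<lambda>x. R x * z x)"
    using L4_product[OF L(3) L(1) L4_const[of 1] L4_const[of 1]] by simp
  have PP: "expectation (\<lambda>x. P' x * (R x * z x)) = expectation P' * expectation (\<lambda>x. R x * z x)"
  proof (cases "a + a < j")
    case False
    then show ?thesis by (simp add: P'_def S_def[abs_def])
  next
    case True
    have "expectation (\<lambda>x. (\<Sum>i = 1..j - a - a. \<xi> i x) ^ 1 * (R x * z x))
      = expectation (\<lambda>x. (\<Sum>i = 1..j - a - a. \<xi> i x) ^ 1) * expectation (\<lambda>x. R x * z x)"
    proof (rule past_future_factor[OF order_refl _ _ meas[OF True]])
      show "j - a - a + a + 1 \<le> q" using True j by simp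
      have "(\<Sum>i\<in>{j - a + 1..j}. (\<lambda>i\<in>{j - a - a + a + 1..q}. \<xi> i x) i) = R x" for x
        unfolding R_def using True j by (intro sum.cong) auto
      then show "R x * z x = (\<Sum>i\<in>{j - a + 1..j}. (\<lambda>i\<in>{j - a - a + a + 1..q}. \<xi> i x) i) * (\<lambda>i\<in>{j - a - a + a + 1..q}. \<xi> i x) (Suc j)" for x
        using True j by (simp add: z_def)
      show "integrable M (\<lambda>x. (\<Sum>i = 1..j - a - a. \<xi> i x) ^ 1)"
        using L4_integrable(1)[OF L(4)] by (simp add: P'_def S_def[abs_def])
    qed (use int2 in auto)
    then show ?thesis by (simp add: P'_def S_def[abs_def])
  qed
  have zero: "expectation P = 0" "expectation P' = 0" "expectation z = 0"
    unfolding P_def P'_def z_def S_def[abs_def] using j by (auto intro!: sum_centred centred)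
  note one = L4_const[of 1]
  have i3: "integrable M (\<lambda>x. f x * g x * h x)" if "L4 M f" "L4 M g" "L4 M h" for f g h
    using L4_product[OF that one] by simp
  have b3: "\<bar>expectation (\<lambda>x. f x * g x * h x)\<bar> \<le> B" if "L4 M f" "L4 M g" "L4 M h"
      "expectation (\<lambda>x. f x ^ 4) \<le> B" "expectation (\<lambda>x. g x ^ 4) \<le> B" "expectation (\<lambda>x. h x ^ 4) \<le> B" for f g h
    using L4_product_bound[OF that(1-3) one that(4-6) bounds(4)] by simp
  have "expectation (\<lambda>x. S (Suc j) x ^ 3) = expectation (\<lambda>x. S j x ^ 3
      + 3 * (P x * P x * z x) + 6 * (P' x * R x * z x) + 6 * (R' x * R x * z x) + 3 * (R x * R x * z x)
      + 3 * (P x * z x * z x) + 3 * (R x * z x * z x) + z x * z x * z x)"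
    by (intro Bochner_Integration.integral_cong refl)
      (simp add: SS SR PR power3_eq_cube algebra_simps)
  also have "\<dots> = expectation (\<lambda>x. S j x ^ 3)
      + 3 * expectation (\<lambda>x. P x * P x * z x) + 6 * expectation (\<lambda>x. P' x * R x * z x)
      + 6 * expectation (\<lambda>x. R' x * R x * z x) + 3 * expectation (\<lambda>x. R x * R x * z x)
      + 3 * expectation (\<lambda>x. P x * z x * z x) + 3 * expectation (\<lambda>x. R x * z x * z x) + expectation (\<lambda>x. z x * z x * z x)"
    using L4_integrable(3)[OF L(6)] i3 L by simp
  also have "expectation (\<lambda>x. P x * P x * z x) = 0"
    using P2[of 2 1] zero by (simp add: power2_eq_square)
  also have "expectation (\<lambda>x. P x * z x * z x) = 0"
    using P2[of 1 2] zero by (simp add: power2_eq_square mult.assoc)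
  also have "expectation (\<lambda>x. P' x * R x * z x) = 0"
    using PP zero by (simp add: mult.assoc)
  finally show ?thesis
    using b3[of R' R z] b3[of R R z] b3[of R z z] b3[of z z z] L bounds(1-3)
    unfolding B_def[symmetric] abs_le_iff by linarith
qed

lemma third_moment_sum:
  "\<bar>expectation (\<lambda>x. S q x ^ 3)\<bar> \<le> 13 * real (a + 1) ^ 4 * K * real q"
proof -
  have "\<bar>expectation (\<lambda>x. S j x ^ 3)\<bar> \<le> 13 * (real (a + 1) ^ 4 * K) * real j" if "j \<le> q" for j
    using that
  proof (induction j)
    case 0
    then show ?case by (simp add: S_def)
  next
    case (Suc j)
    then show ?case using third_moment_step[of j] by (simp add: algebra_simps)
  qed
  from this[of q] show ?thesis by (simp add: mult_ac)
qed

end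

section \<open>Squared distances between independent vectors\<close>

lemma product_integral:
  fixes g :: "'a \<Rightarrow> real" and h :: "'b \<Rightarrow> real"
  assumes "prob_space P" "prob_space Q" "integrable P g" "integrable Q h"
  shows "integrable (P \<Otimes>\<^sub>M Q) (\<lambda>z. g (fst z) * h (snd z))"
    and "(\<integral>z. g (fst z) * h (snd z) \<partial>(P \<Otimes>\<^sub>M Q)) = (\<integral>x. g x \<partial>P) * (\<integral>y. h y \<partial>Q)"
proof -
  interpret P: prob_space P by fact
  interpret Q: prob_space Q by fact
  interpret PQ: pair_prob_space P Q ..
  have [measurable]: "g \<in> borel_measurable P" "h \<in> borel_measurable Q" using assms by auto
  show i: "integrable (P \<Otimes>\<^sub>M Q) (\<lambda>z. g (fst z) * h (snd z))"
    by (rule PQ.Fubini_integrable) (use assms in \<open>auto simp: abs_mult\<close>)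
  show "(\<integral>z. g (fst z) * h (snd z) \<partial>(P \<Otimes>\<^sub>M Q)) = (\<integral>x. g x \<partial>P) * (\<integral>y. h y \<partial>Q)"
    using PQ.integral_fst'[OF i] by simp
qed

lemma lift_integral:
  fixes g :: "'a \<Rightarrow> real" and h :: "'b \<Rightarrow> real"
  assumes "prob_space P" "prob_space Q"
  shows "integrable P g \<Longrightarrow> integrable (P \<Otimes>\<^sub>M Q) (\<lambda>z. g (fst z))"
    and "integrable P g \<Longrightarrow> (\<integral>z. g (fst z) \<partial>(P \<Otimes>\<^sub>M Q)) = (\<integral>x. g x \<partial>P)"
    and "integrable Q h \<Longrightarrow> integrable (P \<Otimes>\<^sub>M Q) (\<lambda>z. h (snd z))"
    and "integrable Q h \<Longrightarrow> (\<integral>z. h (snd z) \<partial>(P \<Otimes>\<^sub>M Q)) = (\<integral>y. h y \<partial>Q)"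
  using product_integral[OF assms, of g "\<lambda>_. 1"] product_integral[OF assms, of "\<lambda>_. 1" h]
    assms[THEN prob_space.axioms(1)] assms[THEN prob_space.prob_space]
  by (auto simp: finite_measure.integrable_const)


text \<open>Supplies a generator that is stable under intersection for the events described by a pair of
random variables, one on each factor of a product space.\<close>

lemma sigma_sets_pair_vimage:
  assumes X: "X \<in> P \<rightarrow>\<^sub>M S" and Z: "Z \<in> Q \<rightarrow>\<^sub>M R"
  shows "sigma_sets (space (P \<Otimes>\<^sub>M Q))
      {(\<lambda>z. (X (fst z), Z (snd z))) -` A \<inter> space (P \<Otimes>\<^sub>M Q) | A. A \<in> sets (S \<Otimes>\<^sub>M R)}
    = sigma_sets (space (P \<Otimes>\<^sub>M Q))
      {(X -` a \<inter> space P) \<times> (Z -` b \<inter> space Q) | a b. a \<in> sets S \<and> b \<in> sets R}" (is "_ = sigma_sets _ ?G")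
proof -
  have "(\<lambda>z. (X (fst z), Z (snd z))) \<in> space (P \<Otimes>\<^sub>M Q) \<rightarrow> space S \<times> space R"
    using measurable_space[OF X] measurable_space[OF Z] by (auto simp: space_pair_measure)
  from sigma_sets_vimage_commute[OF this, of "{a \<times> b | a b. a \<in> sets S \<and> b \<in> sets R}"]
  have "{(\<lambda>z. (X (fst z), Z (snd z))) -` A \<inter> space (P \<Otimes>\<^sub>M Q) | A. A \<in> sets (S \<Otimes>\<^sub>M R)}
    = sigma_sets (space (P \<Otimes>\<^sub>M Q))
       {(\<lambda>z. (X (fst z), Z (snd z))) -` A \<inter> space (P \<Otimes>\<^sub>M Q) | A. A \<in> {a \<times> b | a b. a \<in> sets S \<and> b \<in> sets R}}"
    by (simp add: sets_pair_measure)
  also have "{(\<lambda>z. (X (fst z), Z (snd z))) -` A \<inter> space (P \<Otimes>\<^sub>M Q) | A. A \<in> {a \<times> b | a b. a \<in> sets S \<and> b \<in> sets R}}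
    = {(\<lambda>z. (X (fst z), Z (snd z))) -` (a \<times> b) \<inter> space (P \<Otimes>\<^sub>M Q) | a b. a \<in> sets S \<and> b \<in> sets R}"
    by blast
  also have "\<dots> = ?G"
  proof -
    have "(\<lambda>z. (X (fst z), Z (snd z))) -` (a \<times> b) \<inter> space (P \<Otimes>\<^sub>M Q) = (X -` a \<inter> space P) \<times> (Z -` b \<inter> space Q)" for a b
      by (auto simp: space_pair_measure)
    then show ?thesis by (simp only:)
  qed
  finally have eq: "{(\<lambda>z. (X (fst z), Z (snd z))) -` A \<inter> space (P \<Otimes>\<^sub>M Q) | A. A \<in> sets (S \<Otimes>\<^sub>M R)}
    = sigma_sets (space (P \<Otimes>\<^sub>M Q)) ?G" .
  show ?thesis unfolding eq by (rule sigma_sets_sigma_sets_eq) (auto simp: space_pair_measure)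
qed

lemma Int_stable_rectangles:
  "Int_stable {(X -` a \<inter> U) \<times> (Z -` b \<inter> V) | a b. a \<in> sets S \<and> b \<in> sets R}" (is "Int_stable ?G")
proof (rule Int_stableI)
  fix c d assume cd: "c \<in> ?G" "d \<in> ?G"
  from cd(1) obtain a b where 1: "c = (X -` a \<inter> U) \<times> (Z -` b \<inter> V)" "a \<in> sets S" "b \<in> sets R"
    by (elim CollectE exE conjE)
  from cd(2) obtain a' b' where 2: "d = (X -` a' \<inter> U) \<times> (Z -` b' \<inter> V)" "a' \<in> sets S" "b' \<in> sets R"
    by (elim CollectE exE conjE)
  have sets: "a \<inter> a' \<in> sets S" "b \<inter> b' \<in> sets R" using 1 2 by auto
  have "c \<inter> d = (X -` (a \<inter> a') \<inter> U) \<times> (Z -` (b \<inter> b') \<inter> V)" unfolding 1 2 by blast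
  with sets show "c \<inter> d \<in> ?G" unfolding mem_Collect_eq by (intro exI conjI)
qed

text \<open>If the past is independent of the future under each of two laws, then the same holds for the
pair of pasts and the pair of futures under the product law. By the generator above it is enough
to compare rectangles, on which all four probabilities factorise.\<close>

lemma indep_var_pair:
  assumes P: "prob_space P" and Q: "prob_space Q"
    and 1: "prob_space.indep_var P S1 X1 T1 Y1" and 2: "prob_space.indep_var Q S2 X2 T2 Y2"
  shows "prob_space.indep_var (P \<Otimes>\<^sub>M Q) (S1 \<Otimes>\<^sub>M S2) (\<lambda>z. (X1 (fst z), X2 (snd z)))
    (T1 \<Otimes>\<^sub>M T2) (\<lambda>z. (Y1 (fst z), Y2 (snd z)))"
proof -
  interpret P: prob_space P by fact
  interpret Q: prob_space Q by fact
  interpret PQ: pair_prob_space P Q ..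
  have rv[measurable]: "X1 \<in> P \<rightarrow>\<^sub>M S1" "Y1 \<in> P \<rightarrow>\<^sub>M T1" "X2 \<in> Q \<rightarrow>\<^sub>M S2" "Y2 \<in> Q \<rightarrow>\<^sub>M T2"
    using 1 2 by (auto simp: P.indep_var_eq Q.indep_var_eq)
  have meas: "measure (P \<Otimes>\<^sub>M Q) (U \<times> V) = measure P U * measure Q V" if "U \<in> sets P" "V \<in> sets Q" for U V
    using that by (simp add: measure_def Q.emeasure_pair_measure_Times enn2real_mult)
  have "PQ.indep_set
      {(X1 -` a \<inter> space P) \<times> (X2 -` b \<inter> space Q) | a b. a \<in> sets S1 \<and> b \<in> sets S2}
      {(Y1 -` a \<inter> space P) \<times> (Y2 -` b \<inter> space Q) | a b. a \<in> sets T1 \<and> b \<in> sets T2}"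
  proof (rule PQ.indep_setI)
    fix c d
    assume c: "c \<in> {(X1 -` a \<inter> space P) \<times> (X2 -` b \<inter> space Q) | a b. a \<in> sets S1 \<and> b \<in> sets S2}"
      and d: "d \<in> {(Y1 -` a \<inter> space P) \<times> (Y2 -` b \<inter> space Q) | a b. a \<in> sets T1 \<and> b \<in> sets T2}"
    from c obtain a b where c: "c = (X1 -` a \<inter> space P) \<times> (X2 -` b \<inter> space Q)"
      and [measurable]: "a \<in> sets S1" "b \<in> sets S2" by (elim CollectE exE conjE)
    from d obtain a' b' where d: "d = (Y1 -` a' \<inter> space P) \<times> (Y2 -` b' \<inter> space Q)"
      and [measurable]: "a' \<in> sets T1" "b' \<in> sets T2" by (elim CollectE exE conjE)
    have Int: "c \<inter> d = ((\<lambda>x. (X1 x, Y1 x)) -` (a \<times> a') \<inter> space P) \<times> ((\<lambda>x. (X2 x, Y2 x)) -` (b \<times> b') \<inter> space Q)"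
      unfolding c d by blast
    have "measure (P \<Otimes>\<^sub>M Q) (c \<inter> d) = measure P ((\<lambda>x. (X1 x, Y1 x)) -` (a \<times> a') \<inter> space P)
      * measure Q ((\<lambda>x. (X2 x, Y2 x)) -` (b \<times> b') \<inter> space Q)"
      unfolding Int by (rule meas) measurable
    also have "\<dots> = (P.prob (X1 -` a \<inter> space P) * P.prob (Y1 -` a' \<inter> space P))
      * (Q.prob (X2 -` b \<inter> space Q) * Q.prob (Y2 -` b' \<inter> space Q))"
      by (subst P.indep_varD[OF 1], simp, simp, subst Q.indep_varD[OF 2], simp, simp, rule refl)
    also have "\<dots> = measure (P \<Otimes>\<^sub>M Q) c * measure (P \<Otimes>\<^sub>M Q) d"
      unfolding c d by (subst (1 2) meas) auto
    finally show "measure (P \<Otimes>\<^sub>M Q) (c \<inter> d) = measure (P \<Otimes>\<^sub>M Q) c * measure (P \<Otimes>\<^sub>M Q) d" .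
  qed (auto intro!: pair_measureI)
  from PQ.indep_set_sigma_sets[OF this Int_stable_rectangles Int_stable_rectangles]
  show ?thesis
    by (subst PQ.indep_var_eq) (simp add: sigma_sets_pair_vimage)
qed



locale vector_law = prob_space P for P :: "vec measure" +
  fixes q :: nat and U :: real
  assumes sets_eq: "sets P = sets (Rp q)"
    and moment: "\<And>j. j \<in> {1..q} \<Longrightarrow> integrable P (\<lambda>x. x j ^ 8)"
      "\<And>j. j \<in> {1..q} \<Longrightarrow> expectation (\<lambda>x. x j ^ 8) \<le> U"
    and U: "1 \<le> U"
begin

lemma coord_measurable[measurable]: "j \<in> {1..q} \<Longrightarrow> (\<lambda>x. x j) \<in> borel_measurable P"
  by (subst measurable_cong_sets[OF sets_eq refl]) (rule measurable_component_singleton)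

lemma coord_sq_L4: "j \<in> {1..q} \<Longrightarrow> L4 P (\<lambda>x. x j ^ 2)"
  using moment(1)[of j] by (simp add: L4_def coord_measurable flip: power_mult)

end

lemma L4_dominated:
  assumes "L4 M g" "f \<in> borel_measurable M" "\<And>x. x \<in> space M \<Longrightarrow> \<bar>f x\<bar> \<le> g x"
  shows "L4 M f"
  unfolding L4_def
proof
  show "integrable M (\<lambda>x. f x ^ 4)"
  proof (rule Bochner_Integration.integrable_bound[OF L4_integrable_pow4[OF assms(1)]])
    show "AE x in M. norm (f x ^ 4) \<le> norm (g x ^ 4)"
    proof (rule AE_I2)
      fix x assume "x \<in> space M"
      then have "\<bar>f x\<bar> ^ 4 \<le> g x ^ 4" by (intro power_mono assms) auto
      then show "norm (f x ^ 4) \<le> norm (g x ^ 4)" by (simp add: power_abs)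
    qed
  qed (use assms in measurable)
qed (rule assms)

lemma (in vector_law) coord_L4: 
  assumes "j \<in> {1..q}" shows "L4 P (\<lambda>x. x j)"
proof (rule L4_dominated)
  show "L4 P (\<lambda>x. 1 + x j ^ 2)" by (intro L4_add L4_const coord_sq_L4 assms)
  show "\<bar>x j\<bar> \<le> 1 + x j ^ 2" for x :: vec
    using sum_squares_bound[of 1 "\<bar>x j\<bar>"] by simp
qed (use assms in measurable)

lemma L4_lift:
  assumes "prob_space P" "prob_space Q"
  shows "L4 P f \<Longrightarrow> L4 (P \<Otimes>\<^sub>M Q) (\<lambda>z. f (fst z))" "L4 Q g \<Longrightarrow> L4 (P \<Otimes>\<^sub>M Q) (\<lambda>z. g (snd z))"
  using lift_integral(1)[OF assms, of "\<lambda>x. f x ^ 4"] lift_integral(3)[OF assms, of "\<lambda>x. g x ^ 4"]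
  by (auto simp: L4_def)

lemma lag_independent_mono:
  assumes "lag_independent q b P" "b \<le> a" shows "lag_independent q a P"
  using assms unfolding lag_independent_def by auto

definition sq_dist :: "nat \<Rightarrow> vec \<times> vec \<Rightarrow> real" where
  "sq_dist q z = (\<Sum>i = 1..q. (fst z i - snd z i)\<^sup>2)"

text \<open>The pair may consist of two copies of the same law, so that one development covers the
distances between samples and within samples.\<close>

locale law_pair = P: vector_law P q U + Q: vector_law Q q U
  for P Q :: "vec measure" and q :: nat and U :: real +
  fixes a :: nat
  assumes lagP: "lag_independent q a P" and lagQ: "lag_independent q a Q"
begin

sublocale PQ: prob_space "P \<Otimes>\<^sub>M Q"
  by (rule prob_space_pair) unfold_locales

abbreviation d2 :: "nat \<Rightarrow> vec \<times> vec \<Rightarrow> real" where "d2 i z \<equiv> (fst z i - snd z i)\<^sup>2"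

definition \<xi> :: "nat \<Rightarrow> vec \<times> vec \<Rightarrow> real" where
  "\<xi> i z = d2 i z - PQ.expectation (d2 i)"

lemma d2_L4: assumes "i \<in> {1..q}"
  shows "L4 (P \<Otimes>\<^sub>M Q) (d2 i)" and "PQ.expectation (\<lambda>z. d2 i z ^ 4) \<le> 256 * U"
proof -
  note L = L4_lift(1)[OF P.prob_space_axioms Q.prob_space_axioms P.coord_sq_L4[OF assms]]
    L4_lift(2)[OF P.prob_space_axioms Q.prob_space_axioms Q.coord_sq_L4[OF assms]]
  have le: "d2 i z \<le> 2 * ((fst z i)\<^sup>2 + (snd z i)\<^sup>2)" for z :: "vec \<times> vec"
    using sum_squares_bound[of "fst z i" "- snd z i"] by (simp add: power2_diff)
  have m: "d2 i \<in> borel_measurable (P \<Otimes>\<^sub>M Q)"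
    using measurable_compose[OF measurable_fst P.coord_measurable[OF assms]]
      measurable_compose[OF measurable_snd Q.coord_measurable[OF assms]] by measurable
  show L2: "L4 (P \<Otimes>\<^sub>M Q) (d2 i)"
    by (rule L4_dominated[OF L4_cmult[OF L4_add[OF L], of 2] m]) (use le in simp)
  have "PQ.expectation (\<lambda>z. d2 i z ^ 4) \<le> PQ.expectation (\<lambda>z. 128 * (((fst z i)\<^sup>2) ^ 4 + ((snd z i)\<^sup>2) ^ 4))"
  proof (rule integral_mono)
    show "integrable (P \<Otimes>\<^sub>M Q) (\<lambda>z. d2 i z ^ 4)" by (rule L4_integrable_pow4[OF L2])
    show "integrable (P \<Otimes>\<^sub>M Q) (\<lambda>z. 128 * (((fst z i)\<^sup>2) ^ 4 + ((snd z i)\<^sup>2) ^ 4))"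
      using L4_integrable_pow4[OF L(1)] L4_integrable_pow4[OF L(2)] by simp
    fix z :: "vec \<times> vec"
    have "d2 i z ^ 4 \<le> (2 * ((fst z i)\<^sup>2 + (snd z i)\<^sup>2)) ^ 4" by (rule power_mono[OF le]) simp
    also have "\<dots> = 16 * ((fst z i)\<^sup>2 + (snd z i)\<^sup>2) ^ 4" by (simp only: power_mult_distrib) simp
    also have "\<dots> \<le> 16 * (8 * (((fst z i)\<^sup>2) ^ 4 + ((snd z i)\<^sup>2) ^ 4))"
      by (intro mult_left_mono add_pow4_le) simp
    finally show "d2 i z ^ 4 \<le> 128 * (((fst z i)\<^sup>2) ^ 4 + ((snd z i)\<^sup>2) ^ 4)" by simp
  qed
  also have "\<dots> = 128 * (P.expectation (\<lambda>x. x i ^ 8) + Q.expectation (\<lambda>x. x i ^ 8))"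
    using L4_integrable_pow4[OF L(1)] L4_integrable_pow4[OF L(2)]
      lift_integral(2)[OF P.prob_space_axioms Q.prob_space_axioms P.moment(1)[OF assms]]
      lift_integral(4)[OF P.prob_space_axioms Q.prob_space_axioms Q.moment(1)[OF assms]]
    by (simp flip: power_mult)
  also have "\<dots> \<le> 256 * U" using P.moment(2)[OF assms] Q.moment(2)[OF assms] by simp
  finally show "PQ.expectation (\<lambda>z. d2 i z ^ 4) \<le> 256 * U" .
qed

lemma \<xi>_indep:
  assumes "1 \<le> j" "j + a + 1 \<le> q"
  shows "PQ.indep_var (PiM {1..j} (\<lambda>_. borel)) (\<lambda>z. \<lambda>i\<in>{1..j}. \<xi> i z)
        (PiM {j + a + 1..q} (\<lambda>_. borel)) (\<lambda>z. \<lambda>i\<in>{j + a + 1..q}. \<xi> i z)"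
proof -
  define \<phi> :: "nat set \<Rightarrow> vec \<times> vec \<Rightarrow> vec" where
    "\<phi> I = (\<lambda>w. \<lambda>i\<in>I. (fst w i - snd w i)\<^sup>2 - PQ.expectation (d2 i))" for I
  have \<phi>: "\<phi> I \<in> (PiM I (\<lambda>_. borel) \<Otimes>\<^sub>M PiM I (\<lambda>_. borel)) \<rightarrow>\<^sub>M PiM I (\<lambda>_. borel)" for I
    unfolding \<phi>_def
  proof (rule measurable_restrict)
    fix i assume "i \<in> I"
    then show "(\<lambda>w. (fst w i - snd w i)\<^sup>2 - PQ.expectation (d2 i)) \<in> borel_measurable (PiM I (\<lambda>_. borel) \<Otimes>\<^sub>M PiM I (\<lambda>_. borel))"
      by (intro borel_measurable_diff borel_measurable_power borel_measurable_const
          measurable_compose[OF measurable_fst] measurable_compose[OF measurable_snd] measurable_component_singleton)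
  qed
  have ind: "P.indep_var (PiM {1..j} (\<lambda>_. borel)) (\<lambda>x. restrict x {1..j})
          (PiM {j + a + 1..q} (\<lambda>_. borel)) (\<lambda>x. restrict x {j + a + 1..q})"
    "Q.indep_var (PiM {1..j} (\<lambda>_. borel)) (\<lambda>x. restrict x {1..j})
          (PiM {j + a + 1..q} (\<lambda>_. borel)) (\<lambda>x. restrict x {j + a + 1..q})"
    using lagP[unfolded lag_independent_def, rule_format, of j "a + 1"]
      lagQ[unfolded lag_independent_def, rule_format, of j "a + 1"] assms by (simp_all add: add.assoc)
  have eq: "\<phi> I (restrict (fst z) I, restrict (snd z) I) = (\<lambda>i\<in>I. \<xi> i z)" for I z
    by (auto simp: \<phi>_def \<xi>_def intro!: restrict_ext)
  from PQ.indep_var_compose[OF indep_var_pair[OF P.prob_space_axioms Q.prob_space_axioms ind] \<phi> \<phi>]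
  show ?thesis by (simp add: comp_def eq)
qed

sublocale m_dependent "P \<Otimes>\<^sub>M Q" \<xi> q a "4096 * U"
proof
  fix i assume i: "i \<in> {1..q}"
  note L = d2_L4(1)[OF i]
  show "L4 (P \<Otimes>\<^sub>M Q) (\<xi> i)" unfolding \<xi>_def[abs_def] by (intro L4_diff L PQ.L4_const)
  show "PQ.expectation (\<xi> i) = 0"
    using PQ.L4_integrable(1)[OF L] by (simp add: \<xi>_def[abs_def] PQ.prob_space)
  define m where "m = PQ.expectation (d2 i)"
  have "m ^ 4 = (m\<^sup>2)\<^sup>2" by (simp flip: power_mult)
  also have "\<dots> \<le> (PQ.expectation (\<lambda>z. (d2 i z)\<^sup>2))\<^sup>2"
    unfolding m_def by (intro power_mono PQ.square_expectation_le PQ.L4_integrable L) auto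
  also have "\<dots> \<le> PQ.expectation (\<lambda>z. ((d2 i z)\<^sup>2)\<^sup>2)"
    using PQ.L4_integrable(2)[OF L] L4_integrable_pow4[OF L]
    by (intro PQ.square_expectation_le) (simp_all flip: power_mult)
  also have "\<dots> \<le> 256 * U" using d2_L4(2)[OF i] by (simp flip: power_mult)
  finally have m4: "m ^ 4 \<le> 256 * U" .
  have "PQ.expectation (\<lambda>z. \<xi> i z ^ 4) \<le> PQ.expectation (\<lambda>z. 8 * (d2 i z ^ 4 + (- m) ^ 4))"
  proof (rule integral_mono)
    show "\<xi> i z ^ 4 \<le> 8 * (d2 i z ^ 4 + (- m) ^ 4)" for z
      using add_pow4_le[of "d2 i z" "- m"] by (simp add: \<xi>_def m_def)
    show "integrable (P \<Otimes>\<^sub>M Q) (\<lambda>z. \<xi> i z ^ 4)"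
      by (rule L4_integrable_pow4) (unfold \<xi>_def[abs_def], intro L4_diff L PQ.L4_const)
    show "integrable (P \<Otimes>\<^sub>M Q) (\<lambda>z. 8 * (d2 i z ^ 4 + (- m) ^ 4))"
      using L4_integrable_pow4[OF L] by simp
  qed
  also have "\<dots> = 8 * (PQ.expectation (\<lambda>z. d2 i z ^ 4) + m ^ 4)"
    using L4_integrable_pow4[OF L] by (simp add: PQ.prob_space)
  also have "\<dots> \<le> 4096 * U" using m4 d2_L4(2)[OF i] by simp
  finally show "PQ.expectation (\<lambda>z. \<xi> i z ^ 4) \<le> 4096 * U" .
qed (use P.U \<xi>_indep in auto)

lemma sq_dist_L4: "L4 (P \<Otimes>\<^sub>M Q) (sq_dist q)"
  unfolding sq_dist_def[abs_def] by (intro PQ.L4_sum d2_L4)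

lemma sq_dist_centred: "sq_dist q z - PQ.expectation (sq_dist q) = S q z"
  unfolding S_def \<xi>_def sq_dist_def[abs_def]
  by (subst Bochner_Integration.integral_sum) (auto simp: sum_subtractf intro!: PQ.L4_integrable(1) d2_L4(1))

end

lemma has_bochner_integral_product:
  fixes g :: "'a \<Rightarrow> real" and h :: "'b \<Rightarrow> real"
  assumes "prob_space P" "prob_space Q" "has_bochner_integral P g u" "has_bochner_integral Q h v"
  shows "has_bochner_integral (P \<Otimes>\<^sub>M Q) (\<lambda>z. g (fst z) * h (snd z)) (u * v)"
  using product_integral[OF assms(1,2), of g h] assms(3,4) by (simp add: has_bochner_integral_iff)

lemma has_bochner_integral_lift:
  fixes g :: "'a \<Rightarrow> real" and h :: "'b \<Rightarrow> real"
  assumes "prob_space P" "prob_space Q"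
  shows "has_bochner_integral P g u \<Longrightarrow> has_bochner_integral (P \<Otimes>\<^sub>M Q) (\<lambda>z. g (fst z)) u"
    and "has_bochner_integral Q h v \<Longrightarrow> has_bochner_integral (P \<Otimes>\<^sub>M Q) (\<lambda>z. h (snd z)) v"
  using lift_integral(1,2)[OF assms, of g] lift_integral(3,4)[OF assms, of h] by (simp_all add: has_bochner_integral_iff)

definition centred_norm_sq :: "nat \<Rightarrow> vec measure \<Rightarrow> vec \<Rightarrow> real" where
  "centred_norm_sq q P x = (\<Sum>i = 1..q. (x i - mean P i)\<^sup>2)"

lemma centered_sq_norm_eq: "centered_sq_norm q P = (\<integral>x. centred_norm_sq q P x \<partial>P)"
  by (simp add: centered_sq_norm_def centred_norm_sq_def L2_set_def sum_nonneg)

lemma mean_sq_dist_eq: "mean_sq_dist q P Q = (\<integral>z. sq_dist q z \<partial>(P \<Otimes>\<^sub>M Q))"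
  by (simp add: mean_sq_dist_def edist_def sq_dist_def L2_set_def sum_nonneg)

lemma frobenius_sq: "(frobenius q B)\<^sup>2 = (\<Sum>i = 1..q. \<Sum>j = 1..q. (B i j)\<^sup>2)"
  by (simp add: frobenius_def L2_set_def sum_nonneg sum.cartesian_product split_def)

context vector_law begin

lemma centred_L4: "j \<in> {1..q} \<Longrightarrow> L4 P (\<lambda>x. x j - mean P j)"
  by (intro L4_diff coord_L4 L4_const)

lemma centred_sq_L4:
  assumes "j \<in> {1..q}" shows "L4 P (\<lambda>x. (x j - mean P j)\<^sup>2)"
proof (rule L4_dominated)
  show "L4 P (\<lambda>x. 2 * ((x j)\<^sup>2 + (mean P j)\<^sup>2))" by (intro L4_add L4_const L4_cmult coord_sq_L4 assms)
  show "\<bar>(x j - mean P j)\<^sup>2\<bar> \<le> 2 * ((x j)\<^sup>2 + (mean P j)\<^sup>2)" for x :: vec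
    unfolding abs_power2 using sum_squares_bound[of "x j" "- mean P j"] by (simp add: power2_diff)
qed (use assms in measurable)

lemma centred_norm_sq_L4: "L4 P (centred_norm_sq q P)"
  unfolding centred_norm_sq_def[abs_def] by (intro L4_sum centred_sq_L4)

lemma centred_norm_sq_integral: "has_bochner_integral P (centred_norm_sq q P) (centered_sq_norm q P)"
  using L4_integrable(1)[OF centred_norm_sq_L4] by (simp add: has_bochner_integral_iff centered_sq_norm_eq)

lemma centred_integral: "j \<in> {1..q} \<Longrightarrow> has_bochner_integral P (\<lambda>x. x j - mean P j) 0"
  using L4_integrable(1)[OF coord_L4[of j]] by (simp add: has_bochner_integral_iff mean_def prob_space)

lemma covariance_integral:
  assumes "i \<in> {1..q}" "j \<in> {1..q}"
  shows "has_bochner_integral P (\<lambda>x. (x i - mean P i) * (x j - mean P j)) (covariance P i j)"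
  using L4_product[OF centred_L4[OF assms(1)] centred_L4[OF assms(2)] L4_const[of 1] L4_const[of 1]]
  by (simp add: has_bochner_integral_iff covariance_def)

lemma centred_norm_sq_centred_integrable:
  assumes "i \<in> {1..q}" shows "integrable P (\<lambda>x. centred_norm_sq q P x * (x i - mean P i))"
  using L4_product[OF centred_norm_sq_L4 centred_L4[OF assms(1)] L4_const[of 1] L4_const[of 1]] by simp

end

context law_pair begin

lemma sq_dist_split:
  assumes "\<And>i. i \<in> {1..q} \<Longrightarrow> mean P i = mean Q i"
  shows "sq_dist q z = centred_norm_sq q P (fst z) + centred_norm_sq q Q (snd z)
    - 2 * (\<Sum>i = 1..q. (fst z i - mean P i) * (snd z i - mean Q i))"
proof -
  have "sq_dist q z = (\<Sum>i = 1..q. (fst z i - mean P i)\<^sup>2 + (snd z i - mean Q i)\<^sup>2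
    - 2 * ((fst z i - mean P i) * (snd z i - mean Q i)))"
    unfolding sq_dist_def by (intro sum.cong refl) (simp add: assms power2_eq_square algebra_simps)
  then show ?thesis by (simp add: centred_norm_sq_def sum.distrib sum_subtractf sum_distrib_left)
qed

lemma sq_dist_mean:
  assumes "\<And>i. i \<in> {1..q} \<Longrightarrow> mean P i = mean Q i"
  shows "PQ.expectation (sq_dist q) = centered_sq_norm q P + centered_sq_norm q Q"
proof -
  have "has_bochner_integral (P \<Otimes>\<^sub>M Q) (\<lambda>z. centred_norm_sq q P (fst z) + centred_norm_sq q Q (snd z)
    - 2 * (\<Sum>i = 1..q. (fst z i - mean P i) * (snd z i - mean Q i)))
    (centered_sq_norm q P + centered_sq_norm q Q - 2 * (\<Sum>i = 1..q. 0 * 0))"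
    by (intro has_bochner_integral_add has_bochner_integral_diff has_bochner_integral_mult_right
        has_bochner_integral_sum has_bochner_integral_product has_bochner_integral_lift
        P.centred_norm_sq_integral Q.centred_norm_sq_integral P.centred_integral Q.centred_integral
        P.prob_space_axioms Q.prob_space_axioms)
  moreover have "sq_dist q = (\<lambda>z. centred_norm_sq q P (fst z) + centred_norm_sq q Q (snd z)
    - 2 * (\<Sum>i = 1..q. (fst z i - mean P i) * (snd z i - mean Q i)))"
    by (rule ext) (rule sq_dist_split[OF assms])
  ultimately show ?thesis by (simp add: has_bochner_integral_iff)
qed

text \<open>With \<open>A = |x - \<mu>|\<^sup>2\<close>, \<open>B = |y - \<mu>|\<^sup>2\<close> and \<open>c\<close> the inner product of the centred vectors, the squared
distance is \<open>A + B - 2c\<close>. Independence turns the expectation of \<open>c\<^sup>2\<close> into the inner product of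
the covariance matrices, and the mixed terms \<open>Ac\<close> and \<open>Bc\<close> integrate to zero.\<close>

lemma sq_dist_second_moment:
  assumes "\<And>i. i \<in> {1..q} \<Longrightarrow> mean P i = mean Q i"
  shows "PQ.expectation (\<lambda>z. (sq_dist q z)\<^sup>2) = P.expectation (\<lambda>x. (centred_norm_sq q P x)\<^sup>2) + Q.expectation (\<lambda>x. (centred_norm_sq q Q x)\<^sup>2)
    + 2 * (centered_sq_norm q P * centered_sq_norm q Q)
    + 4 * (\<Sum>i = 1..q. \<Sum>j = 1..q. covariance P i j * covariance Q i j)"
proof -
  let ?x = "\<lambda>i x. x i - mean P i" and ?y = "\<lambda>i y. y i - mean Q i"
  note ps = P.prob_space_axioms Q.prob_space_axioms
  have 1: "has_bochner_integral P (\<lambda>x. (centred_norm_sq q P x)\<^sup>2) (P.expectation (\<lambda>x. (centred_norm_sq q P x)\<^sup>2))"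
    using P.L4_integrable(2)[OF P.centred_norm_sq_L4] by (rule has_bochner_integral_integrable)
  have 2: "has_bochner_integral Q (\<lambda>x. (centred_norm_sq q Q x)\<^sup>2) (Q.expectation (\<lambda>x. (centred_norm_sq q Q x)\<^sup>2))"
    using Q.L4_integrable(2)[OF Q.centred_norm_sq_L4] by (rule has_bochner_integral_integrable)
  have "has_bochner_integral (P \<Otimes>\<^sub>M Q) (\<lambda>z. (centred_norm_sq q P (fst z))\<^sup>2 + (centred_norm_sq q Q (snd z))\<^sup>2
     + 2 * (centred_norm_sq q P (fst z) * centred_norm_sq q Q (snd z))
     + 4 * (\<Sum>i = 1..q. \<Sum>j = 1..q. (?x i (fst z) * ?x j (fst z)) * (?y i (snd z) * ?y j (snd z)))
     - 4 * (\<Sum>i = 1..q. (centred_norm_sq q P (fst z) * ?x i (fst z)) * ?y i (snd z))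
     - 4 * (\<Sum>i = 1..q. ?x i (fst z) * (centred_norm_sq q Q (snd z) * ?y i (snd z))))
    (P.expectation (\<lambda>x. (centred_norm_sq q P x)\<^sup>2) + Q.expectation (\<lambda>x. (centred_norm_sq q Q x)\<^sup>2)
    + 2 * (centered_sq_norm q P * centered_sq_norm q Q)
    + 4 * (\<Sum>i = 1..q. \<Sum>j = 1..q. covariance P i j * covariance Q i j)
    - 4 * (\<Sum>i = 1..q. P.expectation (\<lambda>x. centred_norm_sq q P x * ?x i x) * 0)
    - 4 * (\<Sum>i = 1..q. 0 * Q.expectation (\<lambda>y. centred_norm_sq q Q y * ?y i y)))"
    by (intro has_bochner_integral_add has_bochner_integral_diff has_bochner_integral_mult_right
        has_bochner_integral_sum has_bochner_integral_product has_bochner_integral_lift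
        1 2 P.centred_norm_sq_integral Q.centred_norm_sq_integral P.centred_integral Q.centred_integral
        P.covariance_integral Q.covariance_integral has_bochner_integral_integrable
        P.centred_norm_sq_centred_integrable Q.centred_norm_sq_centred_integrable ps)
  moreover have "(sq_dist q z)\<^sup>2 = (centred_norm_sq q P (fst z))\<^sup>2 + (centred_norm_sq q Q (snd z))\<^sup>2
     + 2 * (centred_norm_sq q P (fst z) * centred_norm_sq q Q (snd z))
     + 4 * (\<Sum>i = 1..q. \<Sum>j = 1..q. (?x i (fst z) * ?x j (fst z)) * (?y i (snd z) * ?y j (snd z)))
     - 4 * (\<Sum>i = 1..q. (centred_norm_sq q P (fst z) * ?x i (fst z)) * ?y i (snd z))
     - 4 * (\<Sum>i = 1..q. ?x i (fst z) * (centred_norm_sq q Q (snd z) * ?y i (snd z)))" for z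
  proof -
    define c where "c = (\<lambda>i. ?x i (fst z) * ?y i (snd z))"
    have "(\<Sum>i = 1..q. \<Sum>j = 1..q. (?x i (fst z) * ?x j (fst z)) * (?y i (snd z) * ?y j (snd z))) = (\<Sum>i = 1..q. c i)\<^sup>2"
      by (simp add: power2_eq_square sum_product c_def mult_ac)
    moreover have "(\<Sum>i = 1..q. (centred_norm_sq q P (fst z) * ?x i (fst z)) * ?y i (snd z)) = centred_norm_sq q P (fst z) * (\<Sum>i = 1..q. c i)"
      by (simp add: sum_distrib_left c_def mult_ac)
    moreover have "(\<Sum>i = 1..q. ?x i (fst z) * (centred_norm_sq q Q (snd z) * ?y i (snd z))) = centred_norm_sq q Q (snd z) * (\<Sum>i = 1..q. c i)"
      by (simp add: sum_distrib_left c_def mult_ac)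
    moreover have "sq_dist q z = centred_norm_sq q P (fst z) + centred_norm_sq q Q (snd z) - 2 * (\<Sum>i = 1..q. c i)"
      using sq_dist_split[OF assms] by (simp add: c_def)
    ultimately show ?thesis by (simp only:) (simp add: power2_eq_square algebra_simps)
  qed
  ultimately show ?thesis by (simp add: has_bochner_integral_iff)
qed

text \<open>One constant for the second, third and fourth moments. It depends only on the lag and the moment
bound, hence not on the dimension or on which of the two laws are paired.\<close>

definition moment_const :: real where "moment_const = 13 * real (a + 1) ^ 4 * (4096 * U)\<^sup>2"

lemma moment_const_ge_1: "1 \<le> moment_const"
proof -
  have "1 * 1 * 1 \<le> 13 * real (a + 1) ^ 4 * (4096 * U)\<^sup>2"
    using P.U by (intro mult_mono one_le_power) auto
  then show ?thesis by (simp add: moment_const_def)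
qed

lemma S_moments:
  "PQ.expectation (\<lambda>z. S q z ^ 2) \<le> moment_const * real q"
  "\<bar>PQ.expectation (\<lambda>z. S q z ^ 3)\<bar> \<le> moment_const * real q"
  "PQ.expectation (\<lambda>z. S q z ^ 4) \<le> moment_const * (real q)\<^sup>2"
proof -
  have K: "1 \<le> 4096 * U" using P.U by simp
  have KK: "4096 * U \<le> (4096 * U)\<^sup>2" using K by (simp add: power2_eq_square)
  have A: "real (a + 1) ^ 2 \<le> real (a + 1) ^ 4" by (intro power_increasing) auto
  have "2 * real (a + 1) ^ 2 * (4096 * U) * real q \<le> 13 * real (a + 1) ^ 4 * (4096 * U)\<^sup>2 * real q"
    using K KK A by (intro mult_mono) auto
  then show "PQ.expectation (\<lambda>z. S q z ^ 2) \<le> moment_const * real q"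
    using second_moment_sum unfolding moment_const_def by linarith
  have "13 * real (a + 1) ^ 4 * (4096 * U) * real q \<le> 13 * real (a + 1) ^ 4 * (4096 * U)\<^sup>2 * real q"
    using K KK by (intro mult_right_mono mult_left_mono) auto
  then show "\<bar>PQ.expectation (\<lambda>z. S q z ^ 3)\<bar> \<le> moment_const * real q"
    using third_moment_sum unfolding moment_const_def by linarith
  have "3 * real (a + 1) ^ 4 * (4096 * U)\<^sup>2 * (real q)\<^sup>2 \<le> 13 * real (a + 1) ^ 4 * (4096 * U)\<^sup>2 * (real q)\<^sup>2"
    by (intro mult_right_mono) auto
  then show "PQ.expectation (\<lambda>z. S q z ^ 4) \<le> moment_const * (real q)\<^sup>2"
    using fourth_moment_sum unfolding moment_const_def by linarith
qed

text \<open>The expansion point is the mean squared distance between the two samples, whereas the distances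
within a sample have a mean that is off by \<open>d\<close>; this lemma pays for that shift.\<close>

lemma shifted_moments:
  fixes A0 :: real
  defines "d \<equiv> PQ.expectation (sq_dist q) - A0"
  shows "PQ.expectation (\<lambda>z. (sq_dist q z - A0) ^ 2) \<le> moment_const * real q + d\<^sup>2"
    and "\<bar>PQ.expectation (\<lambda>z. (sq_dist q z - A0) ^ 3)\<bar> \<le> moment_const * real q + 3 * \<bar>d\<bar> * (moment_const * real q) + \<bar>d\<bar> ^ 3"
    and "PQ.expectation (\<lambda>z. (sq_dist q z - A0) ^ 4) \<le> 8 * (moment_const * (real q)\<^sup>2 + d ^ 4)"
proof -
  have w: "sq_dist q z - A0 = S q z + d" for z using sq_dist_centred[of z] by (simp add: d_def)
  have SL: "L4 (P \<Otimes>\<^sub>M Q) (S q)" by (rule S_L4) simp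
  note int = PQ.L4_integrable[OF SL] L4_integrable_pow4[OF SL]
  have zero: "PQ.expectation (S q) = 0"
    using sum_centred[of "{1..q}"] by (simp add: S_def[abs_def])
  have "PQ.expectation (\<lambda>z. (sq_dist q z - A0) ^ 2) = PQ.expectation (\<lambda>z. S q z ^ 2 + 2 * d * S q z + d\<^sup>2)"
    unfolding w by (simp add: power2_sum algebra_simps)
  also have "\<dots> = PQ.expectation (\<lambda>z. S q z ^ 2) + d\<^sup>2" using int zero by (simp add: PQ.prob_space)
  finally show "PQ.expectation (\<lambda>z. (sq_dist q z - A0) ^ 2) \<le> moment_const * real q + d\<^sup>2" using S_moments by simp
  have "PQ.expectation (\<lambda>z. (sq_dist q z - A0) ^ 3)
      = PQ.expectation (\<lambda>z. S q z ^ 3 + 3 * d * S q z ^ 2 + 3 * d\<^sup>2 * S q z + d ^ 3)"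
    unfolding w by (intro Bochner_Integration.integral_cong refl) (simp add: power2_eq_square power3_eq_cube algebra_simps)
  also have "\<dots> = PQ.expectation (\<lambda>z. S q z ^ 3) + 3 * d * PQ.expectation (\<lambda>z. S q z ^ 2) + d ^ 3"
    using int zero by (simp add: PQ.prob_space)
  also have "\<bar>\<dots>\<bar> \<le> \<bar>PQ.expectation (\<lambda>z. S q z ^ 3)\<bar> + \<bar>3 * d * PQ.expectation (\<lambda>z. S q z ^ 2)\<bar> + \<bar>d ^ 3\<bar>"
    by linarith
  also have "\<bar>3 * d * PQ.expectation (\<lambda>z. S q z ^ 2)\<bar> = 3 * \<bar>d\<bar> * PQ.expectation (\<lambda>z. S q z ^ 2)"
    by (simp add: abs_mult)
  also have "\<bar>PQ.expectation (\<lambda>z. S q z ^ 3)\<bar> + 3 * \<bar>d\<bar> * PQ.expectation (\<lambda>z. S q z ^ 2) + \<bar>d ^ 3\<bar>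
    \<le> moment_const * real q + 3 * \<bar>d\<bar> * (moment_const * real q) + \<bar>d\<bar> ^ 3"
    using S_moments by (intro add_mono mult_left_mono) (auto simp: power_abs)
  finally show "\<bar>PQ.expectation (\<lambda>z. (sq_dist q z - A0) ^ 3)\<bar> \<le> moment_const * real q + 3 * \<bar>d\<bar> * (moment_const * real q) + \<bar>d\<bar> ^ 3" .
  have "PQ.expectation (\<lambda>z. (sq_dist q z - A0) ^ 4) \<le> PQ.expectation (\<lambda>z. 8 * (S q z ^ 4 + d ^ 4))"
  proof (rule integral_mono)
    show "integrable (P \<Otimes>\<^sub>M Q) (\<lambda>z. (sq_dist q z - A0) ^ 4)"
      by (intro L4_integrable_pow4 L4_diff sq_dist_L4 PQ.L4_const)
    show "integrable (P \<Otimes>\<^sub>M Q) (\<lambda>z. 8 * (S q z ^ 4 + d ^ 4))" using int by simp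
  qed (simp only: w add_pow4_le)
  also have "\<dots> = 8 * (PQ.expectation (\<lambda>z. S q z ^ 4) + d ^ 4)" using int by (simp add: PQ.prob_space)
  also have "\<dots> \<le> 8 * (moment_const * (real q)\<^sup>2 + d ^ 4)" using S_moments by simp
  finally show "PQ.expectation (\<lambda>z. (sq_dist q z - A0) ^ 4) \<le> 8 * (moment_const * (real q)\<^sup>2 + d ^ 4)" .
qed

end

text \<open>The terms that depend on a single law cancel, and what is left are the polarised squares of the
differences of the traces and of the covariance matrices.\<close>

lemma energy_second_moment:
  assumes "law_pair P Q q U a" and "\<And>i. i \<in> {1..q} \<Longrightarrow> mean P i = mean Q i"
  defines "G \<equiv> \<lambda>P Q. \<integral>z. (sq_dist q z)\<^sup>2 \<partial>(P \<Otimes>\<^sub>M Q)"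
  shows "G P Q + G Q P - G P P - G Q Q
    = - 2 * (centered_sq_norm q P - centered_sq_norm q Q)\<^sup>2
      - 4 * (frobenius q (\<lambda>i j. covariance P i j - covariance Q i j))\<^sup>2"
proof -
  interpret PQ: law_pair P Q q U a by fact
  interpret QP: law_pair Q P q U a by unfold_locales (fact PQ.lagP PQ.lagQ)+
  interpret PP: law_pair P P q U a by unfold_locales (fact PQ.lagP PQ.lagQ)+
  interpret QQ: law_pair Q Q q U a by unfold_locales (fact PQ.lagP PQ.lagQ)+
  show ?thesis unfolding G_def
    by (subst PQ.sq_dist_second_moment QP.sq_dist_second_moment PP.sq_dist_second_moment QQ.sq_dist_second_moment, simp add: assms(2))+
      (simp add: frobenius_sq, simp add: power2_eq_square algebra_simps sum.distrib sum_subtractf sum_distrib_left)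
qed

section \<open>Taylor expansion of the kernel profile\<close>

lemma nth_deriv_0: "nth_deriv 0 f = f" by (simp add: nth_deriv_def)

lemma nth_deriv_1: "nth_deriv 1 f s = vector_derivative f (at s within {0..})"
  by (simp add: nth_deriv_def)

locale radial_profile =
  fixes f :: "real \<Rightarrow> real" and s0 B :: real
  assumes s0: "0 < s0"
    and taylor: "taylor_condition {s0} f"
    and bound: "derivative_bound B {s0} f"
begin

text \<open>Derivatives are measured in units of \<open>s0\<close>, so that the derivative bound reads \<open>\<bar>g i\<bar> \<le> F\<close>. The
numbers \<open>g 1 / 2\<close>, \<open>beta\<close> and \<open>kappa\<close> are the coefficients of the expansion of the profile in powers
of \<open>(s\<^sup>2 - s0\<^sup>2) / s0\<^sup>2\<close>.\<close>

definition g :: "nat \<Rightarrow> real" where "g i = nth_deriv i f s0 * s0 ^ i"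

definition F :: real where "F = B * \<bar>f s0\<bar>"

definition beta :: real where "beta = (g 2 - g 1) / 8"

definition kappa :: real where "kappa = g 1 / 16 - g 2 / 16 + g 3 / 48"

lemma deriv_le: "\<lbrakk>i \<in> {1..7}; 0 \<le> s\<rbrakk> \<Longrightarrow> \<bar>nth_deriv i f s\<bar> * s0 ^ i \<le> F"
  using bound s0 unfolding derivative_bound_def F_def by auto

lemma g_le: "i \<in> {1..7} \<Longrightarrow> \<bar>g i\<bar> \<le> F"
  using deriv_le[of i s0] s0 by (simp add: g_def abs_mult)

lemma F_nonneg: "0 \<le> F" using g_le[of 1] by simp

lemma differentiable: "f differentiable_on {0..}"
  using taylor unfolding taylor_condition_def by (auto dest!: spec[of _ 0] simp: nth_deriv_0)

lemma lipschitz: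
  assumes "0 \<le> s" shows "\<bar>f s - f s0\<bar> \<le> F * \<bar>(s - s0) / s0\<bar>"
proof -
  have "norm (f s - f s0) \<le> F / s0 * norm (s - s0)"
  proof (rule field_differentiable_bound[of "{0..}" f "nth_deriv 1 f"])
    fix z :: real assume z: "z \<in> {0..}"
    then show "(f has_field_derivative nth_deriv 1 f z) (at z within {0..})"
      using differentiable unfolding nth_deriv_1 has_real_derivative_iff_has_vector_derivative
      by (simp add: differentiable_on_def vector_derivative_works)
    show "norm (nth_deriv 1 f z) \<le> F / s0"
      using deriv_le[of 1 z] z s0 by (simp add: field_simps)
  qed (use assms s0 in auto)
  then show ?thesis using s0 by (simp add: abs_divide)
qed

text \<open>The terms of the Taylor condition of order four to seven are all at most \<open>F * v ^ 4\<close> when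
\<open>\<bar>v\<bar> \<le> 1\<close>. Far away from \<open>s0\<close> the condition would cost seventh powers; there the Lipschitz bound and
the cubic polynomial itself are already dominated by \<open>v ^ 4\<close>. As \<open>v \<ge> -1\<close>, far away means \<open>v > 1\<close>.\<close>

lemma cubic_taylor:
  assumes "0 \<le> s"
  defines "v \<equiv> (s - s0) / s0"
  shows "\<bar>f s - (f s0 + g 1 * v + g 2 * v ^ 2 / 2 + g 3 * v ^ 3 / 6)\<bar> \<le> 3 * F * v ^ 4"
proof (cases "\<bar>v\<bar> \<le> 1")
  case True
  have "\<exists>\<xi>\<in>{min s s0..max s s0}. f s = (\<Sum>i\<le>6. 1 / fact i * nth_deriv i f s0 * (s - s0) ^ i)
              + 1 / fact 7 * nth_deriv 7 f \<xi> * (s - s0) ^ 7"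
    by (rule taylor[unfolded taylor_condition_def, THEN conjunct2, THEN bspec, THEN bspec])
      (use assms(1) in simp_all)
  then obtain \<xi> where \<xi>: "\<xi> \<in> {min s s0..max s s0}"
    and eq: "f s = (\<Sum>i\<le>6. 1 / fact i * nth_deriv i f s0 * (s - s0) ^ i)
              + 1 / fact 7 * nth_deriv 7 f \<xi> * (s - s0) ^ 7" ..
  define G where "G = nth_deriv 7 f \<xi> * s0 ^ 7"
  have G: "\<bar>G\<bar> \<le> F" using deriv_le[of 7 \<xi>] \<xi> assms(1) s0 by (auto simp: G_def abs_mult)
  have sv: "s - s0 = s0 * v" using s0 by (simp add: v_def)
  have "(\<Sum>i\<le>6. 1 / fact i * nth_deriv i f s0 * (s - s0) ^ i) = (\<Sum>i\<le>6. g i * v ^ i / fact i)"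
    by (intro sum.cong refl) (simp add: g_def sv power_mult_distrib)
  also have "\<dots> = f s0 + g 1 * v + g 2 * v ^ 2 / 2 + g 3 * v ^ 3 / 6
     + g 4 * v ^ 4 / 24 + g 5 * v ^ 5 / 120 + g 6 * v ^ 6 / 720"
    by (simp add: numeral_eq_Suc fact_numeral) (simp add: g_def nth_deriv_0 fact_numeral)
  finally have main: "f s - (f s0 + g 1 * v + g 2 * v ^ 2 / 2 + g 3 * v ^ 3 / 6)
    = g 4 * v ^ 4 / 24 + g 5 * v ^ 5 / 120 + g 6 * v ^ 6 / 720 + G * v ^ 7 / 5040"
    unfolding eq sv G_def by (simp add: power_mult_distrib fact_numeral)
  have pw: "\<bar>c * v ^ i\<bar> \<le> F * v ^ 4" if "\<bar>c\<bar> \<le> F" "4 \<le> i" for c i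
  proof -
    have "\<bar>v ^ i\<bar> = \<bar>v\<bar> ^ i" by (simp add: power_abs)
    also have "\<dots> \<le> \<bar>v\<bar> ^ 4" using True that by (intro power_decreasing) auto
    also have "\<dots> = v ^ 4" by (simp add: power_abs)
    finally show ?thesis unfolding abs_mult using that(1) by (intro mult_mono) auto
  qed
  show ?thesis unfolding main
    using pw[OF g_le[of 4], of 4] pw[OF g_le[of 5], of 5] pw[OF g_le[of 6], of 6] pw[OF G, of 7] F_nonneg
    by (simp add: abs_le_iff)
next
  case False
  have "- 1 \<le> v" using assms(1) s0 by (simp add: v_def field_simps)
  then have v: "1 < v" using False by linarith
  have pw: "\<bar>c * v ^ i\<bar> \<le> F * v ^ 4" if "\<bar>c\<bar> \<le> F" "i \<le> 4" for c i
  proof -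
    have "v ^ i \<le> v ^ 4" using v that by (intro power_increasing) auto
    then show ?thesis unfolding abs_mult using that(1) v by (intro mult_mono) auto
  qed
  have "F * \<bar>v\<bar> \<le> F * v ^ 4" using pw[of F 1] v F_nonneg by (simp add: abs_mult)
  then have "\<bar>f s - f s0\<bar> \<le> F * v ^ 4" using lipschitz[OF assms(1)] by (simp add: v_def)
  moreover have "0 \<le> F * v ^ 4" using F_nonneg by simp
  ultimately show ?thesis
    using pw[OF g_le[of 1], of 1] pw[OF g_le[of 2], of 2] pw[OF g_le[of 3], of 3] 
    by (simp add: abs_le_iff)
qed

text \<open>Distances enter the moment bounds only through their squares, so the relative distance \<open>v\<close> is
traded for \<open>u\<close>, where \<open>u = v (2 + v)\<close>. Because \<open>2 + v \<ge> 1\<close>, the powers of \<open>v\<close> up to the third are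
cubic polynomials in \<open>u\<close> up to errors of size \<open>u ^ 4\<close>.\<close>

lemma expansion:
  assumes "0 \<le> s"
  defines "u \<equiv> (s\<^sup>2 - s0\<^sup>2) / s0\<^sup>2"
  shows "\<bar>f s - (f s0 + g 1 / 2 * u + beta * u ^ 2 + kappa * u ^ 3)\<bar> \<le> 6 * F * u ^ 4"
    and "\<bar>f s - f s0\<bar> \<le> F * \<bar>u\<bar>"
proof -
  define v where "v = (s - s0) / s0"
  have v1: "- 1 \<le> v" using assms(1) s0 by (simp add: v_def field_simps)
  have "s = s0 * (1 + v)" using s0 by (simp add: v_def field_simps)
  then have u: "u = v * (2 + v)" using s0 by (simp add: u_def field_simps power2_eq_square)
  define r2 where "r2 = v ^ 3 * (4 + v) / 8"
  define r3 where "r3 = - (v ^ 4 * (10 + 6 * v + v\<^sup>2) / 16)"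
  have w1: "1 \<le> 2 + v" using v1 by simp
  have vu: "\<bar>v\<bar> \<le> \<bar>u\<bar>" unfolding u abs_mult using w1 mult_left_mono[of 1 "\<bar>2 + v\<bar>" "\<bar>v\<bar>"] by simp
  have v4: "v ^ 4 \<le> u ^ 4" using power_mono[OF vu, of 4] by (simp add: power_abs)
  have "\<bar>v ^ 3 * ((4 + v) / 8)\<bar> \<le> \<bar>v ^ 3 * (2 + v) ^ 3\<bar>"
  proof -
    have "2 + v \<le> (2 + v) ^ 3" using w1 by (intro self_le_power) auto
    then have "\<bar>(4 + v) / 8\<bar> \<le> \<bar>(2 + v) ^ 3\<bar>" using v1 by simp
    then show ?thesis unfolding abs_mult by (rule mult_left_mono) simp
  qed
  then have "\<bar>r2\<bar> \<le> \<bar>u\<bar> ^ 3" by (simp add: r2_def u power_mult_distrib power_abs abs_mult)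
  then have r2: "\<bar>u * r2\<bar> \<le> u ^ 4"
    using mult_left_mono[of "\<bar>r2\<bar>" "\<bar>u\<bar> ^ 3" "\<bar>u\<bar>"] by (simp add: abs_mult power_abs flip: power_Suc)
  have r3: "\<bar>r3\<bar> \<le> u ^ 4"
  proof -
    have sq: "1 \<le> (2 + v)\<^sup>2" using w1 by (simp add: one_le_power)
    have "16 * (2 + v)\<^sup>2 - (10 + 6 * v + v\<^sup>2) = 15 * (v + 1)\<^sup>2 + 28 * (v + 1) + 11"
      by (simp add: power2_eq_square algebra_simps)
    moreover have "0 \<le> 15 * (v + 1)\<^sup>2 + 28 * (v + 1) + 11" using v1 by (intro add_nonneg_nonneg) auto
    ultimately have "(10 + 6 * v + v\<^sup>2) / 16 \<le> (2 + v)\<^sup>2" by simp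
    also have "\<dots> \<le> (2 + v)\<^sup>2 * (2 + v)\<^sup>2" using sq mult_left_mono[of 1 "(2+v)\<^sup>2" "(2+v)\<^sup>2"] by simp
    finally have le: "(10 + 6 * v + v\<^sup>2) / 16 \<le> (2 + v) ^ 4" by (simp flip: power_add)
    have "0 \<le> (v + 3)\<^sup>2 + 1" by simp
    also have "\<dots> = 10 + 6 * v + v\<^sup>2" by (simp add: power2_eq_square algebra_simps)
    finally have "0 \<le> (10 + 6 * v + v\<^sup>2) / 16" by simp
    then have "\<bar>r3\<bar> = v ^ 4 * ((10 + 6 * v + v\<^sup>2) / 16)" by (simp add: r3_def abs_mult)
    also have "\<dots> \<le> v ^ 4 * (2 + v) ^ 4" by (intro mult_left_mono le) simp
    finally show ?thesis by (simp add: u power_mult_distrib)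
  qed
  have r3': "16 * r3 = - (v ^ 4 * (10 + 6 * v + v\<^sup>2))" and r2': "8 * r2 = v ^ 3 * (4 + v)"
    by (simp_all add: r3_def r2_def)
  have "16 * v = 8 * u - 2 * u\<^sup>2 + u ^ 3 + 16 * r3" unfolding r3' u by algebra
  then have e1: "v = u / 2 - u\<^sup>2 / 8 + u ^ 3 / 16 + r3" by simp
  have "v\<^sup>2 = u - 2 * v" unfolding u by algebra
  then have e2: "v\<^sup>2 = u\<^sup>2 / 4 - u ^ 3 / 8 - 2 * r3" using e1 by linarith
  have "8 * v ^ 3 = u ^ 3 + u * (8 * r2) + 2 * (16 * r3)" unfolding r3' r2' u by algebra
  then have e3: "v ^ 3 = u ^ 3 / 8 + u * r2 + 4 * r3" by simp
  define E where "E = g 1 * r3 - g 2 * r3 + (g 3 * (u * r2) + 4 * (g 3 * r3)) / 6"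
  have "f s0 + g 1 * v + g 2 * v ^ 2 / 2 + g 3 * v ^ 3 / 6
    = f s0 + g 1 * (u / 2 - u\<^sup>2 / 8 + u ^ 3 / 16 + r3) + g 2 * (u\<^sup>2 / 4 - u ^ 3 / 8 - 2 * r3) / 2
      + g 3 * (u ^ 3 / 8 + u * r2 + 4 * r3) / 6"
    by (simp only: e1[symmetric] e2[symmetric] e3[symmetric])
  also have "\<dots> = f s0 + g 1 / 2 * u + beta * u ^ 2 + kappa * u ^ 3 + E"
    by (simp add: E_def beta_def kappa_def field_simps)
  finally have T: "f s0 + g 1 * v + g 2 * v ^ 2 / 2 + g 3 * v ^ 3 / 6
     = f s0 + g 1 / 2 * u + beta * u ^ 2 + kappa * u ^ 3 + E" .
  have idx: "1 \<in> {1..7::nat}" "2 \<in> {1..7::nat}" "3 \<in> {1..7::nat}" by auto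
  have pr: "\<bar>c * r\<bar> \<le> F * u ^ 4" if "\<bar>c\<bar> \<le> F" "\<bar>r\<bar> \<le> u ^ 4" for c r
    unfolding abs_mult using that by (intro mult_mono) auto
  have tri: "\<bar>a - b + (c + 4 * d) / 6\<bar> \<le> 3 * t"
    if "\<bar>a\<bar> \<le> t" "\<bar>b\<bar> \<le> t" "\<bar>c\<bar> \<le> t" "\<bar>d\<bar> \<le> t" for a b c d t :: real
    using that unfolding abs_le_iff by (elim conjE, intro conjI; simp add: field_simps)
  have "\<bar>E\<bar> \<le> 3 * (F * u ^ 4)"
    using pr[OF g_le[OF idx(1)] r3] pr[OF g_le[OF idx(2)] r3] pr[OF g_le[OF idx(3)] r2] pr[OF g_le[OF idx(3)] r3]
    unfolding E_def by (rule tri)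
  moreover have "3 * F * v ^ 4 \<le> 3 * F * u ^ 4" using v4 F_nonneg by (intro mult_left_mono) auto
  ultimately show "\<bar>f s - (f s0 + g 1 / 2 * u + beta * u ^ 2 + kappa * u ^ 3)\<bar> \<le> 6 * F * u ^ 4"
    using cubic_taylor[OF assms(1)] unfolding v_def[symmetric] T by (simp add: abs_le_iff)
  show "\<bar>f s - f s0\<bar> \<le> F * \<bar>u\<bar>"
    using lipschitz[OF assms(1)] mult_left_mono[OF vu F_nonneg] unfolding v_def[symmetric] by linarith
qed

lemma kappa_le: "\<bar>kappa\<bar> \<le> F"
  using g_le[of 1] g_le[of 2] g_le[of 3] unfolding kappa_def by (simp add: abs_le_iff)

lemma profile_measurable: "(\<lambda>s. f (max 0 s)) \<in> borel_measurable borel"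
proof (rule borel_measurable_continuous_onI)
  have "continuous_on {0..} f" by (rule differentiable_imp_continuous_on[OF differentiable])
  then show "continuous_on UNIV (\<lambda>s. f (max 0 s))"
    by (rule continuous_on_compose2) (auto intro!: continuous_intros)
qed

end

section \<open>Positivity of the population energy\<close>

text \<open>When \<open>- k\<close> is a reproducing kernel, integrals of \<open>k\<close> against product measures are inner products
of mean embeddings up to sign, so the energy is the squared distance of the two embeddings. It
vanishes only if they coincide, which a characteristic kernel forbids for distinct laws.\<close>

lemma rkhs_energy_negative:
  fixes k :: "vec \<Rightarrow> vec \<Rightarrow> real"
  assumes rk: "is_rkhs (space (Rp q)) H ip"
    and rep: "is_reproducing_kernel (space (Rp q)) H ip (\<lambda>x y. - k x y)"
    and ch: "characteristic_rkhs q H ip"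
    and P: "borel_prob q P" and Q: "borel_prob q Q" and "P \<noteq> Q"
    and int: "\<And>P1 P2. P1 \<in> {P, Q} \<Longrightarrow> P2 \<in> {P, Q} \<Longrightarrow> integrable (P1 \<Otimes>\<^sub>M P2) (\<lambda>z. k (fst z) (snd z))"
  shows "kernel_signed k P Q < 0"
proof -
  let ?S = "space (Rp q)"
  define add where "add = (\<lambda>g h :: vec \<Rightarrow> real. \<lambda>x\<in>?S. g x + h x)"
  define scale where "scale = (\<lambda>(c::real) (g :: vec \<Rightarrow> real). \<lambda>x\<in>?S. c * g x)"
  have ext: "H \<subseteq> extensional ?S"
    and addH: "\<And>g h. g \<in> H \<Longrightarrow> h \<in> H \<Longrightarrow> add g h \<in> H"
    and scaleH: "\<And>c g. g \<in> H \<Longrightarrow> scale c g \<in> H"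
    and sym: "\<And>g h. g \<in> H \<Longrightarrow> h \<in> H \<Longrightarrow> ip g h = ip h g"
    and ip_add: "\<And>g h l. g \<in> H \<Longrightarrow> h \<in> H \<Longrightarrow> l \<in> H \<Longrightarrow> ip (add g h) l = ip g l + ip h l"
    and ip_scale: "\<And>c g h. g \<in> H \<Longrightarrow> h \<in> H \<Longrightarrow> ip (scale c g) h = c * ip g h"
    and ip_nonneg: "\<And>g. g \<in> H \<Longrightarrow> 0 \<le> ip g g"
    and ip_zero: "\<And>g. g \<in> H \<Longrightarrow> ip g g = 0 \<Longrightarrow> g = (\<lambda>x\<in>?S. 0)"
    using rk unfolding is_rkhs_def Let_def add_def scale_def by (elim conjE, blast)+
  have kx: "(\<lambda>y\<in>?S. - k y x) \<in> H" "\<And>h. h \<in> H \<Longrightarrow> h x = ip h (\<lambda>y\<in>?S. - k y x)" if "x \<in> ?S" for x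
    using rep that unfolding is_reproducing_kernel_def by auto
  have prob: "prob_space R" "sets R = sets (Rp q)" "space R = ?S" if "R \<in> {P, Q}" for R
    using that P Q sets_eq_imp_space_eq[of R "Rp q"] unfolding borel_prob_def by auto
  have "\<exists>\<mu>. is_mean_embedding H ip R \<mu>" if "R \<in> {P, Q}" for R
    using that ch P Q unfolding characteristic_rkhs_def by blast
  then obtain \<mu> where emb: "\<And>R. R \<in> {P, Q} \<Longrightarrow> is_mean_embedding H ip R (\<mu> R)" by metis
  have \<mu>H: "\<mu> R \<in> H" and \<mu>_int: "\<And>h. h \<in> H \<Longrightarrow> (\<integral>x. h x \<partial>R) = ip h (\<mu> R)" if "R \<in> {P, Q}" for R
    using emb[OF that] unfolding is_mean_embedding_def by auto
  have \<mu>_eval: "\<mu> R x = (\<integral>y. - k y x \<partial>R)" if R: "R \<in> {P, Q}" and x: "x \<in> ?S" for R x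
  proof -
    have "\<mu> R x = ip (\<lambda>y\<in>?S. - k y x) (\<mu> R)"
      using kx(2)[OF x \<mu>H[OF R]] sym[OF \<mu>H[OF R] kx(1)[OF x]] by simp
    also have "\<dots> = (\<integral>y. (\<lambda>y\<in>?S. - k y x) y \<partial>R)" using \<mu>_int[OF R kx(1)[OF x]] by simp
    also have "\<dots> = (\<integral>y. - k y x \<partial>R)"
      by (rule Bochner_Integration.integral_cong) (auto simp: prob(3)[OF R])
    finally show ?thesis .
  qed
  have cross: "kernel_cross k P1 P2 = - ip (\<mu> P1) (\<mu> P2)" if 1: "P1 \<in> {P, Q}" and 2: "P2 \<in> {P, Q}" for P1 P2
  proof -
    interpret P1: prob_space P1 by (rule prob(1)[OF 1])
    interpret P2: prob_space P2 by (rule prob(1)[OF 2])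
    interpret PP: pair_sigma_finite P1 P2 ..
    have "ip (\<mu> P1) (\<mu> P2) = (\<integral>x. \<mu> P1 x \<partial>P2)" using \<mu>_int[OF 2 \<mu>H[OF 1]] by simp
    also have "\<dots> = (\<integral>x. (\<integral>y. - k y x \<partial>P1) \<partial>P2)"
      by (rule Bochner_Integration.integral_cong) (auto simp: prob(3)[OF 2] \<mu>_eval[OF 1])
    also have "\<dots> = - (\<integral>x. (\<integral>y. k y x \<partial>P1) \<partial>P2)" by simp
    also have "(\<integral>x. (\<integral>y. k y x \<partial>P1) \<partial>P2) = kernel_cross k P1 P2"
      using PP.integral_snd[of k] int[OF 1 2] by (simp add: kernel_cross_def split_def)
    finally show ?thesis by simp
  qed
  define d where "d = add (\<mu> P) (scale (-1) (\<mu> Q))"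
  have PQ: "\<mu> P \<in> H" "\<mu> Q \<in> H" using \<mu>H by auto
  have sQ: "scale (-1) (\<mu> Q) \<in> H" using scaleH PQ by auto
  have dH: "d \<in> H" unfolding d_def using addH PQ sQ by auto
  have "ip d d = ip (\<mu> P) d + ip (scale (-1) (\<mu> Q)) d"
    using ip_add[OF PQ(1) sQ dH] by (simp only: d_def[symmetric])
  also have "\<dots> = ip d (\<mu> P) - ip d (\<mu> Q)"
    using ip_scale[OF PQ(2) dH, of "-1"] sym[OF PQ(1) dH] sym[OF PQ(2) dH] by simp
  also have "\<dots> = (ip (\<mu> P) (\<mu> P) - ip (\<mu> Q) (\<mu> P)) - (ip (\<mu> P) (\<mu> Q) - ip (\<mu> Q) (\<mu> Q))"
    unfolding d_def using PQ sQ by (simp add: ip_add ip_scale)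
  finally have signed: "kernel_signed k P Q = - ip d d"
    by (simp add: kernel_signed_def cross)
  have "ip d d \<noteq> 0"
  proof
    assume "ip d d = 0"
    then have z: "d = (\<lambda>x\<in>?S. 0)" by (rule ip_zero[OF dH])
    have "\<mu> P x = \<mu> Q x" if "x \<in> ?S" for x
      using fun_cong[OF z, of x] that by (simp add: d_def add_def scale_def)
    then have "\<mu> P = \<mu> Q" using ext PQ by (intro extensionalityI[of _ ?S]) auto
    then have "is_mean_embedding H ip P (\<mu> P)" "is_mean_embedding H ip Q (\<mu> P)"
      using emb[of P] emb[of Q] by simp_all
    then have "P = Q" using ch P Q unfolding characteristic_rkhs_def by blast
    with \<open>P \<noteq> Q\<close> show False by contradiction
  qed
  then show ?thesis using ip_nonneg[OF dH] signed by simp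
qed

lemma kernel_signed_negative:
  fixes k :: "vec \<Rightarrow> vec \<Rightarrow> real"
  assumes "kernel_on q k"
    and P: "borel_prob q P" and Q: "borel_prob q Q" and "P \<noteq> Q"
    and int: "\<And>P1 P2. P1 \<in> {P, Q} \<Longrightarrow> P2 \<in> {P, Q} \<Longrightarrow> integrable (P1 \<Otimes>\<^sub>M P2) (\<lambda>z. k (fst z) (snd z))"
    and z0: "z0 \<in> space (Rp q)" "integrable P (\<lambda>z. k z z0)" "integrable Q (\<lambda>z. k z z0)"
  shows "kernel_signed k P Q < 0"
  using assms(1) unfolding kernel_on_def
proof (elim conjE disjE)
  assume "strong_negative_type q k"
  then show ?thesis using P Q \<open>P \<noteq> Q\<close> z0 unfolding strong_negative_type_def by blast
next
  assume "neg_characteristic q k"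
  then obtain H ip where "is_rkhs (space (Rp q)) H ip"
    "is_reproducing_kernel (space (Rp q)) H ip (\<lambda>x y. - k x y)" "characteristic_rkhs q H ip"
    unfolding neg_characteristic_def by blast
  from rkhs_energy_negative[OF this P Q \<open>P \<noteq> Q\<close> int] show ?thesis by blast
qed

section \<open>Size of the population energy\<close>

locale radial_pair = law_pair P Q q U a + radial_profile f s0 B
  for P Q :: "vec measure" and q :: nat and U :: real and a :: nat and f :: "real \<Rightarrow> real" and s0 B :: real +
  fixes k :: "vec \<Rightarrow> vec \<Rightarrow> real"
  assumes radial: "\<And>x y. x \<in> space (Rp q) \<Longrightarrow> y \<in> space (Rp q) \<Longrightarrow> k x y = f (edist q x y)"
begin

lemma spaceP: "space P = space (Rp q)" and spaceQ: "space Q = space (Rp q)"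
  using P.sets_eq Q.sets_eq by (auto dest: sets_eq_imp_space_eq)

definition w :: "vec \<times> vec \<Rightarrow> real" where "w z = sq_dist q z - s0\<^sup>2"

definition u :: "vec \<times> vec \<Rightarrow> real" where "u z = w z / s0\<^sup>2"

lemma u_L4: "L4 (P \<Otimes>\<^sub>M Q) u"
proof -
  have "L4 (P \<Otimes>\<^sub>M Q) (\<lambda>z. (1 / s0\<^sup>2) * (sq_dist q z - s0\<^sup>2))" by (intro L4_cmult L4_diff sq_dist_L4 PQ.L4_const)
  then show ?thesis by (simp add: u_def[abs_def] w_def)
qed

lemma k_eq:
  assumes "z \<in> space (P \<Otimes>\<^sub>M Q)"
  shows "k (fst z) (snd z) = f (sqrt (sq_dist q z))"
  using radial[of "fst z" "snd z"] assms
  by (auto simp: space_pair_measure spaceP spaceQ edist_def sq_dist_def L2_set_def)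

lemma sq_dist_nonneg: "0 \<le> sq_dist q z" by (simp add: sq_dist_def sum_nonneg)

lemma k_measurable: "(\<lambda>z. k (fst z) (snd z)) \<in> borel_measurable (P \<Otimes>\<^sub>M Q)"
proof -
  have "(\<lambda>z. f (max 0 (sqrt (sq_dist q z)))) \<in> borel_measurable (P \<Otimes>\<^sub>M Q)"
    by (intro measurable_compose[OF _ profile_measurable] measurable_compose[OF _ borel_measurable_sqrt]
        L4_measurable[OF sq_dist_L4])
  then show ?thesis
    by (subst measurable_cong[where g="\<lambda>z. f (max 0 (sqrt (sq_dist q z)))"]) (auto simp: k_eq sq_dist_nonneg)
qed

lemma k_expansion:
  assumes "z \<in> space (P \<Otimes>\<^sub>M Q)"
  shows "\<bar>k (fst z) (snd z) - (f s0 + g 1 / 2 * u z + beta * u z ^ 2 + kappa * u z ^ 3)\<bar> \<le> 6 * F * u z ^ 4"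
    and "\<bar>k (fst z) (snd z) - f s0\<bar> \<le> F * \<bar>u z\<bar>"
  using expansion[of "sqrt (sq_dist q z)"] sq_dist_nonneg[of z] by (simp_all add: k_eq[OF assms] u_def w_def)

lemma k_integrable: "integrable (P \<Otimes>\<^sub>M Q) (\<lambda>z. k (fst z) (snd z))"
proof (rule Bochner_Integration.integrable_bound[where f="\<lambda>z. \<bar>f s0\<bar> + F * \<bar>u z\<bar>"])
  show "integrable (P \<Otimes>\<^sub>M Q) (\<lambda>z. \<bar>f s0\<bar> + F * \<bar>u z\<bar>)"
    using PQ.L4_integrable(1)[OF u_L4] by simp
  show "AE z in P \<Otimes>\<^sub>M Q. norm (k (fst z) (snd z)) \<le> norm (\<bar>f s0\<bar> + F * \<bar>u z\<bar>)"
    using k_expansion(2) F_nonneg by (intro AE_I2) fastforce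
qed (rule k_measurable)

lemma k_square:
  shows "integrable (P \<Otimes>\<^sub>M Q) (\<lambda>z. (k (fst z) (snd z) - f s0)\<^sup>2)"
    and "PQ.expectation (\<lambda>z. (k (fst z) (snd z) - f s0)\<^sup>2) \<le> F\<^sup>2 * PQ.expectation (\<lambda>z. u z ^ 2)"
proof -
  have le: "(k (fst z) (snd z) - f s0)\<^sup>2 \<le> F\<^sup>2 * u z ^ 2" if "z \<in> space (P \<Otimes>\<^sub>M Q)" for z
    using power_mono[OF k_expansion(2)[OF that], of 2] by (simp add: power_mult_distrib)
  have i: "integrable (P \<Otimes>\<^sub>M Q) (\<lambda>z. F\<^sup>2 * u z ^ 2)" using PQ.L4_integrable(2)[OF u_L4] by simp
  show 1: "integrable (P \<Otimes>\<^sub>M Q) (\<lambda>z. (k (fst z) (snd z) - f s0)\<^sup>2)"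
    by (rule Bochner_Integration.integrable_bound[OF i]) (use k_measurable le in \<open>auto intro!: AE_I2\<close>)
  have "PQ.expectation (\<lambda>z. (k (fst z) (snd z) - f s0)\<^sup>2) \<le> PQ.expectation (\<lambda>z. F\<^sup>2 * u z ^ 2)"
    by (rule integral_mono[OF 1 i]) (rule le)
  then show "PQ.expectation (\<lambda>z. (k (fst z) (snd z) - f s0)\<^sup>2) \<le> F\<^sup>2 * PQ.expectation (\<lambda>z. u z ^ 2)" by simp
qed

lemma expectation_expansion:
  "\<bar>kernel_cross k P Q - (f s0 + g 1 / 2 * PQ.expectation u + beta * PQ.expectation (\<lambda>z. u z ^ 2))\<bar>
    \<le> F * (\<bar>PQ.expectation (\<lambda>z. u z ^ 3)\<bar> + 6 * PQ.expectation (\<lambda>z. u z ^ 4))"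
proof -
  note int = PQ.L4_integrable[OF u_L4] L4_integrable_pow4[OF u_L4]
  let ?T = "\<lambda>z. f s0 + g 1 / 2 * u z + beta * u z ^ 2 + kappa * u z ^ 3"
  have iT: "integrable (P \<Otimes>\<^sub>M Q) ?T" using int by simp
  have "\<bar>PQ.expectation (\<lambda>z. k (fst z) (snd z) - ?T z)\<bar> \<le> PQ.expectation (\<lambda>z. \<bar>k (fst z) (snd z) - ?T z\<bar>)"
    by (rule integral_abs_bound)
  also have "\<dots> \<le> PQ.expectation (\<lambda>z. 6 * F * u z ^ 4)"
    using k_integrable iT int k_expansion(1) by (intro integral_mono) auto
  also have "PQ.expectation (\<lambda>z. k (fst z) (snd z) - ?T z) = kernel_cross k P Q - PQ.expectation ?T"
    using k_integrable iT by (simp add: kernel_cross_def)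
  also have "PQ.expectation ?T = f s0 + g 1 / 2 * PQ.expectation u + beta * PQ.expectation (\<lambda>z. u z ^ 2)
     + kappa * PQ.expectation (\<lambda>z. u z ^ 3)"
    using int by (simp add: PQ.prob_space)
  finally have 1: "\<bar>kernel_cross k P Q - (f s0 + g 1 / 2 * PQ.expectation u + beta * PQ.expectation (\<lambda>z. u z ^ 2)
     + kappa * PQ.expectation (\<lambda>z. u z ^ 3))\<bar> \<le> 6 * F * PQ.expectation (\<lambda>z. u z ^ 4)" by simp
  have "\<bar>kappa * PQ.expectation (\<lambda>z. u z ^ 3)\<bar> \<le> F * \<bar>PQ.expectation (\<lambda>z. u z ^ 3)\<bar>"
    unfolding abs_mult by (intro mult_right_mono kappa_le) simp
  then show ?thesis using 1 by (simp add: distrib_left abs_le_iff)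
qed

lemma u_moments:
  fixes \<tau> :: real
  assumes \<tau>: "\<bar>PQ.expectation (sq_dist q) - s0\<^sup>2\<bar> \<le> \<tau>"
  shows "PQ.expectation (\<lambda>z. u z ^ 2) \<le> (moment_const * real q + \<tau>\<^sup>2) / (s0\<^sup>2)\<^sup>2"
    and "\<bar>PQ.expectation (\<lambda>z. u z ^ 3)\<bar> \<le> (moment_const * real q + 3 * \<tau> * (moment_const * real q) + \<tau> ^ 3) / (s0\<^sup>2) ^ 3"
    and "PQ.expectation (\<lambda>z. u z ^ 4) \<le> 8 * (moment_const * (real q)\<^sup>2 + \<tau> ^ 4) / (s0\<^sup>2) ^ 4"
proof -
  define d where "d = PQ.expectation (sq_dist q) - s0\<^sup>2"
  have d: "\<bar>d\<bar> \<le> \<tau>" using \<tau> by (simp add: d_def)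
  have p: "0 < s0\<^sup>2" using s0 by simp
  have m: "0 \<le> moment_const" using moment_const_ge_1 by simp
  have pw: "\<bar>d\<bar> ^ i \<le> \<tau> ^ i" for i by (rule power_mono[OF d]) simp
  have d2: "d\<^sup>2 \<le> \<tau>\<^sup>2" using pw[of 2] by simp
  have d4: "d ^ 4 \<le> \<tau> ^ 4" using pw[of 4] by (simp add: power_abs)
  note sm = shifted_moments[of "s0\<^sup>2", folded d_def w_def]
  have e: "PQ.expectation (\<lambda>z. u z ^ i) = PQ.expectation (\<lambda>z. w z ^ i) / (s0\<^sup>2) ^ i" for i
    by (simp add: u_def power_divide)
  show "PQ.expectation (\<lambda>z. u z ^ 2) \<le> (moment_const * real q + \<tau>\<^sup>2) / (s0\<^sup>2)\<^sup>2"
    unfolding e using sm(1) d2 p by (intro divide_right_mono) auto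
  have "\<bar>PQ.expectation (\<lambda>z. w z ^ 3)\<bar> \<le> moment_const * real q + 3 * \<tau> * (moment_const * real q) + \<tau> ^ 3"
    using sm(2) pw[of 3] d m
    by (elim order_trans) (intro add_mono mult_right_mono mult_left_mono order_refl; simp)
  then show "\<bar>PQ.expectation (\<lambda>z. u z ^ 3)\<bar> \<le> (moment_const * real q + 3 * \<tau> * (moment_const * real q) + \<tau> ^ 3) / (s0\<^sup>2) ^ 3"
    unfolding e abs_divide using p by (simp add: divide_right_mono)
  show "PQ.expectation (\<lambda>z. u z ^ 4) \<le> 8 * (moment_const * (real q)\<^sup>2 + \<tau> ^ 4) / (s0\<^sup>2) ^ 4"
    unfolding e using sm(3) d4 by (intro divide_right_mono) auto
qed

lemma k_section_integrable: "integrable P (\<lambda>x. k x (origin q))"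
proof -
  have o: "origin q \<in> space (Rp q)" by (auto simp: origin_def space_PiM)
  define r where "r x = (\<Sum>i = 1..q. (x i)\<^sup>2)" for x :: vec
  have r0: "0 \<le> r x" for x by (simp add: r_def sum_nonneg)
  have keq: "k x (origin q) = f (sqrt (r x))" if "x \<in> space P" for x
    using radial[of x "origin q"] that o by (simp add: spaceP edist_def L2_set_def origin_def r_def)
  have rL: "L4 P r" unfolding r_def[abs_def] by (intro P.L4_sum P.coord_sq_L4)
  show ?thesis
  proof (rule Bochner_Integration.integrable_bound[where f="\<lambda>x. \<bar>f s0\<bar> + F * \<bar>(r x - s0\<^sup>2) / s0\<^sup>2\<bar>"])
    show "integrable P (\<lambda>x. \<bar>f s0\<bar> + F * \<bar>(r x - s0\<^sup>2) / s0\<^sup>2\<bar>)"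
      using P.L4_integrable(1)[OF rL] by simp
    have "(\<lambda>x. f (max 0 (sqrt (r x)))) \<in> borel_measurable P"
      by (intro measurable_compose[OF _ profile_measurable] measurable_compose[OF _ borel_measurable_sqrt]
          L4_measurable[OF rL])
    then show "(\<lambda>x. k x (origin q)) \<in> borel_measurable P"
      by (subst measurable_cong[where g="\<lambda>x. f (max 0 (sqrt (r x)))"]) (auto simp: keq r0)
    show "AE x in P. norm (k x (origin q)) \<le> norm (\<bar>f s0\<bar> + F * \<bar>(r x - s0\<^sup>2) / s0\<^sup>2\<bar>)"
    proof (rule AE_I2)
      fix x assume x: "x \<in> space P"
      have "\<bar>f (sqrt (r x)) - f s0\<bar> \<le> F * \<bar>(r x - s0\<^sup>2) / s0\<^sup>2\<bar>"
        using expansion(2)[of "sqrt (r x)"] r0[of x] by simp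
      moreover have "0 \<le> F * \<bar>(r x - s0\<^sup>2) / s0\<^sup>2\<bar>" using F_nonneg by simp
      ultimately show "norm (k x (origin q)) \<le> norm (\<bar>f s0\<bar> + F * \<bar>(r x - s0\<^sup>2) / s0\<^sup>2\<bar>)"
        unfolding keq[OF x] real_norm_def by linarith
    qed
  qed
qed

definition tau :: real where "tau = centered_sq_norm q P - centered_sq_norm q Q"

definition cov_gap :: real where "cov_gap = frobenius q (\<lambda>i j. covariance P i j - covariance Q i j)"

text \<open>The four cross expectations are expanded around the same point. Their constant and linear terms
cancel, the quadratic terms combine to \<open>energy_second_moment\<close>, and the rest is estimated by
absolute values.\<close>

lemma energy_expansion:
  assumes mean: "\<And>i. i \<in> {1..q} \<Longrightarrow> mean P i = mean Q i"
    and A: "s0\<^sup>2 = mean_sq_dist q P Q"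
  shows "\<bar>- kernel_signed k P Q + beta * (2 * tau\<^sup>2 + 4 * cov_gap\<^sup>2) / (s0\<^sup>2)\<^sup>2\<bar>
    \<le> 4 * F * ((moment_const * real q + 3 * \<bar>tau\<bar> * (moment_const * real q) + \<bar>tau\<bar> ^ 3) / (s0\<^sup>2) ^ 3
      + 48 * (moment_const * (real q)\<^sup>2 + tau ^ 4) / (s0\<^sup>2) ^ 4)" (is "_ \<le> 4 * F * (?M3 + ?M4)")
    and "\<And>P1 P2. P1 \<in> {P, Q} \<Longrightarrow> P2 \<in> {P, Q} \<Longrightarrow>
      integrable (P1 \<Otimes>\<^sub>M P2) (\<lambda>z. k (fst z) (snd z)) \<and>
      integrable (P1 \<Otimes>\<^sub>M P2) (\<lambda>z. (k (fst z) (snd z) - f s0)\<^sup>2) \<and>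
      (\<integral>z. (k (fst z) (snd z) - f s0)\<^sup>2 \<partial>(P1 \<Otimes>\<^sub>M P2)) \<le> F\<^sup>2 * ((moment_const * real q + tau\<^sup>2) / (s0\<^sup>2)\<^sup>2)"
    and "integrable P (\<lambda>x. k x (origin q))" "integrable Q (\<lambda>x. k x (origin q))"
proof -
  have pair: "radial_pair P1 P2 q U a f s0 B k" if "P1 \<in> {P, Q}" "P2 \<in> {P, Q}" for P1 P2
  proof -
    have "vector_law P1 q U" "vector_law P2 q U" "lag_independent q a P1" "lag_independent q a P2"
      using that P.vector_law_axioms Q.vector_law_axioms lagP lagQ by auto
    then show ?thesis
      by (intro radial_pair.intro law_pair.intro law_pair_axioms.intro radial_profile_axioms
          radial_pair_axioms.intro radial)
  qed
  define A0 where "A0 = s0\<^sup>2"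
  have A0: "0 < A0" using s0 by (simp add: A0_def)
  define E where "E P1 P2 h = (\<integral>z. h z \<partial>(P1 \<Otimes>\<^sub>M P2))" for P1 P2 :: "vec measure" and h :: "vec \<times> vec \<Rightarrow> real"
  define T where "T R = centered_sq_norm q R" for R
  have Esqd: "E P1 P2 (sq_dist q) = T P1 + T P2" if "P1 \<in> {P, Q}" "P2 \<in> {P, Q}" for P1 P2
  proof -
    interpret I: radial_pair P1 P2 q U a f s0 B k by (rule pair[OF that])
    show ?thesis using I.sq_dist_mean mean that by (auto simp: E_def T_def)
  qed
  have A0T: "A0 = T P + T Q"
    using A Esqd[of P Q] by (simp add: A0_def mean_sq_dist_eq E_def)
  have gap: "\<bar>E P1 P2 (sq_dist q) - s0\<^sup>2\<bar> \<le> \<bar>tau\<bar>" if "P1 \<in> {P, Q}" "P2 \<in> {P, Q}" for P1 P2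
    using Esqd[OF that] that A0T by (auto simp: tau_def T_def A0_def[symmetric])
  let ?u = "\<lambda>z. (sq_dist q z - s0\<^sup>2) / s0\<^sup>2"
  have main: "\<bar>kernel_cross k P1 P2 - (f s0 + g 1 / 2 * E P1 P2 ?u + beta * E P1 P2 (\<lambda>z. ?u z ^ 2))\<bar> \<le> F * (?M3 + ?M4)"
    and first: "E P1 P2 ?u = (E P1 P2 (sq_dist q) - A0) / A0"
    and second: "E P1 P2 (\<lambda>z. ?u z ^ 2) = (E P1 P2 (\<lambda>z. (sq_dist q z)\<^sup>2) - 2 * A0 * E P1 P2 (sq_dist q) + A0\<^sup>2) / A0\<^sup>2"
    and square: "integrable (P1 \<Otimes>\<^sub>M P2) (\<lambda>z. k (fst z) (snd z)) \<and>
      integrable (P1 \<Otimes>\<^sub>M P2) (\<lambda>z. (k (fst z) (snd z) - f s0)\<^sup>2) \<and>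
      E P1 P2 (\<lambda>z. (k (fst z) (snd z) - f s0)\<^sup>2) \<le> F\<^sup>2 * ((moment_const * real q + tau\<^sup>2) / (s0\<^sup>2)\<^sup>2)"
    and sect: "integrable P1 (\<lambda>x. k x (origin q))"
    if "P1 \<in> {P, Q}" "P2 \<in> {P, Q}" for P1 P2
  proof -
    interpret I: radial_pair P1 P2 q U a f s0 B k by (rule pair[OF that])
    have u: "I.u = ?u" by (simp add: I.u_def I.w_def fun_eq_iff)
    note um = I.u_moments[OF gap[OF that, unfolded E_def], unfolded u]
    have "F * (\<bar>E P1 P2 (\<lambda>z. ?u z ^ 3)\<bar> + 6 * E P1 P2 (\<lambda>z. ?u z ^ 4)) \<le> F * (?M3 + ?M4)"
    proof (intro mult_left_mono add_mono F_nonneg)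
      show "\<bar>E P1 P2 (\<lambda>z. ?u z ^ 3)\<bar> \<le> ?M3" using um(2) unfolding E_def .
      have "6 * E P1 P2 (\<lambda>z. ?u z ^ 4) \<le> 6 * (8 * (moment_const * (real q)\<^sup>2 + \<bar>tau\<bar> ^ 4) / (s0\<^sup>2) ^ 4)"
        using um(3) unfolding E_def by (intro mult_left_mono) auto
      also have "\<dots> = ?M4" by simp
      finally show "6 * E P1 P2 (\<lambda>z. ?u z ^ 4) \<le> ?M4" .
    qed
    then show "\<bar>kernel_cross k P1 P2 - (f s0 + g 1 / 2 * E P1 P2 ?u + beta * E P1 P2 (\<lambda>z. ?u z ^ 2))\<bar> \<le> F * (?M3 + ?M4)"
      using I.expectation_expansion unfolding u E_def by linarith
    note int = I.PQ.L4_integrable[OF I.sq_dist_L4]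
    show "E P1 P2 ?u = (E P1 P2 (sq_dist q) - A0) / A0"
      using int by (simp add: E_def A0_def I.PQ.prob_space)
    have "E P1 P2 (\<lambda>z. ?u z ^ 2) = E P1 P2 (\<lambda>z. ((sq_dist q z)\<^sup>2 - 2 * A0 * sq_dist q z + A0\<^sup>2) / A0\<^sup>2)"
      by (simp add: E_def A0_def power_divide power2_diff algebra_simps)
    also have "\<dots> = (E P1 P2 (\<lambda>z. (sq_dist q z)\<^sup>2) - 2 * A0 * E P1 P2 (sq_dist q) + A0\<^sup>2) / A0\<^sup>2"
      using int by (simp add: E_def I.PQ.prob_space)
    finally show "E P1 P2 (\<lambda>z. ?u z ^ 2) = (E P1 P2 (\<lambda>z. (sq_dist q z)\<^sup>2) - 2 * A0 * E P1 P2 (sq_dist q) + A0\<^sup>2) / A0\<^sup>2" .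
    have "F\<^sup>2 * E P1 P2 (\<lambda>z. ?u z ^ 2) \<le> F\<^sup>2 * ((moment_const * real q + tau\<^sup>2) / (s0\<^sup>2)\<^sup>2)"
      using um(1) unfolding E_def by (intro mult_left_mono) auto
    then show "integrable (P1 \<Otimes>\<^sub>M P2) (\<lambda>z. k (fst z) (snd z)) \<and>
      integrable (P1 \<Otimes>\<^sub>M P2) (\<lambda>z. (k (fst z) (snd z) - f s0)\<^sup>2) \<and>
      E P1 P2 (\<lambda>z. (k (fst z) (snd z) - f s0)\<^sup>2) \<le> F\<^sup>2 * ((moment_const * real q + tau\<^sup>2) / (s0\<^sup>2)\<^sup>2)"
      using I.k_integrable I.k_square unfolding u E_def by auto
    show "integrable P1 (\<lambda>x. k x (origin q))" by (rule I.k_section_integrable)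
  qed
  show "\<And>P1 P2. P1 \<in> {P, Q} \<Longrightarrow> P2 \<in> {P, Q} \<Longrightarrow>
      integrable (P1 \<Otimes>\<^sub>M P2) (\<lambda>z. k (fst z) (snd z)) \<and>
      integrable (P1 \<Otimes>\<^sub>M P2) (\<lambda>z. (k (fst z) (snd z) - f s0)\<^sup>2) \<and>
      (\<integral>z. (k (fst z) (snd z) - f s0)\<^sup>2 \<partial>(P1 \<Otimes>\<^sub>M P2)) \<le> F\<^sup>2 * ((moment_const * real q + tau\<^sup>2) / (s0\<^sup>2)\<^sup>2)"
    using square unfolding E_def by blast
  show "integrable P (\<lambda>x. k x (origin q))" "integrable Q (\<lambda>x. k x (origin q))" using sect by auto
  define G where "G P1 P2 = E P1 P2 (\<lambda>z. (sq_dist q z)\<^sup>2)" for P1 P2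
  define V where "V P1 P2 = f s0 + g 1 / 2 * E P1 P2 ?u + beta * E P1 P2 (\<lambda>z. ?u z ^ 2)" for P1 P2
  have Vf: "V P1 P2 = f s0 + g 1 / 2 * ((T P1 + T P2 - A0) / A0)
      + beta * ((G P1 P2 - 2 * A0 * (T P1 + T P2) + A0\<^sup>2) / A0\<^sup>2)"
    if "P1 \<in> {P, Q}" "P2 \<in> {P, Q}" for P1 P2
    unfolding V_def G_def first[OF that] second[OF that] Esqd[OF that] ..
  have "V P Q + V Q P - V P P - V Q Q = beta * (G P Q + G Q P - G P P - G Q Q) / A0\<^sup>2"
    by (simp add: Vf add_divide_distrib diff_divide_distrib algebra_simps)
  also have "G P Q + G Q P - G P P - G Q Q = - (2 * tau\<^sup>2 + 4 * cov_gap\<^sup>2)"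
    using energy_second_moment[OF law_pair_axioms mean] by (simp add: G_def E_def tau_def cov_gap_def)
  finally have V: "V P Q + V Q P - V P P - V Q Q = - (beta * (2 * tau\<^sup>2 + 4 * cov_gap\<^sup>2) / (s0\<^sup>2)\<^sup>2)"
    by (simp only: A0_def mult_minus_right minus_divide_left)
  have c: "\<bar>kernel_cross k P1 P2 - V P1 P2\<bar> \<le> F * (?M3 + ?M4)" if "P1 \<in> {P, Q}" "P2 \<in> {P, Q}" for P1 P2
    using main[OF that] by (simp add: V_def)
  have tri: "\<bar>- (x3 - x1 - x2 + x4) - (y1 + y2 - y3 - y4)\<bar> \<le> 4 * t"
    if "\<bar>x1 - y1\<bar> \<le> t" "\<bar>x2 - y2\<bar> \<le> t" "\<bar>x3 - y3\<bar> \<le> t" "\<bar>x4 - y4\<bar> \<le> t"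
    for x1 x2 x3 x4 y1 y2 y3 y4 t :: real
    using that unfolding abs_le_iff by (elim conjE, intro conjI; linarith)
  have "\<bar>(- kernel_signed k P Q) - (V P Q + V Q P - V P P - V Q Q)\<bar> \<le> 4 * (F * (?M3 + ?M4))"
    unfolding kernel_signed_def by (rule tri; rule c) auto
  then show "\<bar>- kernel_signed k P Q + beta * (2 * tau\<^sup>2 + 4 * cov_gap\<^sup>2) / (s0\<^sup>2)\<^sup>2\<bar> \<le> 4 * F * (?M3 + ?M4)"
    unfolding V by simp
qed

text \<open>If \<open>f s0\<close> were zero, the derivative bound would make all coefficients of the expansion vanish, and
the energy with them; so strict positivity of the energy also excludes \<open>f s0 = 0\<close>.\<close>

lemma energy_positive:
  assumes mean: "\<And>i. i \<in> {1..q} \<Longrightarrow> mean P i = mean Q i"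
    and A: "s0\<^sup>2 = mean_sq_dist q P Q" and k: "kernel_on q k" and gap: "0 < cov_gap"
  shows "kernel_signed k P Q < 0" and "f s0 \<noteq> 0"
proof -
  note ee = energy_expansion[OF mean A]
  have "P \<noteq> Q"
  proof
    assume "P = Q"
    then have "cov_gap = 0" unfolding cov_gap_def by (simp add: frobenius_def L2_set_def split_def)
    with gap show False by simp
  qed
  moreover have "borel_prob q P" "borel_prob q Q"
    using P.sets_eq Q.sets_eq P.prob_space_axioms Q.prob_space_axioms by (auto simp: borel_prob_def)
  moreover have "origin q \<in> space (Rp q)" by (auto simp: origin_def space_PiM)
  ultimately show neg: "kernel_signed k P Q < 0"
    using ee(2-4) by (intro kernel_signed_negative[OF k]) auto
  show "f s0 \<noteq> 0"
  proof
    assume "f s0 = 0"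
    then have F: "F = 0" by (simp add: F_def)
    then have "beta = 0" using g_le[of 1] g_le[of 2] by (simp add: beta_def)
    then have "kernel_signed k P Q = 0" using ee(1) F by simp
    with neg show False by simp
  qed
qed

end

section \<open>Algebra of the statistics\<close>

\<comment> \<open>index ranges start at \<open>1\<close>; rewriting it to \<open>Suc 0\<close> would block the sum lemmas below\<close>
declare One_nat_def [simp del]

text \<open>The weights with which the energy statistic is a double sum over the pooled sample. Each
unordered pair within a sample occurs twice in that double sum, which turns the inverse binomial
coefficients into \<open>1 / (n (n - 1))\<close>.\<close>

definition contrast :: "nat \<Rightarrow> nat \<Rightarrow> nat \<Rightarrow> nat \<Rightarrow> real" where
  "contrast n m s t =
     (if s = t then 0
      else if s \<le> n \<and> t \<le> n then - 1 / (real n * (real n - 1))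
      else if n < s \<and> n < t then - 1 / (real m * (real m - 1))
      else 1 / (real n * real m))"

lemma contrast_sym: "contrast n m s t = contrast n m t s"
  by (auto simp: contrast_def)

lemma contrast_diag: "contrast n m s s = 0"
  by (simp add: contrast_def)

lemma sum_split:
  fixes g :: "nat \<Rightarrow> real"
  shows "(\<Sum>s = 1..n + m. g s) = (\<Sum>i = 1..n. g i) + (\<Sum>j = 1..m. g (n + j))"
proof -
  have "{1..n + m} = {1..n} \<union> {n + 1..n + m}" by auto
  then have "(\<Sum>s = 1..n + m. g s) = (\<Sum>i = 1..n. g i) + (\<Sum>s\<in>{n + 1..n + m}. g s)"
    by (simp only:, intro sum.union_disjoint) auto
  also have "(\<Sum>s\<in>{n + 1..n + m}. g s) = (\<Sum>j = 1..m. g (n + j))"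
    using sum.shift_bounds_cl_nat_ivl[of g 1 n m] by (simp add: add.commute)
  finally show ?thesis .
qed

lemma sum_off_diagonal:
  fixes h :: "nat \<Rightarrow> nat \<Rightarrow> real"
  assumes "\<And>i j. i \<in> {1..n} \<Longrightarrow> j \<in> {1..n} \<Longrightarrow> h i j = h j i"
  shows "(\<Sum>i = 1..n. \<Sum>j = 1..n. if i = j then 0 else h i j)
    = 2 * (\<Sum>(i, j)\<in>{(i, j). 1 \<le> i \<and> i < j \<and> j \<le> n}. h i j)"
proof -
  let ?U = "{(i, j). 1 \<le> i \<and> i < j \<and> j \<le> n}" and ?L = "{(j, i). 1 \<le> i \<and> i < j \<and> j \<le> n}"
  have "?U \<subseteq> {1..n} \<times> {1..n}" "?L \<subseteq> {1..n} \<times> {1..n}" by auto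
  then have fin: "finite ?U" "finite ?L" by (auto dest: finite_subset)
  have "(\<Sum>i = 1..n. \<Sum>j = 1..n. if i = j then 0 else h i j)
    = (\<Sum>(i, j)\<in>{1..n} \<times> {1..n}. if i = j then 0 else h i j)"
    by (rule sum.cartesian_product)
  also have "\<dots> = (\<Sum>(i, j)\<in>?U \<union> ?L. h i j)"
    by (rule sum.mono_neutral_cong_right) (auto split: if_splits)
  also have "\<dots> = (\<Sum>(i, j)\<in>?U. h i j) + (\<Sum>(i, j)\<in>?L. h i j)"
    by (rule sum.union_disjoint[OF fin]) auto
  also have "(\<Sum>(i, j)\<in>?L. h i j) = (\<Sum>(i, j)\<in>?U. h i j)"
    by (rule sum.reindex_bij_witness[where i="\<lambda>(i, j). (j, i)" and j="\<lambda>(i, j). (j, i)"]) (auto intro!: assms)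
  finally show ?thesis by simp
qed

lemma sum_const_off:
  fixes c :: real
  assumes "s \<in> {1..n}"
  shows "(\<Sum>t = 1..n. if s = t then 0 else c) = (real n - 1) * c"
proof -
  have "(\<Sum>t = 1..n. if s = t then 0 else c) = (\<Sum>t\<in>{1..n} - {s}. c)"
    by (rule sum.mono_neutral_cong_right) auto
  also have "\<dots> = (real n - 1) * c" using assms by (simp add: of_nat_diff)
  finally show ?thesis .
qed

lemma energy_stat_contrast:
  assumes n: "2 \<le> n" and m: "2 \<le> m"
    and x: "\<And>i j. k (x i) (x j) = k (x j) (x i)" and y: "\<And>i j. k (y i) (y j) = k (y j) (y i)"
    and xy: "\<And>i j. k (x i) (y j) = k (y j) (x i)"
  shows "energy_stat k n m x y
    = (\<Sum>s = 1..n + m. \<Sum>t = 1..n + m. contrast n m s t * k (pooled n x y s) (pooled n x y t))"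
proof -
  let ?XY = "\<Sum>i = 1..n. \<Sum>j = 1..m. k (x i) (y j)"
  let ?K = "\<lambda>s t. contrast n m s t * k (pooled n x y s) (pooled n x y t)"
  have choose: "inverse (real (l choose 2)) = 2 / (real l * (real l - 1))" if "2 \<le> l" for l
  proof -
    have "even (l * (l - 1))" using that by (cases "even l") auto
    then have "2 * (l choose 2) = l * (l - 1)" by (simp add: choose_two)
    then have "real (2 * (l choose 2)) = real (l * (l - 1))" by (rule arg_cong)
    then have "2 * real (l choose 2) = real l * (real l - 1)"
      using that by (simp add: of_nat_diff)
    then show ?thesis using that by (simp add: field_simps)
  qed
  have XX: "(\<Sum>i = 1..n. \<Sum>j = 1..n. ?K i j)
    = - (2 / (real n * (real n - 1)) * (\<Sum>(i, j)\<in>{(i, j). 1 \<le> i \<and> i < j \<and> j \<le> n}. k (x i) (x j)))"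
  proof -
    have "(\<Sum>i = 1..n. \<Sum>j = 1..n. ?K i j)
      = (\<Sum>i = 1..n. \<Sum>j = 1..n. (- 1 / (real n * (real n - 1))) * (if i = j then 0 else k (x i) (x j)))"
      by (intro sum.cong refl) (auto simp: contrast_def pooled_def)
    also have "\<dots> = (- 1 / (real n * (real n - 1))) * (\<Sum>i = 1..n. \<Sum>j = 1..n. if i = j then 0 else k (x i) (x j))"
      by (simp only: sum_distrib_left)
    also have "(\<Sum>i = 1..n. \<Sum>j = 1..n. if i = j then 0 else k (x i) (x j))
      = 2 * (\<Sum>(i, j)\<in>{(i, j). 1 \<le> i \<and> i < j \<and> j \<le> n}. k (x i) (x j))"
      by (rule sum_off_diagonal) (rule x)
    finally show ?thesis by simp
  qed
  have YY: "(\<Sum>i = 1..m. \<Sum>j = 1..m. ?K (n + i) (n + j))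
    = - (2 / (real m * (real m - 1)) * (\<Sum>(i, j)\<in>{(i, j). 1 \<le> i \<and> i < j \<and> j \<le> m}. k (y i) (y j)))"
  proof -
    have "(\<Sum>i = 1..m. \<Sum>j = 1..m. ?K (n + i) (n + j))
      = (\<Sum>i = 1..m. \<Sum>j = 1..m. (- 1 / (real m * (real m - 1))) * (if i = j then 0 else k (y i) (y j)))"
      by (intro sum.cong refl) (auto simp: contrast_def pooled_def)
    also have "\<dots> = (- 1 / (real m * (real m - 1))) * (\<Sum>i = 1..m. \<Sum>j = 1..m. if i = j then 0 else k (y i) (y j))"
      by (simp only: sum_distrib_left)
    also have "(\<Sum>i = 1..m. \<Sum>j = 1..m. if i = j then 0 else k (y i) (y j))
      = 2 * (\<Sum>(i, j)\<in>{(i, j). 1 \<le> i \<and> i < j \<and> j \<le> m}. k (y i) (y j))"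
      by (rule sum_off_diagonal) (rule y)
    finally show ?thesis by simp
  qed
  have XY: "(\<Sum>i = 1..n. \<Sum>j = 1..m. ?K i (n + j)) = 1 / (real n * real m) * ?XY"
    by (simp add: sum_distrib_left, intro sum.cong refl) (auto simp: contrast_def pooled_def)
  have YX: "(\<Sum>j = 1..m. \<Sum>i = 1..n. ?K (n + j) i) = 1 / (real n * real m) * ?XY"
    by (subst (2) sum.swap, simp add: sum_distrib_left, intro sum.cong refl) (auto simp: contrast_def pooled_def xy)
  have "(\<Sum>s = 1..n + m. \<Sum>t = 1..n + m. ?K s t)
    = (\<Sum>i = 1..n. \<Sum>j = 1..n. ?K i j) + (\<Sum>i = 1..n. \<Sum>j = 1..m. ?K i (n + j))
     + ((\<Sum>j = 1..m. \<Sum>i = 1..n. ?K (n + j) i) + (\<Sum>i = 1..m. \<Sum>j = 1..m. ?K (n + i) (n + j)))"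
    by (simp only: sum_split sum.distrib)
  then show ?thesis
    unfolding XX XY YX YY energy_stat_def choose[OF n] choose[OF m] by simp
qed

text \<open>The vanishing row sums make the energy statistic blind to additive row and column effects; the
absolute row sums control its variance.\<close>

lemma contrast_row:
  assumes n: "2 \<le> n" and m: "2 \<le> m" and s: "s \<in> {1..n + m}"
  shows "(\<Sum>t = 1..n + m. contrast n m s t) = 0"
    and "(\<Sum>t = 1..n + m. \<bar>contrast n m s t\<bar>) = (if s \<le> n then 2 / real n else 2 / real m)"
proof -
  have v: "(l - 1) * (- 1 / (l * (l - 1))) = - 1 / l" "(l - 1) * \<bar>- 1 / (l * (l - 1))\<bar> = 1 / l"
    "l * (1 / (l' * l)) = 1 / l'" "l * \<bar>1 / (l' * l)\<bar> = 1 / l'"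
    "l * (1 / (l * l')) = 1 / l'" "l * \<bar>1 / (l * l')\<bar> = 1 / l'"
    if "1 < l" "1 < l'" for l l' :: real
    using that by (simp_all add: abs_mult)
  have nm: "1 < real n" "1 < real m" using n m by auto
  have *: "(\<Sum>t = 1..n + m. contrast n m s t) = 0 \<and>
    (\<Sum>t = 1..n + m. \<bar>contrast n m s t\<bar>) = (if s \<le> n then 2 / real n else 2 / real m)"
  proof (cases "s \<le> n")
    case True
    then have s': "s \<in> {1..n}" using s by auto
    have 1: "(\<Sum>t = 1..n. \<phi> (contrast n m s t)) = (real n - 1) * \<phi> (- 1 / (real n * (real n - 1)))" if "\<phi> 0 = 0" for \<phi> :: "real \<Rightarrow> real"
      unfolding sum_const_off[OF s', symmetric] using s' that by (intro sum.cong refl) (auto simp: contrast_def)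
    have 2: "(\<Sum>j = 1..m. \<phi> (contrast n m s (n + j))) = real m * \<phi> (1 / (real n * real m))" for \<phi> :: "real \<Rightarrow> real"
    proof -
      have "(\<Sum>j = 1..m. \<phi> (contrast n m s (n + j))) = (\<Sum>j = 1..m. \<phi> (1 / (real n * real m)))"
        using s' by (intro sum.cong refl) (auto simp: contrast_def)
      then show ?thesis by simp
    qed
    show ?thesis
      using 1[of "\<lambda>x. x"] 1[of abs] 2[of "\<lambda>x. x"] 2[of abs] True
      unfolding sum_split v[OF nm] using n m by simp
  next
    case False
    define i where "i = s - n"
    have i: "i \<in> {1..m}" "s = n + i" using s False by (auto simp: i_def)
    have 1: "(\<Sum>j = 1..m. \<phi> (contrast n m s (n + j))) = (real m - 1) * \<phi> (- 1 / (real m * (real m - 1)))" if "\<phi> 0 = 0" for \<phi> :: "real \<Rightarrow> real"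
      unfolding sum_const_off[OF i(1), symmetric] using i that by (intro sum.cong refl) (auto simp: contrast_def)
    have 2: "(\<Sum>t = 1..n. \<phi> (contrast n m s t)) = real n * \<phi> (1 / (real n * real m))" for \<phi> :: "real \<Rightarrow> real"
    proof -
      have "(\<Sum>t = 1..n. \<phi> (contrast n m s t)) = (\<Sum>t = 1..n. \<phi> (1 / (real n * real m)))"
        using i by (intro sum.cong refl) (auto simp: contrast_def)
      then show ?thesis by simp
    qed
    show ?thesis
      using 1[of "\<lambda>x. x"] 1[of abs] 2[of "\<lambda>x. x"] 2[of abs] False
      unfolding sum_split v[OF nm(2) nm(1)] using n m by simp
  qed
  then show "(\<Sum>t = 1..n + m. contrast n m s t) = 0"
    and "(\<Sum>t = 1..n + m. \<bar>contrast n m s t\<bar>) = (if s \<le> n then 2 / real n else 2 / real m)" by auto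
qed

lemma contrast_total:
  assumes n: "2 \<le> n" and m: "2 \<le> m"
  shows "(\<Sum>s = 1..n + m. \<Sum>t = 1..n + m. \<bar>contrast n m s t\<bar>) = 4"
proof -
  have "(\<Sum>s = 1..n + m. \<Sum>t = 1..n + m. \<bar>contrast n m s t\<bar>)
    = (\<Sum>s = 1..n + m. if s \<le> n then 2 / real n else 2 / real m)"
    by (intro sum.cong refl contrast_row n m)
  also have "\<dots> = (\<Sum>i = 1..n. 2 / real n) + (\<Sum>j = 1..m. 2 / real m)"
    unfolding sum_split by (intro arg_cong2[where f="(+)"] sum.cong) auto
  also have "\<dots> = 4" using n m by simp
  finally show ?thesis .
qed

text \<open>A symmetric matrix \<open>a\<close> with constant diagonal, as produced by a radial kernel, is reduced to the
matrix \<open>h\<close> with zero diagonal and off-diagonal entries \<open>a s t - c\<close>. The centred matrix \<open>H\<close> is the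
orthogonal projection of \<open>h\<close> onto the matrices with zero diagonal and zero row sums, and it does
not depend on the constant \<open>c\<close>, which can thus be chosen freely in upper bounds.\<close>

locale hollow =
  fixes N :: nat and a :: "nat \<Rightarrow> nat \<Rightarrow> real" and a0 c :: real
  assumes N: "4 \<le> N"
    and sym: "\<And>s t. s \<in> {1..N} \<Longrightarrow> t \<in> {1..N} \<Longrightarrow> a s t = a t s"
    and diag: "\<And>s. s \<in> {1..N} \<Longrightarrow> a s s = a0"
begin

definition h :: "nat \<Rightarrow> nat \<Rightarrow> real" where "h s t = (if s = t then 0 else a s t - c)"
definition r :: "nat \<Rightarrow> real" where "r s = (\<Sum>t = 1..N. h s t)"
definition T :: real where "T = (\<Sum>s = 1..N. r s)"
definition \<rho> :: "nat \<Rightarrow> real" where "\<rho> s = r s / (real N - 2) - T / (2 * (real N - 1) * (real N - 2))"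
definition H :: "nat \<Rightarrow> nat \<Rightarrow> real" where "H s t = (if s = t then 0 else h s t - \<rho> s - \<rho> t)"

lemma nz: "real N - 1 > 0" "real N - 2 > 0" "real N - 3 > 0" using N by auto

lemma h_sym: "s \<in> {1..N} \<Longrightarrow> t \<in> {1..N} \<Longrightarrow> h s t = h t s" by (simp add: h_def sym)

lemma H_sym: "s \<in> {1..N} \<Longrightarrow> t \<in> {1..N} \<Longrightarrow> H s t = H t s" by (simp add: H_def h_sym)

lemma row_sum: assumes "s \<in> {1..N}" shows "(\<Sum>t = 1..N. a s t) = r s + ((real N - 1) * c + a0)"
proof -
  have "(\<Sum>t = 1..N. a s t) = (\<Sum>t = 1..N. h s t + ((if s = t then 0 else c) + (if s = t then a0 else 0)))"
    by (intro sum.cong refl) (auto simp: h_def diag)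
  also have "\<dots> = r s + ((real N - 1) * c + a0)"
    using assms by (simp only: sum.distrib sum_const_off r_def) (simp add: sum.delta)
  finally show ?thesis .
qed

lemma column_sum: assumes "t \<in> {1..N}" shows "(\<Sum>s = 1..N. a s t) = r t + ((real N - 1) * c + a0)"
proof -
  have "(\<Sum>s = 1..N. a s t) = (\<Sum>s = 1..N. a t s)" by (intro sum.cong refl sym assms)
  then show ?thesis by (simp only: row_sum[OF assms])
qed

lemma total_sum: "(\<Sum>s = 1..N. \<Sum>t = 1..N. a s t) = T + real N * ((real N - 1) * c + a0)"
proof -
  have "(\<Sum>s = 1..N. \<Sum>t = 1..N. a s t) = (\<Sum>s = 1..N. r s + ((real N - 1) * c + a0))"
    by (intro sum.cong refl row_sum)
  then show ?thesis by (simp add: T_def sum.distrib)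
qed

lemma u_center_eq:
  assumes "s \<in> {1..N}" "t \<in> {1..N}" "s \<noteq> t"
  shows "u_center N a s t = H s t - a0 / (real N - 1)"
proof -
  define x y where "x = real N - 1" and "y = real N - 2"
  have x: "x \<noteq> 0" "y \<noteq> 0" "real N = x + 1" "x = y + 1" using nz by (auto simp: x_def y_def)
  define K where "K = x * c + a0"
  have "u_center N a s t = h s t + c - (r t + K) / y - (r s + K) / y + (T + real N * K) / (x * y)"
    unfolding u_center_def row_sum[OF assms(1)] column_sum[OF assms(2)] total_sum
    using assms(3) by (simp add: h_def x_def y_def K_def)
  also have "\<dots> = h s t - (r s / y - T / (2 * x * y)) - (r t / y - T / (2 * x * y)) - a0 / x"
  proof -
    have "c - K / y - K / y + real N * K / (x * y) = - a0 / x"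
      unfolding x(3) K_def using x(1,2) by (simp add: divide_simps) (simp add: x(4) algebra_simps)
    moreover have "T / (x * y) = 2 * (T / (2 * x * y))" by simp
    ultimately show ?thesis unfolding add_divide_distrib by linarith
  qed
  finally show ?thesis using assms(3) by (simp add: H_def \<rho>_def x_def y_def)
qed

lemma H_row: assumes "s \<in> {1..N}" shows "(\<Sum>t = 1..N. H s t) = 0"
proof -
  define x y where "x = real N - 1" and "y = real N - 2"
  have x: "x \<noteq> 0" "y \<noteq> 0" "real N = x + 1" "x = y + 1" using nz by (auto simp: x_def y_def)
  have sr: "(\<Sum>t = 1..N. \<rho> t) = T / y - real N * (T / (2 * x * y))"
    by (simp add: \<rho>_def sum_subtractf T_def x_def y_def flip: sum_divide_distrib)
  have "(\<Sum>t = 1..N. H s t) = (\<Sum>t = 1..N. h s t - (if s = t then 0 else \<rho> s) - (\<rho> t - (if s = t then \<rho> t else 0)))"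
    by (intro sum.cong refl) (auto simp: H_def h_def)
  also have "\<dots> = r s - x * \<rho> s - ((\<Sum>t = 1..N. \<rho> t) - \<rho> s)"
    unfolding sum_subtractf sum_const_off[OF assms] r_def x_def using assms by (simp add: sum.delta)
  also have "\<dots> = r s - (x - 1) * \<rho> s - (T / y - real N * (T / (2 * x * y)))"
    unfolding sr by (simp add: algebra_simps)
  also have "\<dots> = 0"
    unfolding \<rho>_def x_def[symmetric] y_def[symmetric] x(3) using x(1,2)
    by (simp add: divide_simps) (simp add: x(4) algebra_simps)
  finally show ?thesis .
qed

lemma H_column: "t \<in> {1..N} \<Longrightarrow> (\<Sum>s = 1..N. H s t) = 0"
  using H_row[of t] sum.cong[OF refl H_sym, of "{1..N}" "\<lambda>_. t"] by simp

text \<open>Off the diagonal \<open>h - H\<close> is a sum of a row effect and a column effect, hence orthogonal to \<open>H\<close>.\<close>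

lemma H_sum_squares: "(\<Sum>s = 1..N. \<Sum>t = 1..N. (H s t)\<^sup>2) \<le> (\<Sum>s = 1..N. \<Sum>t = 1..N. (h s t)\<^sup>2)"
proof -
  have "(\<Sum>s = 1..N. \<Sum>t = 1..N. H s t * \<rho> s) = (\<Sum>s = 1..N. (\<Sum>t = 1..N. H s t) * \<rho> s)"
    by (simp only: sum_distrib_right)
  also have "\<dots> = 0" by (rule sum.neutral, rule ballI) (simp add: H_row)
  finally have 1: "(\<Sum>s = 1..N. \<Sum>t = 1..N. H s t * \<rho> s) = 0" .
  have "(\<Sum>s = 1..N. \<Sum>t = 1..N. H s t * \<rho> t) = (\<Sum>t = 1..N. (\<Sum>s = 1..N. H s t) * \<rho> t)"
    by (subst sum.swap) (simp only: sum_distrib_right)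
  also have "\<dots> = 0" by (rule sum.neutral, rule ballI) (simp add: H_column)
  finally have 2: "(\<Sum>s = 1..N. \<Sum>t = 1..N. H s t * \<rho> t) = 0" .
  have "(\<Sum>s = 1..N. \<Sum>t = 1..N. (H s t)\<^sup>2)
    = (\<Sum>s = 1..N. \<Sum>t = 1..N. (H s t)\<^sup>2 + 2 * (H s t * \<rho> s) + 2 * (H s t * \<rho> t))"
    using 1 2 by (simp add: sum.distrib flip: sum_distrib_left)
  also have "\<dots> \<le> (\<Sum>s = 1..N. \<Sum>t = 1..N. (h s t)\<^sup>2)"
  proof (intro sum_mono)
    fix s t
    show "(H s t)\<^sup>2 + 2 * (H s t * \<rho> s) + 2 * (H s t * \<rho> t) \<le> (h s t)\<^sup>2"
    proof (cases "s = t")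
      case False
      then have "h s t = H s t + (\<rho> s + \<rho> t)" by (simp add: H_def)
      then have "(h s t)\<^sup>2 = (H s t)\<^sup>2 + 2 * (H s t * \<rho> s) + 2 * (H s t * \<rho> t) + (\<rho> s + \<rho> t)\<^sup>2"
        by (simp add: power2_eq_square algebra_simps)
      then show ?thesis by simp
    qed (simp add: H_def)
  qed
  finally show ?thesis .
qed

text \<open>Off the diagonal, centring sends the diagonal \<open>a0\<close> to the constant \<open>- a0 / (N - 1)\<close> and constants
off the diagonal to zero. Since \<open>H\<close> sums to zero the cross term disappears, and the square of that
constant is exactly what the variance statistic subtracts. In particular the statistic is never
negative.\<close>

lemma variance_identity:
  "1 / (real N * (real N - 3)) *
      (\<Sum>(s, t)\<in>{(s, t). s \<in> {1..N} \<and> t \<in> {1..N} \<and> s \<noteq> t}. (u_center N a s t)\<^sup>2)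
    - a0\<^sup>2 / ((real N - 1) * (real N - 3))
   = (\<Sum>s = 1..N. \<Sum>t = 1..N. (H s t)\<^sup>2) / (real N * (real N - 3))"
proof -
  define b where "b = a0 / (real N - 1)"
  have "(\<Sum>(s, t)\<in>{(s, t). s \<in> {1..N} \<and> t \<in> {1..N} \<and> s \<noteq> t}. (u_center N a s t)\<^sup>2)
    = (\<Sum>(s, t)\<in>{1..N} \<times> {1..N}. (H s t)\<^sup>2 - 2 * b * H s t + (if s = t then 0 else b\<^sup>2))"
    by (rule sum.mono_neutral_cong_left)
      (auto simp: u_center_eq b_def[symmetric] power2_diff H_def[of x x for x])
  also have "\<dots> = (\<Sum>s = 1..N. \<Sum>t = 1..N. (H s t)\<^sup>2 - 2 * b * H s t + (if s = t then 0 else b\<^sup>2))"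
    by (rule sum.cartesian_product[symmetric])
  also have "\<dots> = (\<Sum>s = 1..N. (\<Sum>t = 1..N. (H s t)\<^sup>2) + (real N - 1) * b\<^sup>2)"
  proof (intro sum.cong refl)
    fix s assume s: "s \<in> {1..N}"
    have "(\<Sum>t = 1..N. (H s t)\<^sup>2 - 2 * b * H s t + (if s = t then 0 else b\<^sup>2))
      = (\<Sum>t = 1..N. (H s t)\<^sup>2) - 2 * b * (\<Sum>t = 1..N. H s t) + (\<Sum>t = 1..N. if s = t then 0 else b\<^sup>2)"
      by (simp only: sum.distrib sum_subtractf sum_distrib_left)
    then show "(\<Sum>t = 1..N. (H s t)\<^sup>2 - 2 * b * H s t + (if s = t then 0 else b\<^sup>2))
      = (\<Sum>t = 1..N. (H s t)\<^sup>2) + (real N - 1) * b\<^sup>2"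
      unfolding H_row[OF s] sum_const_off[OF s] by simp
  qed
  also have "\<dots> = (\<Sum>s = 1..N. \<Sum>t = 1..N. (H s t)\<^sup>2) + real N * ((real N - 1) * b\<^sup>2)"
    by (simp add: sum.distrib)
  finally have *: "(\<Sum>(s, t)\<in>{(s, t). s \<in> {1..N} \<and> t \<in> {1..N} \<and> s \<noteq> t}. (u_center N a s t)\<^sup>2)
    = (\<Sum>s = 1..N. \<Sum>t = 1..N. (H s t)\<^sup>2) + real N * ((real N - 1) * b\<^sup>2)" .
  have "1 / (real N * (real N - 3)) * (real N * ((real N - 1) * b\<^sup>2)) = a0\<^sup>2 / ((real N - 1) * (real N - 3))"
    using nz N by (simp add: b_def divide_simps power2_eq_square)
  then show ?thesis unfolding * by (simp add: distrib_left)
qed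

text \<open>Weights with vanishing row sums do not see the row and column effects by which \<open>a\<close> and \<open>H\<close> differ.
Hence the energy statistic vanishes whenever the variance statistic does.\<close>

lemma contrast_sum:
  assumes w: "\<And>s. s \<in> {1..N} \<Longrightarrow> (\<Sum>t = 1..N. w s t) = 0"
    "\<And>s t. w s t = w t s" "\<And>s. w s s = (0::real)"
  shows "(\<Sum>s = 1..N. \<Sum>t = 1..N. w s t * a s t) = (\<Sum>s = 1..N. \<Sum>t = 1..N. w s t * H s t)"
proof -
  have "(\<Sum>s = 1..N. \<Sum>t = 1..N. w s t * a s t)
    = (\<Sum>s = 1..N. \<Sum>t = 1..N. w s t * H s t + w s t * (\<rho> s + c) + w s t * \<rho> t)"
    by (intro sum.cong refl) (auto simp: H_def h_def w(3) algebra_simps)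
  also have "\<dots> = (\<Sum>s = 1..N. \<Sum>t = 1..N. w s t * H s t) + (\<Sum>s = 1..N. \<Sum>t = 1..N. w s t * (\<rho> s + c))
    + (\<Sum>s = 1..N. \<Sum>t = 1..N. w s t * \<rho> t)" by (simp only: sum.distrib)
  also have "(\<Sum>s = 1..N. \<Sum>t = 1..N. w s t * (\<rho> s + c)) = 0"
    by (rule sum.neutral, rule ballI) (simp add: w(1) flip: sum_distrib_right)
  also have "(\<Sum>s = 1..N. \<Sum>t = 1..N. w s t * \<rho> t) = (\<Sum>t = 1..N. \<Sum>s = 1..N. w t s * \<rho> t)"
    by (subst sum.swap) (simp only: w(2))
  also have "\<dots> = 0"
    by (rule sum.neutral, rule ballI) (simp add: w(1) flip: sum_distrib_right)
  finally show ?thesis by simp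
qed

end

section \<open>Sampling fluctuations\<close>

lemma (in prob_space) centred_square_le:
  fixes Y :: "'a \<Rightarrow> real"
  assumes "integrable M Y" "integrable M (\<lambda>x. (Y x - c)\<^sup>2)"
  shows "integrable M (\<lambda>x. (Y x - expectation Y)\<^sup>2)"
    and "expectation (\<lambda>x. (Y x - expectation Y)\<^sup>2) \<le> expectation (\<lambda>x. (Y x - c)\<^sup>2)"
proof -
  define e where "e = expectation Y"
  have eq: "(Y x - e)\<^sup>2 = (Y x - c)\<^sup>2 - 2 * (e - c) * Y x + (e\<^sup>2 - c\<^sup>2)" for x
    by (simp add: power2_eq_square algebra_simps)
  show "integrable M (\<lambda>x. (Y x - expectation Y)\<^sup>2)"
    unfolding e_def[symmetric] eq using assms by simp
  have "expectation (\<lambda>x. (Y x - e)\<^sup>2) = expectation (\<lambda>x. (Y x - c)\<^sup>2) - 2 * (e - c) * e + (e\<^sup>2 - c\<^sup>2)"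
    unfolding eq using assms by (simp add: e_def prob_space)
  also have "\<dots> = expectation (\<lambda>x. (Y x - c)\<^sup>2) - (e - c)\<^sup>2"
    by (simp add: power2_eq_square algebra_simps)
  finally show "expectation (\<lambda>x. (Y x - expectation Y)\<^sup>2) \<le> expectation (\<lambda>x. (Y x - c)\<^sup>2)"
    by (simp add: e_def)
qed

text \<open>Two terms of the double sum are uncorrelated unless they share an index. Each pair of indices
meets the pairs that share an index with it only along two rows and two columns, which accounts
for the factor \<open>4 * R\<close>.\<close>

lemma (in prob_space) u_statistic_variance:
  fixes Y :: "nat \<Rightarrow> nat \<Rightarrow> 'a \<Rightarrow> real" and w :: "nat \<Rightarrow> nat \<Rightarrow> real"
  assumes int: "\<And>s t. \<lbrakk>s \<in> I; t \<in> I; s \<noteq> t\<rbrakk> \<Longrightarrow> integrable M (Y s t)"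
      "\<And>s t. \<lbrakk>s \<in> I; t \<in> I; s \<noteq> t\<rbrakk> \<Longrightarrow> integrable M (\<lambda>x. (Y s t x - c)\<^sup>2)"
    and v: "\<And>s t. \<lbrakk>s \<in> I; t \<in> I; s \<noteq> t\<rbrakk> \<Longrightarrow> expectation (\<lambda>x. (Y s t x - c)\<^sup>2) \<le> v" "0 \<le> v"
    and indep: "\<And>s t s' t'. \<lbrakk>s \<in> I; t \<in> I; s' \<in> I; t' \<in> I; s \<noteq> t; s' \<noteq> t'; {s, t} \<inter> {s', t'} = {}\<rbrakk>
      \<Longrightarrow> indep_var borel (Y s t) borel (Y s' t')"
    and I: "finite I"
    and w: "\<And>s. w s s = 0" "\<And>s t. w s t = w t s"
      "\<And>s. s \<in> I \<Longrightarrow> (\<Sum>t\<in>I. \<bar>w s t\<bar>) \<le> R" "(\<Sum>s\<in>I. \<Sum>t\<in>I. \<bar>w s t\<bar>) \<le> L" "0 \<le> R"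
  defines "Z \<equiv> \<lambda>x. \<Sum>s\<in>I. \<Sum>t\<in>I. w s t * Y s t x"
    and "e \<equiv> \<Sum>s\<in>I. \<Sum>t\<in>I. w s t * expectation (Y s t)"
  shows "integrable M (\<lambda>x. (Z x - e)\<^sup>2)" and "expectation (\<lambda>x. (Z x - e)\<^sup>2) \<le> 4 * R * L * v"
proof -
  define b where "b = (\<lambda>s t x. if s = t then 0 else Y s t x - expectation (Y s t))"
  have b2: "integrable M (\<lambda>x. (b s t x)\<^sup>2)" "expectation (\<lambda>x. (b s t x)\<^sup>2) \<le> v"
    and bi: "integrable M (b s t)" and b0: "expectation (b s t) = 0" if "s \<in> I" "t \<in> I" for s t
    using centred_square_le[OF int(1)[of s t] int(2)[of s t]] int(1)[of s t] v(1)[of s t] v(2) that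
    by (cases "s = t"; auto simp: b_def prob_space intro: order_trans)+
  have bb: "integrable M (\<lambda>x. b s t x * b s' t' x)" "\<bar>expectation (\<lambda>x. b s t x * b s' t' x)\<bar> \<le> v"
    if "s \<in> I" "t \<in> I" "s' \<in> I" "t' \<in> I" for s t s' t'
  proof -
    have le: "\<bar>b s t x * b s' t' x\<bar> \<le> ((b s t x)\<^sup>2 + (b s' t' x)\<^sup>2) / 2" for x
      using sum_squares_bound[of "\<bar>b s t x\<bar>" "\<bar>b s' t' x\<bar>"] by (simp add: abs_mult)
    have i: "integrable M (\<lambda>x. ((b s t x)\<^sup>2 + (b s' t' x)\<^sup>2) / 2)" using b2 that by simp
    show 1: "integrable M (\<lambda>x. b s t x * b s' t' x)"
      by (rule Bochner_Integration.integrable_bound[OF i])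
        (use le bi[OF that(1,2)] bi[OF that(3,4)] in \<open>auto intro!: AE_I2\<close>)
    have "\<bar>expectation (\<lambda>x. b s t x * b s' t' x)\<bar> \<le> expectation (\<lambda>x. \<bar>b s t x * b s' t' x\<bar>)"
      by (rule integral_abs_bound)
    also have "\<dots> \<le> expectation (\<lambda>x. ((b s t x)\<^sup>2 + (b s' t' x)\<^sup>2) / 2)"
      using 1 i le by (intro integral_mono) auto
    also have "\<dots> = (expectation (\<lambda>x. (b s t x)\<^sup>2) + expectation (\<lambda>x. (b s' t' x)\<^sup>2)) / 2"
      using b2 that by simp
    also have "\<dots> \<le> v" using b2(2)[OF that(1,2)] b2(2)[OF that(3,4)] by simp
    finally show "\<bar>expectation (\<lambda>x. b s t x * b s' t' x)\<bar> \<le> v" .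
  qed
  define \<sigma> where "\<sigma> = (\<lambda>s t s' (t' :: nat). of_bool (s' = s) + of_bool (s' = t) + of_bool (t' = s) + of_bool (t' = t) :: real)"
  have cov: "w s t * w s' t' * expectation (\<lambda>x. b s t x * b s' t' x) \<le> \<bar>w s t\<bar> * (\<bar>w s' t'\<bar> * \<sigma> s t s' t') * v"
    if I4: "s \<in> I" "t \<in> I" "s' \<in> I" "t' \<in> I" for s t s' t'
  proof (cases "s = t \<or> s' = t'")
    case True
    then show ?thesis by (auto simp: w(1))
  next
    case False
    show ?thesis
    proof (cases "{s, t} \<inter> {s', t'} = {}")
      case True
      have "indep_var borel ((\<lambda>y. y - expectation (Y s t)) \<circ> Y s t) borel ((\<lambda>y. y - expectation (Y s' t')) \<circ> Y s' t')"
        by (rule indep_var_compose[OF indep]) (use I4 False True in auto)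
      then have "indep_var borel (b s t) borel (b s' t')" using False by (simp add: b_def comp_def)
      from indep_var_lebesgue_integral[OF this bi bi] have "expectation (\<lambda>x. b s t x * b s' t' x) = 0"
        using b0 I4 by simp
      then show ?thesis using v(2) by (simp add: \<sigma>_def)
    next
      case False
      then have \<sigma>1: "1 \<le> \<sigma> s t s' t'" by (auto simp: \<sigma>_def)
      have "w s t * w s' t' * expectation (\<lambda>x. b s t x * b s' t' x)
        \<le> \<bar>w s t * w s' t'\<bar> * \<bar>expectation (\<lambda>x. b s t x * b s' t' x)\<bar>"
        by (metis abs_ge_self abs_mult)
      also have "\<dots> \<le> \<bar>w s t * w s' t'\<bar> * v" by (intro mult_left_mono bb I4) simp
      also have "\<dots> \<le> \<bar>w s t\<bar> * (\<bar>w s' t'\<bar> * \<sigma> s t s' t') * v"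
        using \<sigma>1 v(2) mult_left_mono[OF \<sigma>1, of "\<bar>w s' t'\<bar>"]
        by (intro mult_right_mono) (auto simp: abs_mult intro!: mult_left_mono)
      finally show ?thesis .
    qed
  qed
  have shared: "(\<Sum>s'\<in>I. \<Sum>t'\<in>I. \<bar>w s' t'\<bar> * \<sigma> s t s' t') \<le> 4 * R" if st: "s \<in> I" "t \<in> I" for s t
  proof -
    have row: "(\<Sum>s'\<in>I. \<Sum>t'\<in>I. \<bar>w s' t'\<bar> * of_bool (s' = r)) \<le> R" if "r \<in> I" for r
    proof -
      have "(\<Sum>s'\<in>I. \<Sum>t'\<in>I. \<bar>w s' t'\<bar> * of_bool (s' = r)) = (\<Sum>s'\<in>I. if s' = r then (\<Sum>t'\<in>I. \<bar>w r t'\<bar>) else 0)"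
        by (intro sum.cong refl) auto
      also have "\<dots> = (\<Sum>t'\<in>I. \<bar>w r t'\<bar>)" using that I by simp
      finally show ?thesis using w(3)[OF that] by simp
    qed
    have col: "(\<Sum>s'\<in>I. \<Sum>t'\<in>I. \<bar>w s' t'\<bar> * of_bool (t' = r)) \<le> R" if "r \<in> I" for r
      using row[OF that] by (subst sum.swap, subst w(2))
    show ?thesis using row[OF st(1)] row[OF st(2)] col[OF st(1)] col[OF st(2)]
      by (simp add: \<sigma>_def distrib_left sum.distrib)
  qed
  have Ze: "Z x - e = (\<Sum>s\<in>I. \<Sum>t\<in>I. w s t * b s t x)" for x
    unfolding Z_def e_def sum_subtractf[symmetric]
    by (intro sum.cong refl) (auto simp: b_def w(1) algebra_simps)
  have sq: "(Z x - e)\<^sup>2 = (\<Sum>s\<in>I. \<Sum>t\<in>I. \<Sum>s'\<in>I. \<Sum>t'\<in>I. w s t * w s' t' * (b s t x * b s' t' x))" for x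
  proof -
    have "(Z x - e)\<^sup>2 = (\<Sum>s\<in>I. \<Sum>t\<in>I. w s t * b s t x) * (\<Sum>s'\<in>I. \<Sum>t'\<in>I. w s' t' * b s' t' x)"
      by (simp add: Ze power2_eq_square)
    also have "\<dots> = (\<Sum>s\<in>I. \<Sum>t\<in>I. \<Sum>s'\<in>I. \<Sum>t'\<in>I. (w s t * b s t x) * (w s' t' * b s' t' x))"
      by (simp only: sum_distrib_right) (simp only: sum_distrib_left)
    finally show ?thesis by (simp add: mult_ac)
  qed
  show "integrable M (\<lambda>x. (Z x - e)\<^sup>2)"
    unfolding sq by (intro Bochner_Integration.integrable_sum integrable_mult_right bb)
  have "expectation (\<lambda>x. (Z x - e)\<^sup>2)
    = (\<Sum>s\<in>I. \<Sum>t\<in>I. \<Sum>s'\<in>I. \<Sum>t'\<in>I. w s t * w s' t' * expectation (\<lambda>x. b s t x * b s' t' x))"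
  proof -
    have "has_bochner_integral M (\<lambda>x. (Z x - e)\<^sup>2)
      (\<Sum>s\<in>I. \<Sum>t\<in>I. \<Sum>s'\<in>I. \<Sum>t'\<in>I. w s t * w s' t' * expectation (\<lambda>x. b s t x * b s' t' x))"
      unfolding sq
      by (intro has_bochner_integral_sum has_bochner_integral_mult_right has_bochner_integral_integrable bb)
    then show ?thesis by (simp add: has_bochner_integral_iff)
  qed
  also have "\<dots> \<le> (\<Sum>s\<in>I. \<Sum>t\<in>I. \<Sum>s'\<in>I. \<Sum>t'\<in>I. \<bar>w s t\<bar> * (\<bar>w s' t'\<bar> * \<sigma> s t s' t') * v)"
    by (intro sum_mono cov)
  also have "\<dots> = (\<Sum>s\<in>I. \<Sum>t\<in>I. \<bar>w s t\<bar> * (\<Sum>s'\<in>I. \<Sum>t'\<in>I. \<bar>w s' t'\<bar> * \<sigma> s t s' t')) * v"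
    by (simp only: sum_distrib_left sum_distrib_right)
  also have "\<dots> \<le> (\<Sum>s\<in>I. \<Sum>t\<in>I. \<bar>w s t\<bar> * (4 * R)) * v"
    by (intro mult_right_mono sum_mono mult_left_mono shared v) auto
  also have "\<dots> = (\<Sum>s\<in>I. \<Sum>t\<in>I. \<bar>w s t\<bar>) * (4 * R) * v"
    by (simp only: sum_distrib_right)
  also have "\<dots> \<le> L * (4 * R) * v"
    using w(4,5) v(2) by (intro mult_right_mono) auto
  finally show "expectation (\<lambda>x. (Z x - e)\<^sup>2) \<le> 4 * R * L * v" by (simp add: mult_ac)
qed

text \<open>A radial kernel together with two independent samples. The bound \<open>v\<close> on the mean square of
\<open>k - f s0\<close> is the only information on the kernel that enters the fluctuations.\<close>

locale two_sample_energy = radial_pair P Q q U a f s0 B k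
  for P Q :: "vec measure" and q :: nat and U :: real and a :: nat and f :: "real \<Rightarrow> real"
    and s0 B :: real and k :: "vec \<Rightarrow> vec \<Rightarrow> real" +
  fixes \<Omega> :: "'w measure" and X Y :: "nat \<Rightarrow> 'w \<Rightarrow> vec" and n m :: nat and v :: real
  assumes samples: "two_samples q \<Omega> X Y P Q"
    and n: "2 \<le> n" and m: "2 \<le> m"
    and second: "\<And>P1 P2. P1 \<in> {P, Q} \<Longrightarrow> P2 \<in> {P, Q} \<Longrightarrow>
      integrable (P1 \<Otimes>\<^sub>M P2) (\<lambda>z. k (fst z) (snd z)) \<and>
      integrable (P1 \<Otimes>\<^sub>M P2) (\<lambda>z. (k (fst z) (snd z) - f s0)\<^sup>2) \<and>
      (\<integral>z. (k (fst z) (snd z) - f s0)\<^sup>2 \<partial>(P1 \<Otimes>\<^sub>M P2)) \<le> v"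
begin

sublocale \<Omega>: prob_space \<Omega> using samples by (simp add: two_samples_def)

definition W :: "nat \<Rightarrow> 'w \<Rightarrow> vec" where
  "W s \<omega> = pooled n (\<lambda>i. X i \<omega>) (\<lambda>j. Y j \<omega>) s"

text \<open>The sampling assumption is about a family indexed by \<open>nat + nat\<close>; \<open>idx\<close> embeds the positions of the
pooled sample into it.\<close>

definition idx :: "nat \<Rightarrow> nat + nat" where "idx s = (if s \<le> n then Inl s else Inr (s - n))"

definition law :: "nat \<Rightarrow> vec measure" where "law s = (if s \<le> n then P else Q)"

definition I :: "nat set" where "I = {1..n + m}"

lemma idx_inj: "idx s = idx t \<longleftrightarrow> s = t" by (auto simp: idx_def)

lemma W_idx: "W s = case_sum X Y (idx s)"
  by (auto simp: W_def pooled_def idx_def)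

lemma indep_all: "\<Omega>.indep_vars (\<lambda>_. Rp q) (case_sum X Y) UNIV"
  and law_X: "distr \<Omega> (Rp q) (X i) = P" and law_Y: "distr \<Omega> (Rp q) (Y i) = Q"
  using samples by (auto simp: two_samples_def)

lemma W_measurable: "W s \<in> \<Omega> \<rightarrow>\<^sub>M Rp q"
  using indep_all unfolding W_idx \<Omega>.indep_vars_def by auto

lemma W_law: "distr \<Omega> (Rp q) (W s) = law s"
  by (auto simp: W_idx idx_def law_def law_X law_Y)

lemma law_cases: "law s \<in> {P, Q}" by (simp add: law_def)

lemma sets_pair: "P1 \<in> {P, Q} \<Longrightarrow> P2 \<in> {P, Q} \<Longrightarrow> sets (P1 \<Otimes>\<^sub>M P2) = sets (Rp q \<Otimes>\<^sub>M Rp q)"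
  using P.sets_eq Q.sets_eq by (intro sets_pair_measure_cong) auto

lemma kernel_measurable: "(\<lambda>z. k (fst z) (snd z)) \<in> borel_measurable (Rp q \<Otimes>\<^sub>M Rp q)"
  using k_measurable measurable_cong_sets[OF sets_pair[of P Q] refl] by auto

lemma kW_measurable: "(\<lambda>\<omega>. k (W s \<omega>) (W t \<omega>)) \<in> borel_measurable \<Omega>"
  using measurable_compose[OF measurable_Pair[OF W_measurable W_measurable] kernel_measurable] by simp

lemma W_pair_law:
  assumes "s \<noteq> t"
  shows "distr \<Omega> (Rp q \<Otimes>\<^sub>M Rp q) (\<lambda>\<omega>. (W s \<omega>, W t \<omega>)) = law s \<Otimes>\<^sub>M law t"
proof -
  have "\<Omega>.indep_var (PiM {idx s} (\<lambda>_. Rp q)) (\<lambda>\<omega>. \<lambda>i\<in>{idx s}. case_sum X Y i \<omega>)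
      (PiM {idx t} (\<lambda>_. Rp q)) (\<lambda>\<omega>. \<lambda>i\<in>{idx t}. case_sum X Y i \<omega>)"
    by (rule \<Omega>.indep_var_restrict[OF indep_all]) (use assms in \<open>auto simp: idx_inj\<close>)
  from \<Omega>.indep_var_compose[OF this measurable_component_singleton[of "idx s"] measurable_component_singleton[of "idx t"]]
  have "\<Omega>.indep_var (Rp q) (W s) (Rp q) (W t)" by (simp add: comp_def W_idx)
  then show ?thesis by (simp add: \<Omega>.indep_var_distribution_eq W_law)
qed

lemma W_integral:
  fixes \<phi> :: "vec \<times> vec \<Rightarrow> real"
  assumes "s \<noteq> t" and \<phi>: "\<phi> \<in> borel_measurable (Rp q \<Otimes>\<^sub>M Rp q)"
  shows "integrable \<Omega> (\<lambda>\<omega>. \<phi> (W s \<omega>, W t \<omega>)) \<longleftrightarrow> integrable (law s \<Otimes>\<^sub>M law t) \<phi>"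
    and "(\<integral>\<omega>. \<phi> (W s \<omega>, W t \<omega>) \<partial>\<Omega>) = (\<integral>z. \<phi> z \<partial>(law s \<Otimes>\<^sub>M law t))"
  unfolding W_pair_law[OF assms(1), symmetric]
  using measurable_Pair[OF W_measurable W_measurable] \<phi>
  by (auto simp: integrable_distr_eq integral_distr)

lemma kW_moments:
  assumes "s \<noteq> t"
  shows "integrable \<Omega> (\<lambda>\<omega>. k (W s \<omega>) (W t \<omega>))"
    and "integrable \<Omega> (\<lambda>\<omega>. (k (W s \<omega>) (W t \<omega>) - f s0)\<^sup>2)"
    and "\<Omega>.expectation (\<lambda>\<omega>. (k (W s \<omega>) (W t \<omega>) - f s0)\<^sup>2) \<le> v"
    and "\<Omega>.expectation (\<lambda>\<omega>. k (W s \<omega>) (W t \<omega>)) = kernel_cross k (law s) (law t)"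
proof -
  have m2: "(\<lambda>z. (k (fst z) (snd z) - f s0)\<^sup>2) \<in> borel_measurable (Rp q \<Otimes>\<^sub>M Rp q)"
    using kernel_measurable by measurable
  note 1 = W_integral[OF assms kernel_measurable] and 2 = W_integral[OF assms m2]
  note sec = second[OF law_cases[of s] law_cases[of t]]
  show "integrable \<Omega> (\<lambda>\<omega>. k (W s \<omega>) (W t \<omega>))" using 1 sec by simp
  show "integrable \<Omega> (\<lambda>\<omega>. (k (W s \<omega>) (W t \<omega>) - f s0)\<^sup>2)" using 2 sec by simp
  show "\<Omega>.expectation (\<lambda>\<omega>. (k (W s \<omega>) (W t \<omega>) - f s0)\<^sup>2) \<le> v" using 2 sec by simp
  show "\<Omega>.expectation (\<lambda>\<omega>. k (W s \<omega>) (W t \<omega>)) = kernel_cross k (law s) (law t)"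
    using 1 by (simp add: kernel_cross_def)
qed

lemma v_nonneg: "0 \<le> v"
proof -
  have "0 \<le> \<Omega>.expectation (\<lambda>\<omega>. (k (W 1 \<omega>) (W 2 \<omega>) - f s0)\<^sup>2)" by simp
  also have "\<dots> \<le> v" by (rule kW_moments) simp
  finally show ?thesis .
qed

lemma kW_indep:
  assumes "{s, t} \<inter> {s', t'} = {}"
  shows "\<Omega>.indep_var borel (\<lambda>\<omega>. k (W s \<omega>) (W t \<omega>)) borel (\<lambda>\<omega>. k (W s' \<omega>) (W t' \<omega>))"
proof -
  define \<phi> where "\<phi> = (\<lambda>s t (y :: nat + nat \<Rightarrow> vec). k (y (idx s)) (y (idx t)))"
  have \<phi>: "\<phi> s t \<in> borel_measurable (PiM {idx s, idx t} (\<lambda>_. Rp q))" for s t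
  proof -
    have "(\<lambda>y :: nat + nat \<Rightarrow> vec. (y (idx s), y (idx t))) \<in> PiM {idx s, idx t} (\<lambda>_. Rp q) \<rightarrow>\<^sub>M Rp q \<Otimes>\<^sub>M Rp q"
      by (intro measurable_Pair measurable_component_singleton) auto
    from measurable_compose[OF this kernel_measurable] show ?thesis by (simp add: \<phi>_def)
  qed
  have "\<Omega>.indep_var (PiM {idx s, idx t} (\<lambda>_. Rp q)) (\<lambda>\<omega>. \<lambda>i\<in>{idx s, idx t}. case_sum X Y i \<omega>)
      (PiM {idx s', idx t'} (\<lambda>_. Rp q)) (\<lambda>\<omega>. \<lambda>i\<in>{idx s', idx t'}. case_sum X Y i \<omega>)"
    by (rule \<Omega>.indep_var_restrict[OF indep_all]) (use assms in \<open>auto simp: idx_inj\<close>)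
  from \<Omega>.indep_var_compose[OF this \<phi>[of s t] \<phi>[of s' t']]
  show ?thesis by (simp add: comp_def W_idx \<phi>_def)
qed

definition Z :: "'w \<Rightarrow> real" where
  "Z \<omega> = (\<Sum>s\<in>I. \<Sum>t\<in>I. contrast n m s t * k (W s \<omega>) (W t \<omega>))"

definition e :: real where "e = - kernel_signed k P Q"

lemma sum_off_const: "(\<Sum>i = 1..l. \<Sum>j = 1..l. if i = j then 0 else c :: real) = real l * ((real l - 1) * c)"
proof -
  have "(\<Sum>i = 1..l. \<Sum>j = 1..l. if i = j then 0 else c) = (\<Sum>i = 1..l. (real l - 1) * c)"
    by (intro sum.cong refl sum_const_off)
  then show ?thesis by simp
qed

lemma contrast_mean:
  "(\<Sum>s\<in>I. \<Sum>t\<in>I. contrast n m s t * \<Omega>.expectation (\<lambda>\<omega>. k (W s \<omega>) (W t \<omega>))) = e"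
proof -
  define \<kappa> where "\<kappa> = (\<lambda>s t. kernel_cross k (law s) (law t))"
  have "(\<Sum>s\<in>I. \<Sum>t\<in>I. contrast n m s t * \<Omega>.expectation (\<lambda>\<omega>. k (W s \<omega>) (W t \<omega>)))
    = (\<Sum>s\<in>I. \<Sum>t\<in>I. contrast n m s t * \<kappa> s t)"
    using kW_moments(4) by (intro sum.cong refl) (auto simp: \<kappa>_def contrast_def)
  also have "\<dots> = (\<Sum>i = 1..n. (\<Sum>j = 1..n. contrast n m i j * \<kappa> i j) + (\<Sum>j = 1..m. contrast n m i (n + j) * \<kappa> i (n + j)))
    + (\<Sum>i = 1..m. (\<Sum>j = 1..n. contrast n m (n + i) j * \<kappa> (n + i) j) + (\<Sum>j = 1..m. contrast n m (n + i) (n + j) * \<kappa> (n + i) (n + j)))"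
    unfolding I_def sum_split ..
  also have "(\<Sum>i = 1..n. (\<Sum>j = 1..n. contrast n m i j * \<kappa> i j) + (\<Sum>j = 1..m. contrast n m i (n + j) * \<kappa> i (n + j)))
    = (\<Sum>i = 1..n. (\<Sum>j = 1..n. if i = j then 0 else - 1 / (real n * (real n - 1)) * kernel_cross k P P)
      + (\<Sum>j = 1..m. 1 / (real n * real m) * kernel_cross k P Q))"
    by (intro sum.cong refl arg_cong2[where f="(+)"]) (auto simp: contrast_def \<kappa>_def law_def)
  also have "\<dots> = kernel_cross k P Q - kernel_cross k P P"
    unfolding sum.distrib sum_off_const using n m by simp
  also have "(\<Sum>i = 1..m. (\<Sum>j = 1..n. contrast n m (n + i) j * \<kappa> (n + i) j) + (\<Sum>j = 1..m. contrast n m (n + i) (n + j) * \<kappa> (n + i) (n + j)))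
    = (\<Sum>i = 1..m. (\<Sum>j = 1..n. 1 / (real n * real m) * kernel_cross k Q P)
      + (\<Sum>j = 1..m. if i = j then 0 else - 1 / (real m * (real m - 1)) * kernel_cross k Q Q))"
    by (intro sum.cong refl arg_cong2[where f="(+)"]) (auto simp: contrast_def \<kappa>_def law_def)
  also have "\<dots> = kernel_cross k Q P - kernel_cross k Q Q"
    unfolding sum.distrib sum_off_const using n m by simp
  finally show ?thesis by (simp add: e_def kernel_signed_def)
qed

definition \<mu> :: real where "\<mu> = real (min n m)"

lemma \<mu>: "2 \<le> \<mu>" "\<mu> \<le> real n" "\<mu> \<le> real m" using n m by (auto simp: \<mu>_def)

lemma Z_variance:
  shows "integrable \<Omega> (\<lambda>\<omega>. (Z \<omega> - e)\<^sup>2)" and "\<Omega>.expectation (\<lambda>\<omega>. (Z \<omega> - e)\<^sup>2) \<le> 32 * v / \<mu>"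
proof -
  have row: "(\<Sum>t\<in>I. \<bar>contrast n m s t\<bar>) \<le> 2 / \<mu>" if "s \<in> I" for s
    using that \<mu> unfolding I_def by (subst contrast_row(2)[OF n m]) (auto intro!: divide_left_mono mult_pos_pos)
  note U = \<Omega>.u_statistic_variance[where Y="\<lambda>s t \<omega>. k (W s \<omega>) (W t \<omega>)" and c="f s0" and v=v
      and I=I and w="contrast n m" and R="2 / \<mu>" and L=4]
  have fin: "finite I" by (simp add: I_def)
  have "integrable \<Omega> (\<lambda>\<omega>. (Z \<omega> - e)\<^sup>2) \<and> \<Omega>.expectation (\<lambda>\<omega>. (Z \<omega> - e)\<^sup>2) \<le> 4 * (2 / \<mu>) * 4 * v"
    unfolding Z_def contrast_mean[symmetric]
    by (intro conjI U)
      (use \<mu> contrast_total[OF n m, folded I_def] in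
        \<open>simp_all add: kW_moments v_nonneg kW_indep contrast_diag contrast_sym row fin\<close>)
  then show "integrable \<Omega> (\<lambda>\<omega>. (Z \<omega> - e)\<^sup>2)" and "\<Omega>.expectation (\<lambda>\<omega>. (Z \<omega> - e)\<^sup>2) \<le> 32 * v / \<mu>" by auto
qed

text \<open>Bounds the variance statistic from above, by the choice \<open>c = f s0\<close> in \<open>hollow\<close>.\<close>

definition V' :: "'w \<Rightarrow> real" where
  "V' \<omega> = (\<Sum>s\<in>I. \<Sum>t\<in>I. if s = t then 0 else (k (W s \<omega>) (W t \<omega>) - f s0)\<^sup>2) / (real (n + m) * (real (n + m) - 3))"

lemma V'_mean:
  shows "integrable \<Omega> V'" and "\<Omega>.expectation V' \<le> 3 * v"
proof -
  define N where "N = real (n + m)"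
  have N: "4 \<le> N" using n m by (simp add: N_def)
  have i: "integrable \<Omega> (\<lambda>\<omega>. if s = t then 0 else (k (W s \<omega>) (W t \<omega>) - f s0)\<^sup>2)" for s t
    using kW_moments(2)[of s t] by (cases "s = t") auto
  show "integrable \<Omega> V'" unfolding V'_def
    by (intro integrable_divide_zero Bochner_Integration.integrable_sum i)
  have "\<Omega>.expectation V' = (\<Sum>s\<in>I. \<Sum>t\<in>I. \<Omega>.expectation (\<lambda>\<omega>. if s = t then 0 else (k (W s \<omega>) (W t \<omega>) - f s0)\<^sup>2)) / (N * (N - 3))"
    unfolding V'_def N_def[symmetric]
    by (simp add: Bochner_Integration.integral_sum Bochner_Integration.integrable_sum i)
  also have "\<dots> \<le> (\<Sum>s\<in>I. \<Sum>t\<in>I. if s = t then 0 else v) / (N * (N - 3))"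
    using N kW_moments(3) by (intro divide_right_mono sum_mono) auto
  also have "(\<Sum>s\<in>I. \<Sum>t\<in>I. if s = t then 0 else v) = (\<Sum>s\<in>I. (N - 1) * v)"
    unfolding I_def N_def by (intro sum.cong refl sum_const_off)
  also have "\<dots> = N * (N - 1) * v" by (simp add: I_def N_def)
  also have "N * (N - 1) * v / (N * (N - 3)) = (N - 1) / (N - 3) * v" using N by simp
  also have "\<dots> \<le> 3 * v" using N v_nonneg by (intro mult_right_mono) (auto simp: divide_simps)
  finally show "\<Omega>.expectation V' \<le> 3 * v" .
qed

lemma c_nm_bound: "0 < c_nm n m" "c_nm n m \<le> 6 / \<mu>"
proof -
  have n': "2 \<le> real n" "2 \<le> real m" using n m by auto
  have le: "2 / (l * (l - 1)) \<le> 2 / \<mu>" if "\<mu> \<le> l" "2 \<le> l" for l :: real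
  proof -
    have "\<mu> * 1 \<le> l * (l - 1)" using that \<mu> by (intro mult_mono) auto
    then show ?thesis using \<mu> that by (intro divide_left_mono) auto
  qed
  have "2 * \<mu> \<le> real n * real m" using \<mu> n' by (intro mult_mono) auto
  then have "4 / (real n * real m) \<le> 4 / (2 * \<mu>)" using \<mu> by (intro divide_left_mono) auto
  then show "c_nm n m \<le> 6 / \<mu>"
    using le[of "real n"] le[of "real m"] \<mu> n' unfolding c_nm_def by simp
  show "0 < c_nm n m" unfolding c_nm_def using n' by (intro add_pos_pos divide_pos_pos mult_pos_pos) auto
qed

lemma W_space: "\<omega> \<in> space \<Omega> \<Longrightarrow> W s \<omega> \<in> space (Rp q)"
  using measurable_space[OF W_measurable] .

lemma k_sym: "x \<in> space (Rp q) \<Longrightarrow> y \<in> space (Rp q) \<Longrightarrow> k x y = k y x"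
  using radial[of x y] radial[of y x] by (simp add: edist_def L2_set_def power2_commute)

lemma k_diag: "x \<in> space (Rp q) \<Longrightarrow> k x x = k (origin q) (origin q)"
  using radial[of x x] radial[of "origin q" "origin q"]
  by (auto simp: edist_def L2_set_def origin_def space_PiM)

lemma X_space: "\<omega> \<in> space \<Omega> \<Longrightarrow> X i \<omega> \<in> space (Rp q)" "\<omega> \<in> space \<Omega> \<Longrightarrow> Y i \<omega> \<in> space (Rp q)"
proof -
  have *: "case_sum X Y l \<in> \<Omega> \<rightarrow>\<^sub>M Rp q" for l using indep_all unfolding \<Omega>.indep_vars_def by auto
  show "\<omega> \<in> space \<Omega> \<Longrightarrow> X i \<omega> \<in> space (Rp q)" "\<omega> \<in> space \<Omega> \<Longrightarrow> Y i \<omega> \<in> space (Rp q)"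
    using measurable_space[OF *[of "Inl i"]] measurable_space[OF *[of "Inr i"]] by auto
qed

abbreviation Ts :: "'w \<Rightarrow> real" where
  "Ts \<omega> \<equiv> T_stat q k n m (\<lambda>i. X i \<omega>) (\<lambda>j. Y j \<omega>)"

lemma energy_stat_Z: "\<omega> \<in> space \<Omega> \<Longrightarrow> energy_stat k n m (\<lambda>i. X i \<omega>) (\<lambda>j. Y j \<omega>) = Z \<omega>"
  unfolding Z_def I_def W_def
  by (rule energy_stat_contrast[OF n m]) (auto intro!: k_sym X_space)

text \<open>A small deviation of the energy statistic keeps it above \<open>e / 2\<close>, in particular away from zero.
By \<open>contrast_sum\<close> the variance statistic is then positive, so the quotient is not the default
value of a division by zero.\<close>

lemma T_exceeds:
  assumes \<omega>: "\<omega> \<in> space \<Omega>" and C: "0 < C" and e0: "0 < e"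
    and small: "(Z \<omega> - e)\<^sup>2 + C\<^sup>2 * (c_nm n m * V' \<omega>) < e\<^sup>2 / 4"
  shows "C < Ts \<omega>"
proof -
  define A where "A = (\<lambda>s t. k (W s \<omega>) (W t \<omega>))"
  interpret hollow "n + m" A "k (origin q) (origin q)" "f s0"
    by unfold_locales (use n m W_space[OF \<omega>] k_sym k_diag in \<open>auto simp: A_def\<close>)
  define V where "V = (\<Sum>s = 1..n + m. \<Sum>t = 1..n + m. (H s t)\<^sup>2) / (real (n + m) * (real (n + m) - 3))"
  have den: "0 < real (n + m) * (real (n + m) - 3)" using n m by (intro mult_pos_pos) auto
  have var: "variance_stat q k n m (\<lambda>i. X i \<omega>) (\<lambda>j. Y j \<omega>) = V"
    unfolding V_def by (subst variance_identity[symmetric]) (simp only: variance_stat_def Let_def A_def W_def)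
  have VV': "V \<le> V' \<omega>"
  proof -
    have "(\<Sum>s = 1..n + m. \<Sum>t = 1..n + m. (h s t)\<^sup>2)
      = (\<Sum>s\<in>I. \<Sum>t\<in>I. if s = t then 0 else (k (W s \<omega>) (W t \<omega>) - f s0)\<^sup>2)"
      unfolding I_def h_def by (intro sum.cong refl) (auto simp: A_def)
    then show ?thesis unfolding V_def V'_def using H_sum_squares den by (intro divide_right_mono) auto
  qed
  have V0: "0 \<le> V" unfolding V_def using den by (intro divide_nonneg_pos sum_nonneg) auto
  have c: "0 < c_nm n m" by (rule c_nm_bound)
  have small': "(Z \<omega> - e)\<^sup>2 + C\<^sup>2 * (c_nm n m * V) < e\<^sup>2 / 4"
  proof -
    have "C\<^sup>2 * (c_nm n m * V) \<le> C\<^sup>2 * (c_nm n m * V' \<omega>)" using VV' c by (intro mult_left_mono) auto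
    then show ?thesis using small by linarith
  qed
  have cV: "0 \<le> C\<^sup>2 * (c_nm n m * V)" using V0 c by simp
  have "(Z \<omega> - e)\<^sup>2 < (e / 2)\<^sup>2" using small' cV by (simp add: power_divide)
  then have "\<bar>Z \<omega> - e\<bar> < e / 2" using power2_less_imp_less[of "\<bar>Z \<omega> - e\<bar>" "e / 2"] e0 by simp
  then have Z: "e / 2 < Z \<omega>" by linarith
  have V: "0 < V"
  proof (rule ccontr)
    assume "\<not> 0 < V"
    then have "V = 0" using V0 by simp
    then have "(\<Sum>s = 1..n + m. \<Sum>t = 1..n + m. (H s t)\<^sup>2) = 0"
      using den unfolding V_def divide_eq_0_iff by (metis less_irrefl)
    then have H0: "H s t = 0" if "s \<in> {1..n + m}" "t \<in> {1..n + m}" for s t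
      using that by (subst (asm) sum_nonneg_eq_0_iff; simp add: sum_nonneg sum_nonneg_eq_0_iff)
    have "Z \<omega> = (\<Sum>s = 1..n + m. \<Sum>t = 1..n + m. contrast n m s t * A s t)" by (simp add: Z_def I_def A_def)
    also have "\<dots> = (\<Sum>s = 1..n + m. \<Sum>t = 1..n + m. contrast n m s t * H s t)"
      by (rule contrast_sum) (auto simp only: contrast_row(1)[OF n m] contrast_diag intro: contrast_sym)
    also have "\<dots> = 0" using H0 by (intro sum.neutral ballI) simp
    finally show False using Z e0 by simp
  qed
  have "(C * sqrt (c_nm n m * V))\<^sup>2 < (e / 2)\<^sup>2"
    using small' V c by (simp add: power_mult_distrib power_divide) (smt (verit) zero_le_power2)
  then have "C * sqrt (c_nm n m * V) < e / 2" using power2_less_imp_less[of "C * sqrt (c_nm n m * V)" "e / 2"] e0 by simp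
  then have "C * sqrt (c_nm n m * V) < Z \<omega>" using Z by simp
  then show ?thesis using V c
    unfolding T_stat_def energy_stat_Z[OF \<omega>] var by (simp add: pos_less_divide_eq)
qed

lemma T_measurable: "Ts \<in> borel_measurable \<Omega>"
proof -
  have e: "(\<lambda>\<omega>. energy_stat k n m (\<lambda>i. X i \<omega>) (\<lambda>j. Y j \<omega>)) \<in> borel_measurable \<Omega>"
  proof (subst measurable_cong[OF energy_stat_Z])
    show "Z \<in> borel_measurable \<Omega>" unfolding Z_def[abs_def]
      by (intro borel_measurable_sum borel_measurable_times borel_measurable_const kW_measurable)
  qed
  have v: "(\<lambda>\<omega>. variance_stat q k n m (\<lambda>i. X i \<omega>) (\<lambda>j. Y j \<omega>)) \<in> borel_measurable \<Omega>"
    unfolding variance_stat_def Let_def u_center_def W_def[symmetric] split_def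
    by (intro borel_measurable_sum borel_measurable_times borel_measurable_const borel_measurable_diff
        borel_measurable_add borel_measurable_power borel_measurable_divide kW_measurable)
  show ?thesis unfolding T_stat_def
    by (intro borel_measurable_divide e measurable_compose[OF _ borel_measurable_sqrt]
        borel_measurable_times borel_measurable_const v)
qed

text \<open>Markov's inequality for the quantity that \<open>T_exceeds\<close> asks to be small.\<close>

lemma T_probability:
  assumes C: "0 < C" and e0: "0 < e"
  shows "1 - 4 * (32 + 18 * C\<^sup>2) * v / (\<mu> * e\<^sup>2) \<le> \<Omega>.prob {\<omega> \<in> space \<Omega>. C < Ts \<omega>}"
proof -
  define D where "D \<omega> = (Z \<omega> - e)\<^sup>2 + C\<^sup>2 * (c_nm n m * V' \<omega>)" for \<omega>
  have D: "integrable \<Omega> D" unfolding D_def[abs_def] using Z_variance(1) V'_mean(1) by simp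
  have V'0: "0 \<le> V' \<omega>" for \<omega>
    unfolding V'_def using n m by (intro divide_nonneg_nonneg sum_nonneg mult_nonneg_nonneg) auto
  have D0: "0 \<le> D \<omega>" for \<omega> unfolding D_def using V'0 c_nm_bound(1) by simp
  have "\<Omega>.expectation D = \<Omega>.expectation (\<lambda>\<omega>. (Z \<omega> - e)\<^sup>2) + C\<^sup>2 * (c_nm n m * \<Omega>.expectation V')"
    unfolding D_def[abs_def] using Z_variance(1) V'_mean(1) by simp
  also have "\<dots> \<le> 32 * v / \<mu> + C\<^sup>2 * (6 / \<mu> * (3 * v))"
    using Z_variance(2) V'_mean(2) c_nm_bound V'0 \<mu> v_nonneg
    by (intro add_mono mult_left_mono mult_mono) (auto intro!: integral_nonneg)
  also have "\<dots> = (32 + 18 * C\<^sup>2) * v / \<mu>" by (simp add: add_divide_distrib algebra_simps)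
  finally have ED: "\<Omega>.expectation D \<le> (32 + 18 * C\<^sup>2) * v / \<mu>" .
  have "\<Omega>.prob {\<omega> \<in> space \<Omega>. e\<^sup>2 / 4 \<le> D \<omega>} \<le> \<Omega>.expectation D / (e\<^sup>2 / 4)"
    by (rule integral_Markov_inequality_measure[OF D, where A="{}"]) (use D0 e0 in auto)
  also have "\<dots> \<le> ((32 + 18 * C\<^sup>2) * v / \<mu>) / (e\<^sup>2 / 4)"
    by (intro divide_right_mono ED) simp
  also have "\<dots> = 4 * (32 + 18 * C\<^sup>2) * v / (\<mu> * e\<^sup>2)" by simp
  finally have bad: "\<Omega>.prob {\<omega> \<in> space \<Omega>. e\<^sup>2 / 4 \<le> D \<omega>} \<le> 4 * (32 + 18 * C\<^sup>2) * v / (\<mu> * e\<^sup>2)" .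
  have Dm: "D \<in> borel_measurable \<Omega>" using D by auto
  have meas: "{\<omega> \<in> space \<Omega>. e\<^sup>2 / 4 \<le> D \<omega>} \<in> \<Omega>.events" "{\<omega> \<in> space \<Omega>. C < Ts \<omega>} \<in> \<Omega>.events"
    using Dm T_measurable by measurable
  have "1 - \<Omega>.prob {\<omega> \<in> space \<Omega>. e\<^sup>2 / 4 \<le> D \<omega>} = \<Omega>.prob (space \<Omega> - {\<omega> \<in> space \<Omega>. e\<^sup>2 / 4 \<le> D \<omega>})"
    by (rule \<Omega>.prob_compl[symmetric, OF meas(1)])
  also have "\<dots> \<le> \<Omega>.prob {\<omega> \<in> space \<Omega>. C < Ts \<omega>}"
    using T_exceeds[OF _ C e0] by (intro \<Omega>.finite_measure_mono meas) (auto simp: D_def not_le)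
  finally show ?thesis using bad by simp
qed

end

declare One_nat_def [simp]

section \<open>Asymptotics\<close>

text \<open>The constants are chosen before the dimension and the kernel. The number \<open>y\<close> stands for
$q^{\delta/2}$, which keeps real exponents out of the estimates: in units of \<open>\<bar>f s0\<bar> / q\<^sup>2\<close> the
signal is at least \<open>c1 * y\<^sup>2\<close> and the noise at most \<open>C2 * y\<close>, so the condition \<open>2 * C2 / c1 \<le> y\<close> leaves
at least half of the signal.\<close>

lemma fixed_dimension_bound:
  fixes U L Ud L3 U3 B' B3 C :: real and a :: nat
  assumes pos: "1 \<le> U" "0 < L" "0 < Ud" "0 < L3" "0 < U3" "0 < B'" "0 < B3" "0 < C"
  obtains K y0 :: real where "0 \<le> K" and
    "\<And>P Q q f s0 B k (\<Omega> :: 'w measure) X Y n m y.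
      \<lbrakk>radial_pair P Q q U a f s0 B k; two_samples q \<Omega> X Y P Q; 2 \<le> n; 2 \<le> m; 1 \<le> q;
       \<And>i. i \<in> {1..q} \<Longrightarrow> mean P i = mean Q i; s0\<^sup>2 = mean_sq_dist q P Q; kernel_on q k;
       L * real q \<le> s0\<^sup>2; s0\<^sup>2 \<le> Ud * real q; 1 \<le> y; y\<^sup>2 \<le> real q; y0 \<le> y;
       \<bar>centered_sq_norm q P - centered_sq_norm q Q\<bar> \<le> U3 * y;
       0 < frobenius q (\<lambda>i j. covariance P i j - covariance Q i j);
       2 * L3\<^sup>2 * y\<^sup>2 \<le> 2 * (centered_sq_norm q P - centered_sq_norm q Q)\<^sup>2
         + 4 * (frobenius q (\<lambda>i j. covariance P i j - covariance Q i j))\<^sup>2;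
       B * \<bar>f s0\<bar> \<le> B' * \<bar>f s0\<bar>; \<bar>f s0\<bar> \<le> B3 * \<bar>radial_profile.beta f s0\<bar>\<rbrakk>
      \<Longrightarrow> 1 - K * (real q ^ 3 / y ^ 4) / real (min n m)
        \<le> measure \<Omega> {\<omega> \<in> space \<Omega>. C < T_stat q k n m (\<lambda>i. X i \<omega>) (\<lambda>j. Y j \<omega>)}"
proof -
  define mc where "mc = 13 * real (a + 1) ^ 4 * (4096 * U)\<^sup>2"
  define c1 where "c1 = 2 * L3\<^sup>2 / (B3 * Ud\<^sup>2)"
  define C3 where "C3 = mc + 3 * U3 * mc + U3 ^ 3"
  define C2 where "C2 = 4 * B' * (C3 / L ^ 3 + 48 * (mc + U3 ^ 4) / L ^ 4)"
  define C4 where "C4 = B'\<^sup>2 * (mc + U3\<^sup>2) / L\<^sup>2"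
  define K where "K = 4 * (32 + 18 * C\<^sup>2) * (4 * C4 / c1\<^sup>2)"
  have c1: "0 < c1" using pos by (simp add: c1_def)
  have mc: "1 \<le> mc"
  proof -
    have "1 * 1 * 1 \<le> 13 * real (a + 1) ^ 4 * (4096 * U)\<^sup>2"
      using pos by (intro mult_mono one_le_power) auto
    then show ?thesis by (simp add: mc_def)
  qed
  show ?thesis
  proof (rule that[of K "2 * C2 / c1"])
    show "0 \<le> K" using mc pos by (simp add: K_def C4_def)
    fix P Q :: "vec measure" and q n m :: nat and f :: "real \<Rightarrow> real" and s0 B y :: real
      and k :: "vec \<Rightarrow> vec \<Rightarrow> real" and \<Omega> :: "'w measure" and X Y :: "nat \<Rightarrow> 'w \<Rightarrow> vec"
    assume rp: "radial_pair P Q q U a f s0 B k" and samples: "two_samples q \<Omega> X Y P Q"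
      and n: "2 \<le> n" and m: "2 \<le> m" and q: "1 \<le> q"
      and mean: "\<And>i. i \<in> {1..q} \<Longrightarrow> mean P i = mean Q i"
      and A: "s0\<^sup>2 = mean_sq_dist q P Q" and k: "kernel_on q k"
      and AL: "L * real q \<le> s0\<^sup>2" and AU: "s0\<^sup>2 \<le> Ud * real q"
      and y: "1 \<le> y" "y\<^sup>2 \<le> real q" "2 * C2 / c1 \<le> y"
      and tau: "\<bar>centered_sq_norm q P - centered_sq_norm q Q\<bar> \<le> U3 * y"
      and gap: "0 < frobenius q (\<lambda>i j. covariance P i j - covariance Q i j)"
      and signal: "2 * L3\<^sup>2 * y\<^sup>2 \<le> 2 * (centered_sq_norm q P - centered_sq_norm q Q)\<^sup>2
         + 4 * (frobenius q (\<lambda>i j. covariance P i j - covariance Q i j))\<^sup>2"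
      and BB: "B * \<bar>f s0\<bar> \<le> B' * \<bar>f s0\<bar>" and beta: "\<bar>f s0\<bar> \<le> B3 * \<bar>radial_profile.beta f s0\<bar>"
    interpret R: radial_pair P Q q U a f s0 B k by (rule rp)
    define x where "x = real q"
    define f0 where "f0 = \<bar>f s0\<bar>"
    define e where "e = - kernel_signed k P Q"
    have x: "1 \<le> x" using q by (simp add: x_def)
    have yx: "y\<^sup>2 \<le> x" using y by (simp add: x_def)
    have m1: "1 \<le> R.moment_const" by (rule R.moment_const_ge_1)
    have mc': "R.moment_const = mc" by (simp add: mc_def R.moment_const_def)
    note tau' = tau[folded R.tau_def] and gap' = gap[folded R.cov_gap_def]
      and signal' = signal[folded R.tau_def R.cov_gap_def]
    note ee = R.energy_expansion[OF mean A, unfolded mc', folded x_def]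
    note pp = R.energy_positive[OF mean A k gap']
    have f0: "0 < f0" using pp(2) by (simp add: f0_def)
    have epos: "0 < e" using pp(1) by (simp add: e_def)
    have F: "0 \<le> R.F" "R.F \<le> B' * f0" using R.F_nonneg BB by (auto simp: R.F_def f0_def)
    have s: "0 < s0\<^sup>2" "L * x \<le> s0\<^sup>2" "s0\<^sup>2 \<le> Ud * x" using R.s0 AL AU by (auto simp: x_def)
    have Lx: "0 < L * x" using pos x by simp
    have tp: "\<bar>R.tau\<bar> ^ i \<le> U3 ^ i * y ^ i" for i
      using power_mono[OF tau', of i] by (simp add: power_mult_distrib)
    have y3: "y ^ 3 \<le> x * y" using yx y by (simp add: power3_eq_cube power2_eq_square mult_right_mono)
    have y4: "y ^ 4 \<le> x\<^sup>2" using power_mono[OF yx, of 2] by (simp flip: power_mult)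
    have num3: "mc * x + 3 * \<bar>R.tau\<bar> * (mc * x) + \<bar>R.tau\<bar> ^ 3 \<le> C3 * (x * y)"
    proof -
      have "mc * x * 1 \<le> mc * x * y" using mc x y by (intro mult_left_mono) auto
      moreover have "3 * \<bar>R.tau\<bar> * (mc * x) \<le> 3 * (U3 * y) * (mc * x)"
        using tau' mc x by (intro mult_right_mono mult_left_mono) auto
      moreover have "U3 ^ 3 * y ^ 3 \<le> U3 ^ 3 * (x * y)" using y3 pos by (intro mult_left_mono) auto
      ultimately show ?thesis using tp[of 3] by (simp add: C3_def algebra_simps)
    qed
    have C30: "0 \<le> C3" using mc pos by (simp add: C3_def)
    have M3: "(mc * x + 3 * \<bar>R.tau\<bar> * (mc * x) + \<bar>R.tau\<bar> ^ 3) / (s0\<^sup>2) ^ 3 \<le> C3 / L ^ 3 * (y / x\<^sup>2)"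
    proof -
      have "(mc * x + 3 * \<bar>R.tau\<bar> * (mc * x) + \<bar>R.tau\<bar> ^ 3) / (s0\<^sup>2) ^ 3 \<le> C3 * (x * y) / (L * x) ^ 3"
        using num3 s Lx C30 x y pos by (intro frac_le power_mono mult_nonneg_nonneg) auto
      also have "\<dots> = C3 / L ^ 3 * (y / x\<^sup>2)"
        using pos x by (simp add: power_mult_distrib field_simps power2_eq_square power3_eq_cube)
      finally show ?thesis .
    qed
    have M4: "48 * (mc * x\<^sup>2 + R.tau ^ 4) / (s0\<^sup>2) ^ 4 \<le> 48 * (mc + U3 ^ 4) / L ^ 4 * (y / x\<^sup>2)"
    proof -
      have "U3 ^ 4 * y ^ 4 \<le> U3 ^ 4 * x\<^sup>2" using y4 pos by (intro mult_left_mono) auto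
      then have "R.tau ^ 4 \<le> U3 ^ 4 * x\<^sup>2" using tp[of 4] by simp
      then have "48 * (mc * x\<^sup>2 + R.tau ^ 4) \<le> 48 * (mc + U3 ^ 4) * x\<^sup>2" by (simp add: algebra_simps)
      then have "48 * (mc * x\<^sup>2 + R.tau ^ 4) / (s0\<^sup>2) ^ 4 \<le> 48 * (mc + U3 ^ 4) * x\<^sup>2 / (L * x) ^ 4"
        using s Lx mc pos x by (intro frac_le power_mono mult_nonneg_nonneg) auto
      also have "\<dots> = 48 * (mc + U3 ^ 4) / L ^ 4 * (1 / x\<^sup>2)"
        using pos x by (simp add: power_mult_distrib field_simps power2_eq_square power4_eq_xxxx)
      also have "\<dots> \<le> 48 * (mc + U3 ^ 4) / L ^ 4 * (y / x\<^sup>2)"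
        using mc pos y by (intro mult_left_mono divide_right_mono) auto
      finally show ?thesis .
    qed
    have noise: "4 * R.F * ((mc * x + 3 * \<bar>R.tau\<bar> * (mc * x) + \<bar>R.tau\<bar> ^ 3) / (s0\<^sup>2) ^ 3
      + 48 * (mc * x\<^sup>2 + R.tau ^ 4) / (s0\<^sup>2) ^ 4) \<le> f0 * C2 * (y / x\<^sup>2)"
    proof -
      have "4 * R.F * ((mc * x + 3 * \<bar>R.tau\<bar> * (mc * x) + \<bar>R.tau\<bar> ^ 3) / (s0\<^sup>2) ^ 3
        + 48 * (mc * x\<^sup>2 + R.tau ^ 4) / (s0\<^sup>2) ^ 4)
        \<le> 4 * (B' * f0) * (C3 / L ^ 3 * (y / x\<^sup>2) + 48 * (mc + U3 ^ 4) / L ^ 4 * (y / x\<^sup>2))"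
        using F M3 M4 mc x pos f0 by (intro mult_mono add_mono mult_left_mono add_nonneg_nonneg divide_nonneg_nonneg mult_nonneg_nonneg) auto
      also have "\<dots> = f0 * C2 * (y / x\<^sup>2)" unfolding C2_def by (simp only: ring_distribs mult_ac)
      finally show ?thesis .
    qed
    have sig: "f0 * c1 * (y\<^sup>2 / x\<^sup>2) \<le> \<bar>R.beta * (2 * R.tau\<^sup>2 + 4 * R.cov_gap\<^sup>2) / (s0\<^sup>2)\<^sup>2\<bar>"
    proof -
      have "f0 * c1 * (y\<^sup>2 / x\<^sup>2) = f0 / B3 * (2 * L3\<^sup>2 * y\<^sup>2) / (Ud * x)\<^sup>2"
        by (simp add: c1_def power_mult_distrib)
      also have "\<dots> \<le> \<bar>R.beta\<bar> * (2 * R.tau\<^sup>2 + 4 * R.cov_gap\<^sup>2) / (s0\<^sup>2)\<^sup>2"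
        using beta signal' s pos f0
        by (intro frac_le mult_mono power_mono) (auto simp: f0_def pos_divide_le_eq mult.commute)
      finally show ?thesis by (simp add: abs_mult)
    qed
    have "f0 * c1 * (y\<^sup>2 / x\<^sup>2) - f0 * C2 * (y / x\<^sup>2) \<le> e"
      using sig ee(1) noise epos unfolding e_def[symmetric] by linarith
    moreover have "f0 * C2 * (y / x\<^sup>2) \<le> f0 * (c1 / 2 * y) * (y / x\<^sup>2)"
      using y(1,3) c1 f0 x by (intro mult_right_mono mult_left_mono) (auto simp: field_simps)
    ultimately have elow: "f0 * (c1 / 2) * (y\<^sup>2 / x\<^sup>2) \<le> e"
      by (simp add: power2_eq_square algebra_simps)
    \<comment> \<open>the mean square of \<open>k - f s0\<close>, by the Lipschitz bound on the profile\<close>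
    define v where "v = R.F\<^sup>2 * ((mc * x + R.tau\<^sup>2) / (s0\<^sup>2)\<^sup>2)"
    have vle: "v \<le> C4 * f0\<^sup>2 / x"
    proof -
      have "U3\<^sup>2 * y\<^sup>2 \<le> U3\<^sup>2 * x" using yx by (intro mult_left_mono) auto
      then have "mc * x + R.tau\<^sup>2 \<le> (mc + U3\<^sup>2) * x" using tp[of 2] by (simp add: algebra_simps)
      then have "v \<le> (B' * f0)\<^sup>2 * ((mc + U3\<^sup>2) * x / (L * x)\<^sup>2)"
        unfolding v_def using F s Lx mc x pos by (intro mult_mono power_mono frac_le) auto
      also have "\<dots> = C4 * f0\<^sup>2 / x"
        using x pos by (simp add: C4_def power_mult_distrib power2_eq_square mult_ac)
      finally show ?thesis .
    qed
    interpret E: two_sample_energy P Q q U a f s0 B k \<Omega> X Y n m v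
    proof unfold_locales
      show "two_samples q \<Omega> X Y P Q" "2 \<le> n" "2 \<le> m" by fact+
      show "\<And>P1 P2. P1 \<in> {P, Q} \<Longrightarrow> P2 \<in> {P, Q} \<Longrightarrow>
        integrable (P1 \<Otimes>\<^sub>M P2) (\<lambda>z. k (fst z) (snd z)) \<and>
        integrable (P1 \<Otimes>\<^sub>M P2) (\<lambda>z. (k (fst z) (snd z) - f s0)\<^sup>2) \<and>
        (\<integral>z. (k (fst z) (snd z) - f s0)\<^sup>2 \<partial>(P1 \<Otimes>\<^sub>M P2)) \<le> v"
        unfolding v_def by (rule ee(2))
    qed
    have "4 * (32 + 18 * C\<^sup>2) * v / (E.\<mu> * e\<^sup>2) \<le> K * (x ^ 3 / y ^ 4) / E.\<mu>"
    proof -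
      define l where "l = f0 * (c1 / 2) * (y\<^sup>2 / x\<^sup>2)"
      have l: "0 < l" using f0 c1 y x by (simp add: l_def)
      have "v / e\<^sup>2 \<le> (C4 * f0\<^sup>2 / x) / l\<^sup>2"
        using vle E.v_nonneg elow l unfolding l_def[symmetric] by (intro frac_le power_mono) auto
      also have "\<dots> = 4 * C4 / c1\<^sup>2 * (x ^ 3 / y ^ 4)"
        using f0 c1 y x by (simp add: l_def field_simps power2_eq_square power3_eq_cube power4_eq_xxxx)
      finally have "v / e\<^sup>2 \<le> 4 * C4 / c1\<^sup>2 * (x ^ 3 / y ^ 4)" .
      then have "4 * (32 + 18 * C\<^sup>2) * (v / e\<^sup>2) \<le> K * (x ^ 3 / y ^ 4)"
        unfolding K_def by (simp only: mult.assoc) (intro mult_left_mono; simp)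
      then have "4 * (32 + 18 * C\<^sup>2) * (v / e\<^sup>2) / E.\<mu> \<le> K * (x ^ 3 / y ^ 4) / E.\<mu>"
        using E.\<mu> by (intro divide_right_mono) auto
      then show ?thesis by (simp add: mult.commute)
    qed
    then show "1 - K * (real q ^ 3 / y ^ 4) / real (min n m)
      \<le> measure \<Omega> {\<omega> \<in> space \<Omega>. C < T_stat q k n m (\<lambda>i. X i \<omega>) (\<lambda>j. Y j \<omega>)}"
      using E.T_probability[OF pos(8)] epos by (simp add: E.e_def[folded e_def] E.\<mu>_def x_def)
  qed
qed

lemma moment_law:
  assumes "prob_space P" "sets P = sets (Rp q)"
    and "\<And>j r. j \<in> {1..q} \<Longrightarrow> r \<in> {1..128::nat} \<Longrightarrow> integrable P (\<lambda>x. \<bar>x j\<bar> ^ r) \<and> (\<integral>x. \<bar>x j\<bar> ^ r \<partial>P) < U"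
  shows "vector_law P q (max 1 U)"
proof -
  interpret prob_space P by fact
  show ?thesis
  proof
    fix j assume j: "j \<in> {1..q}"
    show "integrable P (\<lambda>x. x j ^ 8)" "expectation (\<lambda>x. x j ^ 8) \<le> max 1 U"
      using assms(3)[OF j, of 8] by (auto simp: power_even_abs)
  qed (use assms in auto)
qed

text \<open>As the share of the first sample tends to a number strictly between zero and one, both samples
grow proportionally to the pooled sample.\<close>

lemma sample_size_ratio:
  assumes rho: "0 < \<rho>" "\<rho> < 1"
    and n: "filterlim n at_top sequentially" and m: "filterlim m at_top sequentially"
    and ratio: "(\<lambda>\<nu>. real (n \<nu>) / real (n \<nu> + m \<nu>) - \<rho>) \<in> O(\<lambda>\<nu>. 1 / real (n \<nu> + m \<nu>))"
  shows "\<forall>\<^sub>F \<nu> in sequentially. min \<rho> (1 - \<rho>) / 2 * real (n \<nu> + m \<nu>) \<le> real (min (n \<nu>) (m \<nu>))"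
proof -
  have N: "filterlim (\<lambda>\<nu>. n \<nu> + m \<nu>) at_top sequentially"
    by (rule filterlim_at_top_mono[OF n]) auto
  have "filterlim (\<lambda>\<nu>. real (n \<nu> + m \<nu>)) at_top sequentially"
    by (rule filterlim_compose[OF filterlim_real_sequentially N])
  then have "(\<lambda>\<nu>. 1 / real (n \<nu> + m \<nu>)) \<longlonglongrightarrow> 0"
    by (intro tendsto_divide_0[OF tendsto_const] filterlim_at_top_imp_at_infinity)
  then have "(\<lambda>\<nu>. 1 / real (n \<nu> + m \<nu>)) \<in> o(\<lambda>_. 1)"
    by (intro smalloI_tendsto) auto
  from landau_o.big_small_trans[OF ratio this]
  have "(\<lambda>\<nu>. real (n \<nu>) / real (n \<nu> + m \<nu>) - \<rho>) \<longlonglongrightarrow> 0"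
    by (auto dest: smalloD_tendsto)
  then have *: "\<forall>\<^sub>F \<nu> in sequentially. \<bar>real (n \<nu>) / real (n \<nu> + m \<nu>) - \<rho>\<bar> < min \<rho> (1 - \<rho>) / 2"
    using rho tendstoD[of "\<lambda>\<nu>. real (n \<nu>) / real (n \<nu> + m \<nu>) - \<rho>" 0 sequentially "min \<rho> (1 - \<rho>) / 2"]
    by (simp add: dist_real_def)
  have "\<forall>\<^sub>F \<nu> in sequentially. 1 \<le> n \<nu>" using n by (simp add: filterlim_at_top)
  with * show ?thesis
  proof eventually_elim
    case (elim \<nu>)
    define N where "N = real (n \<nu> + m \<nu>)"
    define r where "r = real (n \<nu>) / N"
    define \<kappa> where "\<kappa> = min \<rho> (1 - \<rho>) / 2"
    have N: "0 < N" using elim by (simp add: N_def)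
    have nr: "real (n \<nu>) = r * N" "real (m \<nu>) = (1 - r) * N"
      using N by (simp_all add: r_def left_diff_distrib N_def)
    have "\<bar>r - \<rho>\<bar> < \<kappa>" using elim by (simp add: r_def N_def \<kappa>_def)
    then have "\<kappa> \<le> r" "\<kappa> \<le> 1 - r" by (auto simp: \<kappa>_def min_def abs_if split: if_splits)
    then have "\<kappa> * N \<le> real (n \<nu>)" "\<kappa> * N \<le> real (m \<nu>)"
      unfolding nr using N by (auto intro: mult_right_mono)
    then show ?case by (simp add: \<kappa>_def N_def)
  qed
qed

lemma growth_limit:
  fixes p N :: "nat \<Rightarrow> nat" and \<beta> :: real
  assumes "(\<lambda>\<nu>. real (p \<nu>)) \<in> o(\<lambda>\<nu>. real (N \<nu>) powr (1 / \<beta>))" "0 < \<beta>"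
  shows "(\<lambda>\<nu>. real (p \<nu>) powr \<beta> / real (N \<nu>)) \<longlonglongrightarrow> 0"
proof -
  have "(\<lambda>\<nu>. real (p \<nu>) / real (N \<nu>) powr (1 / \<beta>)) \<longlonglongrightarrow> 0"
    by (rule smalloD_tendsto[OF assms(1)])
  then have "(\<lambda>\<nu>. (real (p \<nu>) / real (N \<nu>) powr (1 / \<beta>)) powr \<beta>) \<longlonglongrightarrow> 0"
    by (rule tendsto_zero_powrI[OF _ tendsto_const]) (use assms(2) in auto)
  moreover have "(real (p \<nu>) / real (N \<nu>) powr (1 / \<beta>)) powr \<beta> = real (p \<nu>) powr \<beta> / real (N \<nu>)" for \<nu>
    using assms(2) by (simp add: powr_divide powr_powr)
  ultimately show ?thesis by simp
qed

theorem proposition23: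
  fixes \<C> :: "kernel_seq set"
    and f :: "kernel_seq \<Rightarrow> nat \<Rightarrow> real \<Rightarrow> real"
    and D0 :: "nat \<Rightarrow> real set"
    and M :: "nat \<Rightarrow> 'w measure"
    and X Y :: "nat \<Rightarrow> nat \<Rightarrow> 'w \<Rightarrow> vec"
    and PX PY :: "nat \<Rightarrow> vec measure"
    and \<alpha> n m p :: "nat \<Rightarrow> nat"
    and \<rho> \<delta>3 \<delta>4 L3 U3 :: real
  assumes rho: "0 < \<rho>" "\<rho> < 1"
    and samples: "\<And>q. 1 \<le> q \<Longrightarrow> two_samples q (M q) (X q) (Y q) (PX q) (PY q)"
    and kernels: "\<And>k q. k \<in> \<C> \<Longrightarrow> 1 \<le> q \<Longrightarrow> kernel_on q (k q)"
    and radial: "\<And>k q x y. k \<in> \<C> \<Longrightarrow> 1 \<le> q \<Longrightarrow> x \<in> space (Rp q) \<Longrightarrow> y \<in> space (Rp q) \<Longrightarrow>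
                   k q x y = f k q (edist q x y)"
    and D0: "\<And>q. 1 \<le> q \<Longrightarrow> D0 q \<subseteq> {0..}"
      "\<And>q. 1 \<le> q \<Longrightarrow>
         sqrt (mean_sq_dist q (mixture \<rho> (PX q) (PY q)) (mixture \<rho> (PX q) (PY q))) \<in> D0 q"
      "\<And>q. 1 \<le> q \<Longrightarrow> sqrt (mean_sq_dist q (PX q) (PY q)) \<in> D0 q"
    and K1: "\<And>k q. k \<in> \<C> \<Longrightarrow> 1 \<le> q \<Longrightarrow> taylor_condition (D0 q) (f k q)"
    and K2: "\<exists>B. \<forall>k\<in>\<C>. \<forall>q\<ge>1. derivative_bound B (D0 q) (f k q)"
    and K3: "\<exists>B. \<forall>k\<in>\<C>. \<forall>q\<ge>1. derivative_nondegenerate B (D0 q) (f k q)"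
    and D1: "dependence_condition \<alpha> PX PY"
    and D2: "moment_condition PX PY"
    and D3: "distance_condition PX PY"
    and D4: "covariance_condition \<alpha> PX PY"
    and alpha_bounded: "(\<lambda>q. real (\<alpha> q)) \<in> O(\<lambda>_. 1)"
    and Delta: "\<And>q. 1 \<le> q \<Longrightarrow> L2_set (\<lambda>i. mean (PX q) i - mean (PY q) i) {1..q} = 0"
    and constants: "0 < L3" "0 < U3"
    and exponents: "0 \<le> \<delta>3" "\<delta>3 < 1" "0 \<le> \<delta>4" "\<delta>4 < 1" "\<delta>3 \<noteq> \<delta>4" "0 < max \<delta>3 \<delta>4"
    and trace_diff:
      "\<And>q. 1 \<le> q \<Longrightarrow>
         L3 * real q powr (\<delta>3 / 2) \<le> \<bar>centered_sq_norm q (PX q) - centered_sq_norm q (PY q)\<bar>"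
      "\<And>q. 1 \<le> q \<Longrightarrow>
         \<bar>centered_sq_norm q (PX q) - centered_sq_norm q (PY q)\<bar> \<le> U3 * real q powr (\<delta>3 / 2)"
    and cov_diff:
      "\<And>q. 1 \<le> q \<Longrightarrow>
         L3 * real q powr (\<delta>4 / 2)
           \<le> frobenius q (\<lambda>i j. covariance (PX q) i j - covariance (PY q) i j)"
      "\<And>q. 1 \<le> q \<Longrightarrow>
         frobenius q (\<lambda>i j. covariance (PX q) i j - covariance (PY q) i j)
           \<le> U3 * real q powr (\<delta>4 / 2)"
    and fourth_moment:
      "\<And>k q. k \<in> \<C> \<Longrightarrow> 1 \<le> q \<Longrightarrow>
         integrable (mixture \<rho> (PX q) (PY q) \<Otimes>\<^sub>M mixture \<rho> (PX q) (PY q))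
           (\<lambda>z. (k q (fst z) (snd z)) ^ 4)"
    and regime: "filterlim n at_top sequentially" "filterlim m at_top sequentially"
      "filterlim p at_top sequentially"
    and ratio: "(\<lambda>\<nu>. real (n \<nu>) / real (n \<nu> + m \<nu>) - \<rho>) \<in> O(\<lambda>\<nu>. 1 / real (n \<nu> + m \<nu>))"
    and growth: "(\<lambda>\<nu>. real (p \<nu>)) \<in>
                   o(\<lambda>\<nu>. real (n \<nu> + m \<nu>) powr (1 / (3 - 2 * max \<delta>3 \<delta>4)))"
  shows "\<forall>k\<in>\<C>. \<forall>C>0.
           (\<lambda>\<nu>. measure (M (p \<nu>))
                  {\<omega> \<in> space (M (p \<nu>)).
                     T_stat (p \<nu>) (k (p \<nu>)) (n \<nu>) (m \<nu>)
                       (\<lambda>i. X (p \<nu>) i \<omega>) (\<lambda>j. Y (p \<nu>) j \<omega>) > C})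
           \<longlonglongrightarrow> 1"
proof (intro ballI allI impI)
  fix k and C :: real
  assume kC: "k \<in> \<C>" and C: "0 < C"
  define \<delta> where "\<delta> = max \<delta>3 \<delta>4"
  have \<delta>: "0 < \<delta>" "\<delta> < 1" using exponents by (auto simp: \<delta>_def)
  obtain U where mom: "\<And>q P j r. \<lbrakk>1 \<le> q; P \<in> {PX q, PY q}; j \<in> {1..q}; r \<in> {1..128::nat}\<rbrakk> \<Longrightarrow>
      integrable P (\<lambda>x. \<bar>x j\<bar> ^ r) \<and> (\<integral>x. \<bar>x j\<bar> ^ r \<partial>P) < U"
    using D2 unfolding moment_condition_def by blast
  obtain L Ud where L: "0 < L" "0 < Ud" and dist: "\<And>q. 1 \<le> q \<Longrightarrow>
      L * real q \<le> mean_sq_dist q (PX q) (PY q) \<and> mean_sq_dist q (PX q) (PY q) \<le> Ud * real q"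
    using D3 unfolding distance_condition_def by blast
  obtain B2 where B2: "\<And>q. 1 \<le> q \<Longrightarrow> derivative_bound B2 (D0 q) (f k q)"
    using K2 kC by blast
  obtain B3 where B3: "\<And>q. 1 \<le> q \<Longrightarrow> derivative_nondegenerate B3 (D0 q) (f k q)"
    using K3 kC by blast
  obtain ca where "\<forall>\<^sub>F q in sequentially. norm (real (\<alpha> q)) \<le> ca * norm (1::real)"
    using alpha_bounded by (elim landau_o.bigE)
  then have "\<forall>\<^sub>F q in sequentially. \<alpha> q \<le> nat \<lceil>ca\<rceil>"
    by eventually_elim (simp add: nat_ceiling_le_eq le_nat_iff; linarith)
  then obtain q0 where \<alpha>: "\<And>q. q0 \<le> q \<Longrightarrow> \<alpha> q \<le> nat \<lceil>ca\<rceil>"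
    by (auto simp: eventually_sequentially)
  define s0 where "s0 q = sqrt (mean_sq_dist q (PX q) (PY q))" for q
  define y where "y q = real q powr (\<delta> / 2)" for q
  have pos: "(1::real) \<le> max 1 U" "0 < L" "0 < Ud" "0 < L3" "0 < U3" "0 < max 1 B2" "0 < max 1 B3" "0 < C"
    using L C constants by auto
  obtain K y0 where K: "0 \<le> K" and bound:
    "\<And>P Q q f s0 B k (\<Omega> :: 'w measure) X Y n m y.
      \<lbrakk>radial_pair P Q q (max 1 U) (nat \<lceil>ca\<rceil>) f s0 B k; two_samples q \<Omega> X Y P Q; 2 \<le> n; 2 \<le> m; 1 \<le> q;
       \<And>i. i \<in> {1..q} \<Longrightarrow> mean P i = mean Q i; s0\<^sup>2 = mean_sq_dist q P Q; kernel_on q k;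
       L * real q \<le> s0\<^sup>2; s0\<^sup>2 \<le> Ud * real q; 1 \<le> y; y\<^sup>2 \<le> real q; y0 \<le> y;
       \<bar>centered_sq_norm q P - centered_sq_norm q Q\<bar> \<le> U3 * y;
       0 < frobenius q (\<lambda>i j. covariance P i j - covariance Q i j);
       2 * L3\<^sup>2 * y\<^sup>2 \<le> 2 * (centered_sq_norm q P - centered_sq_norm q Q)\<^sup>2
         + 4 * (frobenius q (\<lambda>i j. covariance P i j - covariance Q i j))\<^sup>2;
       B * \<bar>f s0\<bar> \<le> max 1 B2 * \<bar>f s0\<bar>; \<bar>f s0\<bar> \<le> max 1 B3 * \<bar>radial_profile.beta f s0\<bar>\<rbrakk>
      \<Longrightarrow> 1 - K * (real q ^ 3 / y ^ 4) / real (min n m)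
        \<le> measure \<Omega> {\<omega> \<in> space \<Omega>. C < T_stat q k n m (\<lambda>i. X i \<omega>) (\<lambda>j. Y j \<omega>)}"
    using fixed_dimension_bound[OF pos] by blast
  have dim: "1 - K * (real q ^ 3 / y q ^ 4) / real (min n m)
      \<le> measure (M q) {\<omega> \<in> space (M q). C < T_stat q (k q) n m (\<lambda>i. X q i \<omega>) (\<lambda>j. Y q j \<omega>)}"
    if q: "1 \<le> q" "q0 \<le> q" "y0 \<le> y q" and nm: "2 \<le> n" "2 \<le> m" for q n m
  proof (rule bound[of "PX q" "PY q" q "f k q" "s0 q" B2 "k q"])
    have sam: "two_samples q (M q) (X q) (Y q) (PX q) (PY q)" by (rule samples[OF q(1)])
    have prob: "prob_space P \<and> sets P = sets (Rp q)" if "P \<in> {PX q, PY q}" for P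
    proof -
      interpret M: prob_space "M q" using sam by (simp add: two_samples_def)
      have "case_sum (X q) (Y q) l \<in> M q \<rightarrow>\<^sub>M Rp q" for l
        using sam unfolding two_samples_def M.indep_vars_def by auto
      \<comment> \<open>the spare observations of index 0 already exhibit the two laws as distributions\<close>
      from M.prob_space_distr[OF this[of "Inl 0"]] M.prob_space_distr[OF this[of "Inr 0"]]
      have "prob_space (distr (M q) (Rp q) (X q 0))" "prob_space (distr (M q) (Rp q) (Y q 0))" by auto
      moreover have "distr (M q) (Rp q) (X q 0) = PX q" "distr (M q) (Rp q) (Y q 0) = PY q"
        using sam by (auto simp: two_samples_def)
      ultimately show ?thesis using that sets_distr[of "M q" "Rp q"] by (metis insertE singletonD)
    qed
    have law: "vector_law P q (max 1 U)" if "P \<in> {PX q, PY q}" for P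
      using prob[OF that] mom[OF q(1) that] by (intro moment_law) auto
    have lag: "lag_independent q (nat \<lceil>ca\<rceil>) (PX q)" "lag_independent q (nat \<lceil>ca\<rceil>) (PY q)"
      using D1 q(1) \<alpha>[OF q(2)] unfolding dependence_condition_def
      by (auto intro: lag_independent_mono)
    have A: "(s0 q)\<^sup>2 = mean_sq_dist q (PX q) (PY q)"
      by (simp add: s0_def mean_sq_dist_def)
    have Apos: "0 < mean_sq_dist q (PX q) (PY q)"
    proof -
      have "0 < L * real q" using L q(1) by simp
      then show ?thesis using dist[OF q(1)] by linarith
    qed
    have s0: "0 < s0 q" using Apos by (simp add: s0_def)
    have sD: "s0 q \<in> D0 q" using D0(3)[OF q(1)] by (simp add: s0_def)
    show "radial_pair (PX q) (PY q) q (max 1 U) (nat \<lceil>ca\<rceil>) (f k q) (s0 q) B2 (k q)"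
    proof (intro radial_pair.intro law_pair.intro law law_pair_axioms.intro lag radial_profile.intro s0 radial_pair_axioms.intro)
      show "taylor_condition {s0 q} (f k q)"
        using K1[OF kC q(1)] sD unfolding taylor_condition_def by blast
      show "derivative_bound B2 {s0 q} (f k q)"
        using B2[OF q(1)] sD unfolding derivative_bound_def by blast
    qed (auto intro: radial[OF kC q(1)])
    then interpret R: radial_pair "PX q" "PY q" q "max 1 U" "nat \<lceil>ca\<rceil>" "f k q" "s0 q" B2 "k q" .
    show "two_samples q (M q) (X q) (Y q) (PX q) (PY q)" "2 \<le> n" "2 \<le> m" "1 \<le> q" "y0 \<le> y q"
      by (fact sam nm q)+
    show "(s0 q)\<^sup>2 = mean_sq_dist q (PX q) (PY q)" by (rule A)
    show "mean (PX q) i = mean (PY q) i" if "i \<in> {1..q}" for i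
      using Delta[OF q(1)] that by (simp add: L2_set_eq_0_iff)
    show "kernel_on q (k q)" by (rule kernels[OF kC q(1)])
    show "L * real q \<le> (s0 q)\<^sup>2" "(s0 q)\<^sup>2 \<le> Ud * real q" using dist[OF q(1)] by (auto simp: A)
    have q1: "1 \<le> real q" using q by simp
    show "1 \<le> y q" unfolding y_def using q1 \<delta> by (intro ge_one_powr_ge_zero) auto
    have ysq: "(y q)\<^sup>2 = real q powr \<delta>" using q1 by (simp add: y_def powr_power)
    show "(y q)\<^sup>2 \<le> real q" unfolding ysq using q1 \<delta> powr_mono[of \<delta> 1 "real q"] by simp
    have le: "real q powr (\<delta>3 / 2) \<le> y q" "real q powr (\<delta>4 / 2) \<le> y q"
      unfolding y_def using q1 by (auto simp: \<delta>_def intro!: powr_mono)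
    show "\<bar>centered_sq_norm q (PX q) - centered_sq_norm q (PY q)\<bar> \<le> U3 * y q"
      using trace_diff(2)[OF q(1)] mult_left_mono[OF le(1), of U3] constants by linarith
    have "0 < L3 * real q powr (\<delta>4 / 2)" using constants q1 by simp
    then show "0 < frobenius q (\<lambda>i j. covariance (PX q) i j - covariance (PY q) i j)"
      using cov_diff(1)[OF q(1)] by linarith
    have sq3: "L3\<^sup>2 * real q powr \<delta>3 \<le> (centered_sq_norm q (PX q) - centered_sq_norm q (PY q))\<^sup>2"
      using power_mono[OF trace_diff(1)[OF q(1)], of 2] constants q1
      by (simp add: power_mult_distrib powr_power)
    have sq4: "L3\<^sup>2 * real q powr \<delta>4 \<le> (frobenius q (\<lambda>i j. covariance (PX q) i j - covariance (PY q) i j))\<^sup>2"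
      using power_mono[OF cov_diff(1)[OF q(1)], of 2] constants q1
      by (simp add: power_mult_distrib powr_power)
    have "L3\<^sup>2 * real q powr \<delta> \<le> (centered_sq_norm q (PX q) - centered_sq_norm q (PY q))\<^sup>2 \<or>
      L3\<^sup>2 * real q powr \<delta> \<le> (frobenius q (\<lambda>i j. covariance (PX q) i j - covariance (PY q) i j))\<^sup>2"
      unfolding \<delta>_def max_def using sq3 sq4 by simp
    then show "2 * L3\<^sup>2 * (y q)\<^sup>2 \<le> 2 * (centered_sq_norm q (PX q) - centered_sq_norm q (PY q))\<^sup>2
         + 4 * (frobenius q (\<lambda>i j. covariance (PX q) i j - covariance (PY q) i j))\<^sup>2"
      unfolding ysq mult.assoc using zero_le_power2[of "centered_sq_norm q (PX q) - centered_sq_norm q (PY q)"]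
        zero_le_power2[of "frobenius q (\<lambda>i j. covariance (PX q) i j - covariance (PY q) i j)"]
      by (elim disjE) linarith+
    show "B2 * \<bar>f k q (s0 q)\<bar> \<le> max 1 B2 * \<bar>f k q (s0 q)\<bar>" by (intro mult_right_mono) auto
    have "\<bar>f k q (s0 q)\<bar> \<le> B3 * min \<bar>1/2 * nth_deriv 1 (f k q) (s0 q) * s0 q\<bar> \<bar>R.beta\<bar>"
      using B3[OF q(1)] sD unfolding derivative_nondegenerate_def R.beta_def R.g_def
      by (auto simp: diff_divide_distrib)
    also have "\<dots> \<le> max 1 B3 * min \<bar>1/2 * nth_deriv 1 (f k q) (s0 q) * s0 q\<bar> \<bar>R.beta\<bar>"
      by (intro mult_right_mono) auto
    also have "\<dots> \<le> max 1 B3 * \<bar>R.beta\<bar>" by (intro mult_left_mono) auto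
    finally show "\<bar>f k q (s0 q)\<bar> \<le> max 1 B3 * \<bar>radial_profile.beta (f k q) (s0 q)\<bar>" .
  qed
  define pr where "pr \<nu> = measure (M (p \<nu>)) {\<omega> \<in> space (M (p \<nu>)).
    T_stat (p \<nu>) (k (p \<nu>)) (n \<nu>) (m \<nu>) (\<lambda>i. X (p \<nu>) i \<omega>) (\<lambda>j. Y (p \<nu>) j \<omega>) > C}" for \<nu>
  define \<kappa> where "\<kappa> = min \<rho> (1 - \<rho>) / 2"
  have \<kappa>: "0 < \<kappa>" using rho by (simp add: \<kappa>_def)
  define g where "g \<nu> = K / \<kappa> * (real (p \<nu>) powr (3 - 2 * \<delta>) / real (n \<nu> + m \<nu>))" for \<nu>
  have g: "g \<longlonglongrightarrow> 0"
    unfolding g_def using growth_limit[OF growth] exponents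
    by (intro tendsto_mult_right_zero) (simp add: \<delta>_def)
  have "\<forall>\<^sub>F q in sequentially. max 1 y0 powr (2 / \<delta>) \<le> real q"
    using filterlim_real_sequentially by (simp add: filterlim_at_top)
  then have "\<forall>\<^sub>F q in sequentially. y0 \<le> y q"
  proof eventually_elim
    case (elim q)
    \<comment> \<open>the maximum keeps the base of the power positive\<close>
    have "y0 \<le> (max 1 y0 powr (2 / \<delta>)) powr (\<delta> / 2)" using \<delta> by (simp add: powr_powr)
    also have "\<dots> \<le> y q" unfolding y_def using elim \<delta> by (intro powr_mono2) auto
    finally show ?case .
  qed
  then have ev_y: "\<forall>\<^sub>F \<nu> in sequentially. y0 \<le> y (p \<nu>)"
    by (rule eventually_compose_filterlim[OF _ regime(3)])
  have ev: "\<forall>\<^sub>F \<nu> in sequentially. 1 \<le> p \<nu>" "\<forall>\<^sub>F \<nu> in sequentially. q0 \<le> p \<nu>"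
    "\<forall>\<^sub>F \<nu> in sequentially. 2 \<le> n \<nu>" "\<forall>\<^sub>F \<nu> in sequentially. 2 \<le> m \<nu>"
    using regime by (auto simp: filterlim_at_top)
  have lower: "\<forall>\<^sub>F \<nu> in sequentially. 1 - g \<nu> \<le> pr \<nu>"
    using ev ev_y sample_size_ratio[OF rho regime(1,2) ratio]
  proof eventually_elim
    case (elim \<nu>)
    have p1: "0 < real (p \<nu>)" using elim by simp
    have y4: "y (p \<nu>) ^ 4 = real (p \<nu>) powr (2 * \<delta>)" using p1 by (simp add: y_def powr_power)
    have pw: "real (p \<nu>) ^ 3 / y (p \<nu>) ^ 4 = real (p \<nu>) powr (3 - 2 * \<delta>)"
      unfolding y4 using p1 by (simp add: powr_diff powr_numeral)
    have "0 < \<kappa> * real (n \<nu> + m \<nu>)" using \<kappa> elim by simp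
    then have "K * real (p \<nu>) powr (3 - 2 * \<delta>) / real (min (n \<nu>) (m \<nu>))
      \<le> K * real (p \<nu>) powr (3 - 2 * \<delta>) / (\<kappa> * real (n \<nu> + m \<nu>))"
      using K \<kappa> elim unfolding \<kappa>_def[symmetric] by (intro divide_left_mono mult_nonneg_nonneg mult_pos_pos) auto
    also have "\<dots> = g \<nu>" by (simp add: g_def)
    finally show ?case using dim[of "p \<nu>" "n \<nu>" "m \<nu>"] elim unfolding pw pr_def by linarith
  qed
  have upper: "\<forall>\<^sub>F \<nu> in sequentially. pr \<nu> \<le> 1"
    using ev(1)
  proof eventually_elim
    case (elim \<nu>)
    interpret prob_space "M (p \<nu>)" using samples[OF elim] by (simp add: two_samples_def)
    show ?case unfolding pr_def by (rule prob_le_1)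
  qed
  have "(\<lambda>\<nu>. 1 - g \<nu>) \<longlonglongrightarrow> 1" using tendsto_diff[OF tendsto_const g, of 1] by simp
  from tendsto_sandwich[OF lower upper this tendsto_const]
  show "(\<lambda>\<nu>. measure (M (p \<nu>)) {\<omega> \<in> space (M (p \<nu>)).
    T_stat (p \<nu>) (k (p \<nu>)) (n \<nu>) (m \<nu>) (\<lambda>i. X (p \<nu>) i \<omega>) (\<lambda>j. Y (p \<nu>) j \<omega>) > C}) \<longlonglongrightarrow> 1"
    unfolding pr_def .
qed

end
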